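(* Let $\mathcal{C}$ be an abelian category with enough projective objects and let $\mathcal{D}$ be an abelian category in which all direct limits exist and are exact. Let $(T^{\bullet},\delta^{\bullet}):\mathcal{C}\to\mathcal{D}$ be any cohomological functor. Then a Mislin completion $(\widehat{T}^{\bullet},\widehat{\delta}^{\bullet})$ of $(T^{\bullet},\delta^{\bullet})$ exists, and it can be defined via the satellite functor construction, i.e. the cohomological functor $\widehat T^{\bullet}=\varinjlim_{m\in\mathbb{N}_0}T^{\bullet}\langle m\rangle$ together with the canonical morphism $T^{\bullet}\to\widehat T^{\bullet}$ is a Mislin completion of $(T^{\bullet},\delta^{\bullet})$.
   Context: A direct limit is a colimit over a directed set; direct limits are exact if they preserve short exact sequences of direct systems. A cohomological functor $(T^\bullet,\delta^\bullet):\mathcal C\to\mathcal D$ is a family of additive functors $(T^n:\mathcal C\to\mathcal D)_{n\in\mathbb Z}$ with, for each short exact sequence $0\to A\xrightarrow{\iota}B\xrightarrow{\pi}C\to0$ in $\mathcal C$ and each $n\in\mathbb Z$, a connecting homomorphism $\delta^n:T^n(C)\to T^{n+1}(A)$, natural in the short exact sequence, such that $\cdots\to T^n(A)\xrightarrow{T^n(\iota)}T^n(B)\xrightarrow{T^n(\pi)}T^n(C)\xrightarrow{\delta^n}T^{n+1}(A)\to\cdots$ is exact. A morphism of cohomological functors is a family of natural transformations $(\nu^n)_{n\in\mathbb Z}$ commuting with the connecting homomorphisms. A Mislin completion of $(T^\bullet,\delta^\bullet)$ is a cohomological functor $(\widehat T^\bullet,\widehat\delta^\bullet)$ from $\mathcal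 C$ to $\mathcal D$ with a morphism $\nu^\bullet:T^\bullet\to\widehat T^\bullet$ such that (1) $\widehat T^n(P)=0$ for all projective $P$ and all $n\in\mathbb Z$; (2) every morphism $T^\bullet\to U^\bullet$ to a cohomological functor $U^\bullet$ vanishing on projectives (in all degrees) factors uniquely through $\nu^\bullet$. Left satellites: for an additive functor $F:\mathcal C\to\mathcal D$ and $M\in\mathcal C$ choose a short exact sequence $0\to K\to P\to M\to0$ with $P$ projective and put $S^{-1}F(M)=\mathrm{Ker}(F(K)\to F(P))$ (independent of the choice up to canonical isomorphism); a morphism $M'\to M$ lifts to $P'\to P$, inducing $K'\to K$ and hence $S^{-1}F(M')\to S^{-1}F(M)$. Put $S^0F=F$ and $S^{-k}F=S^{-1}(S^{-k+1}F)$ for $k\ge 2$. For a short exact sequence $0\to A\to B\to C\to0$ and $k\ge0$, the connecting homomorphism $\varepsilon^{-k-1}:S^{-k-1}F(C)\to S^{-k}F(A)$ is the composite of the kernel inclusion $S^{-k-1}F(C)\to S^{-k}F(K)$ with $S^{-k}F(h^* )$, where $0\to K\to P\to C\to0$ is exact with $P$ projective, $h:P\to B$ lifts $\mathrm{id}_C$, and $h^*:K\to A$ is the induced morphism. Satellite functor construction: for $m\in\mathbb N_0$ let $T^\bullet\langle m\rangle$ be the cohomological functor with $T^k\langle m\rangle=T^k$ for $k\ge m$ and $T^k\langle m\rangle=S^{k-m}T^m$ for $k<m$, with connecting homomorphisms $\delta^k$ for $k\ge m$ and $\varepsilon^{k-m}$ for $k<m$. There are unique morphisms of cohomological functors $\Phi_m^\bullet:T^\bullet\to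 T^\bullet\langle m\rangle$ equal to the identity in degrees $\ge m$, and, for $m\le n$, $\Phi^\bullet_{m,n}:T^\bullet\langle m\rangle\to T^\bullet\langle n\rangle$ equal to the identity in degrees $\ge n$; they form a direct system. Then $\widehat T^\bullet=\varinjlim_{m\in\mathbb N_0}T^\bullet\langle m\rangle$ with connecting homomorphisms the direct limits of those of $T^\bullet\langle m\rangle$, and the canonical morphism $T^\bullet\to\widehat T^\bullet$ is the one induced by the $\Phi_m^\bullet$. *)

theory Defs
  imports "HOL-Algebra.Group" "HOL-Library.Infinite_Typeclass"
begin

section \<open>Abelian categories\<close>

text \<open>Objects and morphisms are carrier sets inside two types. \<^term>\<open>Plus\<close> is only meaningful
  for parallel morphisms and \<^term>\<open>ZeroMor C A B\<close> is the zero morphism from \<open>A\<close> to \<open>B\<close>.\<close>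

record ('o, 'm) ab_cat =
  Obj :: "'o set"
  Arr :: "'m set"
  Src :: "'m \<Rightarrow> 'o"
  Tgt :: "'m \<Rightarrow> 'o"
  Ident :: "'o \<Rightarrow> 'm"
  Comp :: "'m \<Rightarrow> 'm \<Rightarrow> 'm"  (infixl "\<cdot>\<index>" 70)
  Plus :: "'m \<Rightarrow> 'm \<Rightarrow> 'm"
  ZeroMor :: "'o \<Rightarrow> 'o \<Rightarrow> 'm"

definition Hom :: "('o, 'm) ab_cat \<Rightarrow> 'o \<Rightarrow> 'o \<Rightarrow> 'm set" where
  "Hom C A B = {f \<in> Arr C. Src C f = A \<and> Tgt C f = B}"

definition hom_group :: "('o, 'm) ab_cat \<Rightarrow> 'o \<Rightarrow> 'o \<Rightarrow> 'm monoid" where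
  "hom_group C A B = \<lparr>carrier = Hom C A B, monoid.mult = Plus C, one = ZeroMor C A B\<rparr>"

definition mono_mor :: "('o, 'm) ab_cat \<Rightarrow> 'm \<Rightarrow> bool" where
  "mono_mor C f \<longleftrightarrow> f \<in> Arr C \<and>
     (\<forall>X\<in>Obj C. \<forall>g\<in>Hom C X (Src C f). \<forall>h\<in>Hom C X (Src C f).
        f \<cdot>\<^bsub>C\<^esub> g = f \<cdot>\<^bsub>C\<^esub> h \<longrightarrow> g = h)"

definition epi_mor :: "('o, 'm) ab_cat \<Rightarrow> 'm \<Rightarrow> bool" where
  "epi_mor C f \<longleftrightarrow> f \<in> Arr C \<and>
     (\<forall>X\<in>Obj C. \<forall>g\<in>Hom C (Tgt C f) X. \<forall>h\<in>Hom C (Tgt C f) X.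
        g \<cdot>\<^bsub>C\<^esub> f = h \<cdot>\<^bsub>C\<^esub> f \<longrightarrow> g = h)"

definition zero_object :: "('o, 'm) ab_cat \<Rightarrow> 'o \<Rightarrow> bool" where
  "zero_object C Z \<longleftrightarrow> Z \<in> Obj C \<and>
     (\<forall>A\<in>Obj C. (\<exists>!f. f \<in> Hom C Z A) \<and> (\<exists>!f. f \<in> Hom C A Z))"

definition is_product :: "('o, 'm) ab_cat \<Rightarrow> 'o \<Rightarrow> 'o \<Rightarrow> 'o \<Rightarrow> 'm \<Rightarrow> 'm \<Rightarrow> bool" where
  "is_product C A B P p q \<longleftrightarrow> p \<in> Hom C P A \<and> q \<in> Hom C P B \<and>
     (\<forall>X\<in>Obj C. \<forall>f\<in>Hom C X A. \<forall>g\<in>Hom C X B.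
        \<exists>!h. h \<in> Hom C X P \<and> p \<cdot>\<^bsub>C\<^esub> h = f \<and> q \<cdot>\<^bsub>C\<^esub> h = g)"

definition is_kernel :: "('o, 'm) ab_cat \<Rightarrow> 'm \<Rightarrow> 'm \<Rightarrow> bool" where
  "is_kernel C f k \<longleftrightarrow> f \<in> Arr C \<and> k \<in> Arr C \<and> Tgt C k = Src C f \<and>
     f \<cdot>\<^bsub>C\<^esub> k = ZeroMor C (Src C k) (Tgt C f) \<and>
     (\<forall>X\<in>Obj C. \<forall>h\<in>Hom C X (Src C f). f \<cdot>\<^bsub>C\<^esub> h = ZeroMor C X (Tgt C f) \<longrightarrow>
        (\<exists>!u. u \<in> Hom C X (Src C k) \<and> k \<cdot>\<^bsub>C\<^esub> u = h))"

definition is_cokernel :: "('o, 'm) ab_cat \<Rightarrow> 'm \<Rightarrow> 'm \<Rightarrow> bool" where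
  "is_cokernel C f c \<longleftrightarrow> f \<in> Arr C \<and> c \<in> Arr C \<and> Src C c = Tgt C f \<and>
     c \<cdot>\<^bsub>C\<^esub> f = ZeroMor C (Src C f) (Tgt C c) \<and>
     (\<forall>X\<in>Obj C. \<forall>h\<in>Hom C (Tgt C f) X. h \<cdot>\<^bsub>C\<^esub> f = ZeroMor C (Src C f) X \<longrightarrow>
        (\<exists>!u. u \<in> Hom C (Tgt C c) X \<and> u \<cdot>\<^bsub>C\<^esub> c = h))"

locale category =
  fixes C :: "('o, 'm) ab_cat" (structure)
  assumes src_obj: "f \<in> Arr C \<Longrightarrow> Src C f \<in> Obj C"
    and tgt_obj: "f \<in> Arr C \<Longrightarrow> Tgt C f \<in> Obj C"
    and ident_hom: "A \<in> Obj C \<Longrightarrow> Ident C A \<in> Hom C A A"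
    and comp_hom: "f \<in> Hom C X Y \<Longrightarrow> g \<in> Hom C Y Z \<Longrightarrow> g \<cdot> f \<in> Hom C X Z"
    and ident_left: "f \<in> Hom C X Y \<Longrightarrow> Ident C Y \<cdot> f = f"
    and ident_right: "f \<in> Hom C X Y \<Longrightarrow> f \<cdot> Ident C X = f"
    and comp_assoc: "f \<in> Hom C W X \<Longrightarrow> g \<in> Hom C X Y \<Longrightarrow> h \<in> Hom C Y Z \<Longrightarrow>
      h \<cdot> (g \<cdot> f) = (h \<cdot> g) \<cdot> f"

locale preadditive_category = category +
  assumes hom_comm_group: "A \<in> Obj C \<Longrightarrow> B \<in> Obj C \<Longrightarrow> comm_group (hom_group C A B)"
    and comp_plus_left: "f \<in> Hom C X Y \<Longrightarrow> g \<in> Hom C Y Z \<Longrightarrow> h \<in> Hom C Y Z \<Longrightarrow>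
      Plus C g h \<cdot> f = Plus C (g \<cdot> f) (h \<cdot> f)"
    and comp_plus_right: "f \<in> Hom C X Y \<Longrightarrow> g \<in> Hom C X Y \<Longrightarrow> h \<in> Hom C Y Z \<Longrightarrow>
      h \<cdot> Plus C f g = Plus C (h \<cdot> f) (h \<cdot> g)"

locale abelian_category = preadditive_category +
  assumes ex_zero_object: "\<exists>Z. zero_object C Z"
    and ex_product: "A \<in> Obj C \<Longrightarrow> B \<in> Obj C \<Longrightarrow> \<exists>P p q. is_product C A B P p q"
    and ex_kernel: "f \<in> Arr C \<Longrightarrow> \<exists>k. is_kernel C f k"
    and ex_cokernel: "f \<in> Arr C \<Longrightarrow> \<exists>c. is_cokernel C f c"
    and mono_normal: "mono_mor C f \<Longrightarrow> \<exists>g. is_kernel C g f"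
    and epi_normal: "epi_mor C f \<Longrightarrow> \<exists>g. is_cokernel C g f"

text \<open>Exactness of \<open>f\<close> followed by \<open>g\<close>: the image of \<open>f\<close>, i.e. the kernel of its cokernel, is the
  kernel of \<open>g\<close>.\<close>

definition exact_pair :: "('o, 'm) ab_cat \<Rightarrow> 'm \<Rightarrow> 'm \<Rightarrow> bool" where
  "exact_pair C f g \<longleftrightarrow> Tgt C f = Src C g \<and>
     (\<exists>c k. is_cokernel C f c \<and> is_kernel C c k \<and> is_kernel C g k)"

definition short_exact :: "('o, 'm) ab_cat \<Rightarrow> 'm \<Rightarrow> 'm \<Rightarrow> bool" where
  "short_exact C \<iota> \<pi> \<longleftrightarrow> mono_mor C \<iota> \<and> exact_pair C \<iota> \<pi> \<and> epi_mor C \<pi>"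

definition projective :: "('o, 'm) ab_cat \<Rightarrow> 'o \<Rightarrow> bool" where
  "projective C P \<longleftrightarrow> P \<in> Obj C \<and>
     (\<forall>e f. epi_mor C e \<and> f \<in> Hom C P (Tgt C e) \<longrightarrow>
        (\<exists>g. g \<in> Hom C P (Src C e) \<and> e \<cdot>\<^bsub>C\<^esub> g = f))"

definition enough_projectives :: "('o, 'm) ab_cat \<Rightarrow> bool" where
  "enough_projectives C \<longleftrightarrow>
     (\<forall>M\<in>Obj C. \<exists>e. epi_mor C e \<and> Tgt C e = M \<and> projective C (Src C e))"


section \<open>Direct limits\<close>

definition directed_set :: "'i set \<Rightarrow> ('i \<times> 'i) set \<Rightarrow> bool" where
  "directed_set I r \<longleftrightarrow> I \<noteq> {} \<and> preorder_on I r \<and>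
     (\<forall>i\<in>I. \<forall>j\<in>I. \<exists>k\<in>I. (i, k) \<in> r \<and> (j, k) \<in> r)"

definition direct_system ::
  "('o, 'm) ab_cat \<Rightarrow> 'i set \<Rightarrow> ('i \<times> 'i) set \<Rightarrow> ('i \<Rightarrow> 'o) \<Rightarrow> ('i \<Rightarrow> 'i \<Rightarrow> 'm) \<Rightarrow> bool" where
  "direct_system D I r X \<phi> \<longleftrightarrow> directed_set I r \<and>
     (\<forall>i\<in>I. X i \<in> Obj D \<and> \<phi> i i = Ident D (X i)) \<and>
     (\<forall>i j. (i, j) \<in> r \<longrightarrow> \<phi> i j \<in> Hom D (X i) (X j)) \<and>
     (\<forall>i j k. (i, j) \<in> r \<and> (j, k) \<in> r \<longrightarrow> \<phi> j k \<cdot>\<^bsub>D\<^esub> \<phi> i j = \<phi> i k)"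

definition cocone ::
  "('o, 'm) ab_cat \<Rightarrow> 'i set \<Rightarrow> ('i \<times> 'i) set \<Rightarrow> ('i \<Rightarrow> 'o) \<Rightarrow> ('i \<Rightarrow> 'i \<Rightarrow> 'm)
    \<Rightarrow> 'o \<Rightarrow> ('i \<Rightarrow> 'm) \<Rightarrow> bool" where
  "cocone D I r X \<phi> L l \<longleftrightarrow> L \<in> Obj D \<and> (\<forall>i\<in>I. l i \<in> Hom D (X i) L) \<and>
     (\<forall>i j. (i, j) \<in> r \<longrightarrow> l j \<cdot>\<^bsub>D\<^esub> \<phi> i j = l i)"

definition is_direct_limit ::
  "('o, 'm) ab_cat \<Rightarrow> 'i set \<Rightarrow> ('i \<times> 'i) set \<Rightarrow> ('i \<Rightarrow> 'o) \<Rightarrow> ('i \<Rightarrow> 'i \<Rightarrow> 'm)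
    \<Rightarrow> 'o \<Rightarrow> ('i \<Rightarrow> 'm) \<Rightarrow> bool" where
  "is_direct_limit D I r X \<phi> L l \<longleftrightarrow> direct_system D I r X \<phi> \<and> cocone D I r X \<phi> L l \<and>
     (\<forall>Y y. cocone D I r X \<phi> Y y \<longrightarrow>
        (\<exists>!u. u \<in> Hom D L Y \<and> (\<forall>i\<in>I. u \<cdot>\<^bsub>D\<^esub> l i = y i)))"

text \<open>\<open>All direct limits\<close> means all small ones. The type argument plays the role of the universe:
  directed sets are arbitrary directed preorders on subsets of the type \<open>'i\<close>.\<close>

definition has_direct_limits :: "'i itself \<Rightarrow> ('o, 'm) ab_cat \<Rightarrow> bool" where
  "has_direct_limits _ D \<longleftrightarrow>
     (\<forall>(I :: 'i set) r X \<phi>. direct_system D I r X \<phi> \<longrightarrow> (\<exists>L l. is_direct_limit D I r X \<phi> L l))"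

definition direct_system_morphism ::
  "('o, 'm) ab_cat \<Rightarrow> 'i set \<Rightarrow> ('i \<times> 'i) set \<Rightarrow> ('i \<Rightarrow> 'o) \<Rightarrow> ('i \<Rightarrow> 'i \<Rightarrow> 'm)
    \<Rightarrow> ('i \<Rightarrow> 'o) \<Rightarrow> ('i \<Rightarrow> 'i \<Rightarrow> 'm) \<Rightarrow> ('i \<Rightarrow> 'm) \<Rightarrow> bool" where
  "direct_system_morphism D I r X \<phi> Y \<psi> \<alpha> \<longleftrightarrow>
     (\<forall>i\<in>I. \<alpha> i \<in> Hom D (X i) (Y i)) \<and>
     (\<forall>i j. (i, j) \<in> r \<longrightarrow> \<alpha> j \<cdot>\<^bsub>D\<^esub> \<phi> i j = \<psi> i j \<cdot>\<^bsub>D\<^esub> \<alpha> i)"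

definition exact_direct_limits :: "'i itself \<Rightarrow> ('o, 'm) ab_cat \<Rightarrow> bool" where
  "exact_direct_limits _ D \<longleftrightarrow>
     (\<forall>(I :: 'i set) r X \<phi> Y \<psi> Z \<chi> \<alpha> \<beta> L l M m N n u v.
        direct_system_morphism D I r X \<phi> Y \<psi> \<alpha> \<and> direct_system_morphism D I r Y \<psi> Z \<chi> \<beta> \<and>
        (\<forall>i\<in>I. short_exact D (\<alpha> i) (\<beta> i)) \<and>
        is_direct_limit D I r X \<phi> L l \<and> is_direct_limit D I r Y \<psi> M m \<and>
        is_direct_limit D I r Z \<chi> N n \<and>
        u \<in> Hom D L M \<and> (\<forall>i\<in>I. u \<cdot>\<^bsub>D\<^esub> l i = m i \<cdot>\<^bsub>D\<^esub> \<alpha> i) \<and>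
        v \<in> Hom D M N \<and> (\<forall>i\<in>I. v \<cdot>\<^bsub>D\<^esub> m i = n i \<cdot>\<^bsub>D\<^esub> \<beta> i)
        \<longrightarrow> short_exact D u v)"


section \<open>Cohomological functors and Mislin completions\<close>

record ('o, 'm, 'p, 'q) ftor =
  fobj :: "'o \<Rightarrow> 'p"
  fmap :: "'m \<Rightarrow> 'q"

definition additive_functor ::
  "('o, 'm) ab_cat \<Rightarrow> ('p, 'q) ab_cat \<Rightarrow> ('o, 'm, 'p, 'q) ftor \<Rightarrow> bool" where
  "additive_functor C D F \<longleftrightarrow>
     (\<forall>A\<in>Obj C. fobj F A \<in> Obj D \<and> fmap F (Ident C A) = Ident D (fobj F A)) \<and>
     (\<forall>A B. \<forall>f\<in>Hom C A B. fmap F f \<in> Hom D (fobj F A) (fobj F B)) \<and>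
     (\<forall>A B E. \<forall>f\<in>Hom C A B. \<forall>g\<in>Hom C B E. fmap F (g \<cdot>\<^bsub>C\<^esub> f) = fmap F g \<cdot>\<^bsub>D\<^esub> fmap F f) \<and>
     (\<forall>A B. \<forall>f\<in>Hom C A B. \<forall>g\<in>Hom C A B. fmap F (Plus C f g) = Plus D (fmap F f) (fmap F g))"

text \<open>A short exact sequence is determined by its two morphisms \<open>\<iota>\<close> and \<open>\<pi>\<close>, so the connecting
  homomorphism \<^term>\<open>Conn T n \<iota> \<pi>\<close> is indexed by these.\<close>

record ('o, 'm, 'p, 'q) cohom =
  Deg :: "int \<Rightarrow> ('o, 'm, 'p, 'q) ftor"
  Conn :: "int \<Rightarrow> 'm \<Rightarrow> 'm \<Rightarrow> 'q"

definition cohomological_functor ::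
  "('o, 'm) ab_cat \<Rightarrow> ('p, 'q) ab_cat \<Rightarrow> ('o, 'm, 'p, 'q) cohom \<Rightarrow> bool" where
  "cohomological_functor C D T \<longleftrightarrow>
     (\<forall>n. additive_functor C D (Deg T n)) \<and>
     (\<forall>n \<iota> \<pi>. short_exact C \<iota> \<pi> \<longrightarrow>
        Conn T n \<iota> \<pi> \<in> Hom D (fobj (Deg T n) (Tgt C \<pi>)) (fobj (Deg T (n + 1)) (Src C \<iota>)) \<and>
        exact_pair D (fmap (Deg T n) \<iota>) (fmap (Deg T n) \<pi>) \<and>
        exact_pair D (fmap (Deg T n) \<pi>) (Conn T n \<iota> \<pi>) \<and>
        exact_pair D (Conn T n \<iota> \<pi>) (fmap (Deg T (n + 1)) \<iota>)) \<and>
     (\<forall>n \<iota> \<pi> \<iota>' \<pi>' a b c. short_exact C \<iota> \<pi> \<and> short_exact C \<iota>' \<pi>' \<and>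
        a \<in> Hom C (Src C \<iota>) (Src C \<iota>') \<and> b \<in> Hom C (Tgt C \<iota>) (Tgt C \<iota>') \<and>
        c \<in> Hom C (Tgt C \<pi>) (Tgt C \<pi>') \<and>
        b \<cdot>\<^bsub>C\<^esub> \<iota> = \<iota>' \<cdot>\<^bsub>C\<^esub> a \<and> c \<cdot>\<^bsub>C\<^esub> \<pi> = \<pi>' \<cdot>\<^bsub>C\<^esub> b \<longrightarrow>
        Conn T n \<iota>' \<pi>' \<cdot>\<^bsub>D\<^esub> fmap (Deg T n) c = fmap (Deg T (n + 1)) a \<cdot>\<^bsub>D\<^esub> Conn T n \<iota> \<pi>)"

definition natural_transformation ::
  "('o, 'm) ab_cat \<Rightarrow> ('p, 'q) ab_cat \<Rightarrow> ('o, 'm, 'p, 'q) ftor \<Rightarrow> ('o, 'm, 'p, 'q) ftor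
    \<Rightarrow> ('o \<Rightarrow> 'q) \<Rightarrow> bool" where
  "natural_transformation C D F G \<eta> \<longleftrightarrow>
     (\<forall>A\<in>Obj C. \<eta> A \<in> Hom D (fobj F A) (fobj G A)) \<and>
     (\<forall>A B. \<forall>f\<in>Hom C A B. fmap G f \<cdot>\<^bsub>D\<^esub> \<eta> A = \<eta> B \<cdot>\<^bsub>D\<^esub> fmap F f)"

definition cohom_morphism ::
  "('o, 'm) ab_cat \<Rightarrow> ('p, 'q) ab_cat \<Rightarrow> ('o, 'm, 'p, 'q) cohom \<Rightarrow> ('o, 'm, 'p, 'q) cohom
    \<Rightarrow> (int \<Rightarrow> 'o \<Rightarrow> 'q) \<Rightarrow> bool" where
  "cohom_morphism C D T U \<nu> \<longleftrightarrow>
     (\<forall>n. natural_transformation C D (Deg T n) (Deg U n) (\<nu> n)) \<and>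
     (\<forall>n \<iota> \<pi>. short_exact C \<iota> \<pi> \<longrightarrow>
        \<nu> (n + 1) (Src C \<iota>) \<cdot>\<^bsub>D\<^esub> Conn T n \<iota> \<pi> = Conn U n \<iota> \<pi> \<cdot>\<^bsub>D\<^esub> \<nu> n (Tgt C \<pi>))"

definition vanishes_on_projectives ::
  "('o, 'm) ab_cat \<Rightarrow> ('p, 'q) ab_cat \<Rightarrow> ('o, 'm, 'p, 'q) cohom \<Rightarrow> bool" where
  "vanishes_on_projectives C D T \<longleftrightarrow> (\<forall>n P. projective C P \<longrightarrow> zero_object D (fobj (Deg T n) P))"

text \<open>Families indexed by objects are compared on \<^term>\<open>Obj C\<close> only, since their values elsewhere
  carry no information.\<close>

definition mislin_completion ::
  "('o, 'm) ab_cat \<Rightarrow> ('p, 'q) ab_cat \<Rightarrow> ('o, 'm, 'p, 'q) cohom \<Rightarrow> ('o, 'm, 'p, 'q) cohom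
    \<Rightarrow> (int \<Rightarrow> 'o \<Rightarrow> 'q) \<Rightarrow> bool" where
  "mislin_completion C D T T' \<nu> \<longleftrightarrow>
     cohomological_functor C D T' \<and> cohom_morphism C D T T' \<nu> \<and> vanishes_on_projectives C D T' \<and>
     (\<forall>U \<mu>. cohomological_functor C D U \<and> vanishes_on_projectives C D U \<and>
        cohom_morphism C D T U \<mu> \<longrightarrow>
        (\<exists>\<rho>. cohom_morphism C D T' U \<rho> \<and> (\<forall>n. \<forall>M\<in>Obj C. \<rho> n M \<cdot>\<^bsub>D\<^esub> \<nu> n M = \<mu> n M) \<and>
          (\<forall>\<rho>'. cohom_morphism C D T' U \<rho>' \<and>
             (\<forall>n. \<forall>M\<in>Obj C. \<rho>' n M \<cdot>\<^bsub>D\<^esub> \<nu> n M = \<mu> n M) \<longrightarrow>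
             (\<forall>n. \<forall>M\<in>Obj C. \<rho>' n M = \<rho> n M))))"


section \<open>Satellite functor construction\<close>

text \<open>The choices: for each object \<open>M\<close> a short exact sequence \<open>0 \<rightarrow> K \<rightarrow> P \<rightarrow> M \<rightarrow> 0\<close> with \<open>P\<close>
  projective, given by \<open>i M : K \<rightarrow> P\<close> and \<open>p M : P \<rightarrow> M\<close>, and for each morphism \<open>f\<close> of \<open>D\<close> a kernel
  \<open>\<kappa> f\<close>.\<close>

definition satellite_choice ::
  "('o, 'm) ab_cat \<Rightarrow> ('p, 'q) ab_cat \<Rightarrow> ('o \<Rightarrow> 'm) \<Rightarrow> ('o \<Rightarrow> 'm) \<Rightarrow> ('q \<Rightarrow> 'q) \<Rightarrow> bool" where
  "satellite_choice C D i p \<kappa> \<longleftrightarrow>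
     (\<forall>M\<in>Obj C. short_exact C (i M) (p M) \<and> Tgt C (p M) = M \<and> projective C (Src C (p M))) \<and>
     (\<forall>f\<in>Arr D. is_kernel D f (\<kappa> f))"

text \<open>\<open>satellite C D i p \<kappa> F\<close> is \<open>S\<^sup>-\<^sup>1F\<close>. On morphisms, \<open>g\<close> lifts \<open>f\<close> to the projectives, \<open>h\<close> is
  the map induced by \<open>g\<close>, and the value is the restriction of \<open>F h\<close> to the kernels; it does not depend on the
  lift, which justifies the definite description.\<close>

definition satellite ::
  "('o, 'm) ab_cat \<Rightarrow> ('p, 'q) ab_cat \<Rightarrow> ('o \<Rightarrow> 'm) \<Rightarrow> ('o \<Rightarrow> 'm) \<Rightarrow> ('q \<Rightarrow> 'q)
    \<Rightarrow> ('o, 'm, 'p, 'q) ftor \<Rightarrow> ('o, 'm, 'p, 'q) ftor" where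
  "satellite C D i p \<kappa> F =
     \<lparr>fobj = (\<lambda>M. Src D (\<kappa> (fmap F (i M)))),
      fmap = (\<lambda>f. let M' = Src C f; M = Tgt C f in
        THE s. s \<in> Hom D (Src D (\<kappa> (fmap F (i M')))) (Src D (\<kappa> (fmap F (i M)))) \<and>
          (\<exists>g h. g \<in> Hom C (Src C (p M')) (Src C (p M)) \<and> p M \<cdot>\<^bsub>C\<^esub> g = f \<cdot>\<^bsub>C\<^esub> p M' \<and>
             h \<in> Hom C (Src C (i M')) (Src C (i M)) \<and> i M \<cdot>\<^bsub>C\<^esub> h = g \<cdot>\<^bsub>C\<^esub> i M' \<and>
             \<kappa> (fmap F (i M)) \<cdot>\<^bsub>D\<^esub> s = fmap F h \<cdot>\<^bsub>D\<^esub> \<kappa> (fmap F (i M'))))\<rparr>"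

text \<open>The connecting homomorphism from \<open>S\<^sup>-\<^sup>1F\<close> to \<open>F\<close>; with \<open>S\<^sup>-\<^sup>kF\<close> in place of \<open>F\<close> this is
  \<open>\<epsilon>\<close> in degree \<open>-k-1\<close>. It is again independent of the lift \<open>h\<close>.\<close>

definition satellite_conn ::
  "('o, 'm) ab_cat \<Rightarrow> ('p, 'q) ab_cat \<Rightarrow> ('o \<Rightarrow> 'm) \<Rightarrow> ('o \<Rightarrow> 'm) \<Rightarrow> ('q \<Rightarrow> 'q)
    \<Rightarrow> ('o, 'm, 'p, 'q) ftor \<Rightarrow> 'm \<Rightarrow> 'm \<Rightarrow> 'q" where
  "satellite_conn C D i p \<kappa> F \<iota> \<pi> =
     (let M = Tgt C \<pi> in
      THE d. \<exists>h h'. h \<in> Hom C (Src C (p M)) (Src C \<pi>) \<and> \<pi> \<cdot>\<^bsub>C\<^esub> h = p M \<and>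
        h' \<in> Hom C (Src C (i M)) (Src C \<iota>) \<and> \<iota> \<cdot>\<^bsub>C\<^esub> h' = h \<cdot>\<^bsub>C\<^esub> i M \<and>
        d = fmap F h' \<cdot>\<^bsub>D\<^esub> \<kappa> (fmap F (i M)))"

text \<open>The cohomological functor \<open>T\<langle>m\<rangle>\<close>.\<close>

definition satellite_truncation ::
  "('o, 'm) ab_cat \<Rightarrow> ('p, 'q) ab_cat \<Rightarrow> ('o \<Rightarrow> 'm) \<Rightarrow> ('o \<Rightarrow> 'm) \<Rightarrow> ('q \<Rightarrow> 'q)
    \<Rightarrow> ('o, 'm, 'p, 'q) cohom \<Rightarrow> nat \<Rightarrow> ('o, 'm, 'p, 'q) cohom" where
  "satellite_truncation C D i p \<kappa> T m =
     \<lparr>Deg = (\<lambda>k. if k \<ge> int m then Deg T k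
             else (satellite C D i p \<kappa> ^^ nat (int m - k)) (Deg T (int m))),
      Conn = (\<lambda>k. if k \<ge> int m then Conn T k
             else satellite_conn C D i p \<kappa>
                    ((satellite C D i p \<kappa> ^^ nat (int m - k - 1)) (Deg T (int m))))\<rparr>"

text \<open>\<open>T'\<close> with \<open>\<nu>\<close> is a direct limit of the \<open>T\<langle>m\<rangle>\<close> with its canonical morphism. \<open>\<Phi> m\<close> and
  \<open>\<Psi> m n\<close> are the transition morphisms \<open>T \<rightarrow> T\<langle>m\<rangle>\<close> and \<open>T\<langle>m\<rangle> \<rightarrow> T\<langle>n\<rangle>\<close>, which are determined by
  being the identity in high degrees; \<open>l m\<close> is the limit morphism \<open>T\<langle>m\<rangle> \<rightarrow> T'\<close>. The equations with \<open>l\<close>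
  say that \<open>T'\<close> on morphisms and its connecting homomorphisms are the direct limits of those of the
  \<open>T\<langle>m\<rangle>\<close>. Direct limits being unique only up to isomorphism, this is a relation.\<close>

definition satellite_construction ::
  "('o, 'm) ab_cat \<Rightarrow> ('p, 'q) ab_cat \<Rightarrow> ('o \<Rightarrow> 'm) \<Rightarrow> ('o \<Rightarrow> 'm) \<Rightarrow> ('q \<Rightarrow> 'q)
    \<Rightarrow> ('o, 'm, 'p, 'q) cohom \<Rightarrow> ('o, 'm, 'p, 'q) cohom \<Rightarrow> (int \<Rightarrow> 'o \<Rightarrow> 'q) \<Rightarrow> bool" where
  "satellite_construction C D i p \<kappa> T T' \<nu> \<longleftrightarrow>
     (let S = satellite_truncation C D i p \<kappa> T in
      \<exists>\<Phi> \<Psi> l.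
        (\<forall>m. cohom_morphism C D T (S m) (\<Phi> m) \<and>
           (\<forall>k\<ge>int m. \<forall>M\<in>Obj C. \<Phi> m k M = Ident D (fobj (Deg T k) M))) \<and>
        (\<forall>m n. m \<le> n \<longrightarrow> cohom_morphism C D (S m) (S n) (\<Psi> m n) \<and>
           (\<forall>k\<ge>int n. \<forall>M\<in>Obj C. \<Psi> m n k M = Ident D (fobj (Deg T k) M))) \<and>
        (\<forall>k. \<forall>M\<in>Obj C. is_direct_limit D UNIV {(m, n). m \<le> n}
           (\<lambda>m. fobj (Deg (S m) k) M) (\<lambda>m n. \<Psi> m n k M) (fobj (Deg T' k) M) (\<lambda>m. l m k M)) \<and>
        (\<forall>k A B. \<forall>f\<in>Hom C A B. fmap (Deg T' k) f \<in> Hom D (fobj (Deg T' k) A) (fobj (Deg T' k) B) \<and>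
           (\<forall>m. fmap (Deg T' k) f \<cdot>\<^bsub>D\<^esub> l m k A = l m k B \<cdot>\<^bsub>D\<^esub> fmap (Deg (S m) k) f)) \<and>
        (\<forall>k \<iota> \<pi>. short_exact C \<iota> \<pi> \<longrightarrow>
           Conn T' k \<iota> \<pi> \<in> Hom D (fobj (Deg T' k) (Tgt C \<pi>)) (fobj (Deg T' (k + 1)) (Src C \<iota>)) \<and>
           (\<forall>m. Conn T' k \<iota> \<pi> \<cdot>\<^bsub>D\<^esub> l m k (Tgt C \<pi>)
              = l m (k + 1) (Src C \<iota>) \<cdot>\<^bsub>D\<^esub> Conn (S m) k \<iota> \<pi>)) \<and>
        (\<forall>m k. \<forall>M\<in>Obj C. \<nu> k M = l m k M \<cdot>\<^bsub>D\<^esub> \<Phi> m k M))"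

end

theory Submission
  imports Defs
begin

text \<open>Where a cohomological functor \<open>U\<close> vanishes on projectives, \<open>U\<^sup>k(M)\<close> is the kernel of
  \<open>U\<^sup>k\<^sup>+\<^sup>1(K) \<rightarrow> U\<^sup>k\<^sup>+\<^sup>1(P)\<close> for any \<open>0 \<rightarrow> K \<rightarrow> P \<rightarrow> M \<rightarrow> 0\<close> with \<open>P\<close> projective. Hence if \<open>U\<close> vanishes on
  projectives in degrees below \<open>n\<close>, a morphism into \<open>U\<close> given in degrees \<open>\<ge> n\<close> extends uniquely to all
  degrees. Since \<open>T\<langle>m\<rangle>\<close> is a cohomological functor vanishing on projectives below \<open>m\<close> and agreeing with
  \<open>T\<close> from \<open>m\<close> on, this one principle yields the transition morphisms, their compatibilities, and the
  factorisation of any morphism from \<open>T\<close> to a \<open>U\<close> vanishing on projectives through each \<open>T\<langle>m\<rangle>\<close>, hence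
  through the limit. Exactness of direct limits makes the limit cohomological, and it vanishes on
  projectives because \<open>T\<langle>m\<rangle>\<^sup>k(P) = 0\<close> for \<open>m > k\<close>.\<close>

section \<open>Preliminaries on abelian categories\<close>

text \<open>The hard point is that \<open>T\<langle>m\<rangle>\<close> is cohomological. All that is
  used of a functor F for this is half-exactness: F(A) -> F(B) -> F(C) is exact for every short
  exact sequence. It yields exactness of S^-1 F(A) -> S^-1 F(B) -> S^-1 F(C) -> F(A) -> F(B), and
  the first piece says that S^-1 F is half-exact again, so iterated satellites are handled by
  induction. Each position is reduced to half-exactness on an auxiliary sequence: 0 -> K -> A
  \<oplus> P -> B -> 0 or 0 -> K_B -> ker(P_B -> C) -> A -> 0.

  A second obstacle: exactness of direct limits is assumed for short exact sequences, over index
  sets in a given infinite type. Long exact sequences are therefore cut into short ones, after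
  building systems of kernels and cokernels, and nat is embedded into that type.

  The satellite construction is a relation, since limits are unique only up to isomorphism. Hence
  everything in it is shown to be a completion, for arbitrary resolutions, kernels and limits, and
  existence is proved separately.\<close>

lemma Hom_iff [simp]: "f \<in> Hom C A B \<longleftrightarrow> f \<in> Arr C \<and> Src C f = A \<and> Tgt C f = B"
  by (simp add: Hom_def)

context category
begin

lemma src_tgt_obj [simp]: "f \<in> Arr C \<Longrightarrow> Src C f \<in> Obj C" "f \<in> Arr C \<Longrightarrow> Tgt C f \<in> Obj C"
  by (simp_all add: src_obj tgt_obj)

lemma comp_arr [simp]:
  assumes "f \<in> Arr C" "g \<in> Arr C" "Tgt C f = Src C g"
  shows "g \<cdot> f \<in> Arr C" "Src C (g \<cdot> f) = Src C f" "Tgt C (g \<cdot> f) = Tgt C g"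
  using comp_hom[of f "Src C f" "Tgt C f" g "Tgt C g"] assms by simp_all

lemma comp_assoc_arr [simp]:
  assumes "f \<in> Arr C" "g \<in> Arr C" "h \<in> Arr C" "Tgt C f = Src C g" "Tgt C g = Src C h"
  shows "(h \<cdot> g) \<cdot> f = h \<cdot> (g \<cdot> f)"
  using comp_assoc[of f "Src C f" "Tgt C f" g "Tgt C g" h "Tgt C h"] assms by simp

lemma ident_arr [simp]:
  "A \<in> Obj C \<Longrightarrow> Ident C A \<in> Arr C"
  "A \<in> Obj C \<Longrightarrow> Src C (Ident C A) = A"
  "A \<in> Obj C \<Longrightarrow> Tgt C (Ident C A) = A"
  using ident_hom[of A] by simp_all

lemma ident_comp [simp]:
  "f \<in> Arr C \<Longrightarrow> Tgt C f = B \<Longrightarrow> Ident C B \<cdot> f = f"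
  "f \<in> Arr C \<Longrightarrow> Src C f = A \<Longrightarrow> f \<cdot> Ident C A = f"
  using ident_left[of f "Src C f"] ident_right[of f _ "Tgt C f"] by simp_all

text \<open>The simplifier nests composites to the right, which hides a known product
  \<open>g \<cdot> f\<close> inside \<open>g \<cdot> (f \<cdot> x)\<close>; this form makes an
  equation for that product applicable again.\<close>

lemma reassoc:
  assumes "g \<cdot> f = r" "f \<in> Arr C" "g \<in> Arr C" "Tgt C f = Src C g" "x \<in> Arr C" "Tgt C x = Src C f"
  shows "g \<cdot> (f \<cdot> x) = r \<cdot> x"
  using assms comp_assoc_arr[of x f g] by simp

lemma mono_morD:
  assumes "mono_mor C f" "g \<in> Arr C" "h \<in> Arr C" "Src C g = Src C h"
    "Tgt C g = Src C f" "Tgt C h = Src C f" "f \<cdot> g = f \<cdot> h"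
  shows "g = h"
  using assms unfolding mono_mor_def by (metis Hom_iff src_obj)

lemma epi_morD:
  assumes "epi_mor C f" "g \<in> Arr C" "h \<in> Arr C" "Tgt C g = Tgt C h"
    "Src C g = Tgt C f" "Src C h = Tgt C f" "g \<cdot> f = h \<cdot> f"
  shows "g = h"
  using assms unfolding epi_mor_def by (metis Hom_iff tgt_obj)

lemma mono_mor_arr: "mono_mor C f \<Longrightarrow> f \<in> Arr C"
  by (simp add: mono_mor_def)

lemma epi_mor_arr: "epi_mor C f \<Longrightarrow> f \<in> Arr C"
  by (simp add: epi_mor_def)

lemma epi_comp:
  assumes "epi_mor C f" "epi_mor C g" "Tgt C f = Src C g"
  shows "epi_mor C (g \<cdot> f)"
proof -
  have fg: "f \<in> Arr C" "g \<in> Arr C"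
    using assms by (simp_all add: epi_mor_arr)
  show ?thesis
    unfolding epi_mor_def
  proof (intro conjI ballI impI)
    fix X u v
    assume "u \<in> Hom C (Tgt C (g \<cdot> f)) X" "v \<in> Hom C (Tgt C (g \<cdot> f)) X" "u \<cdot> (g \<cdot> f) = v \<cdot> (g \<cdot> f)"
    then have uv: "u \<in> Arr C" "v \<in> Arr C" "Src C u = Tgt C g" "Src C v = Tgt C g" "Tgt C u = Tgt C v"
      and "u \<cdot> (g \<cdot> f) = v \<cdot> (g \<cdot> f)"
      using fg assms by auto
    then have "(u \<cdot> g) \<cdot> f = (v \<cdot> g) \<cdot> f"
      using fg assms(3) by simp
    then have "u \<cdot> g = v \<cdot> g"
      by (rule epi_morD[OF assms(1), rotated -1]) (use uv fg assms in simp_all)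
    then show "u = v"
      by (rule epi_morD[OF assms(2), rotated -1]) (use uv fg assms in simp_all)
  qed (use fg assms in simp)
qed

lemma epi_of_comp:
  assumes "epi_mor C (g \<cdot> f)" "f \<in> Arr C" "g \<in> Arr C" "Tgt C f = Src C g"
  shows "epi_mor C g"
  unfolding epi_mor_def
proof (intro conjI ballI impI)
  fix X u v
  assume "u \<in> Hom C (Tgt C g) X" "v \<in> Hom C (Tgt C g) X" and eq: "u \<cdot> g = v \<cdot> g"
  then have uv: "u \<in> Arr C" "v \<in> Arr C" "Src C u = Tgt C g" "Src C v = Tgt C g" "Tgt C u = Tgt C v"
    by auto
  show "u = v"
    by (rule epi_morD[OF assms(1)]) (use uv assms reassoc[OF eq] in simp_all)
qed (use assms in simp)

lemma mono_of_comp: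
  assumes "mono_mor C (g \<cdot> f)" "f \<in> Arr C" "g \<in> Arr C" "Tgt C f = Src C g"
  shows "mono_mor C f"
  unfolding mono_mor_def
proof (intro conjI ballI impI)
  fix X u v
  assume "u \<in> Hom C X (Src C f)" "v \<in> Hom C X (Src C f)" and eq: "f \<cdot> u = f \<cdot> v"
  then have uv: "u \<in> Arr C" "v \<in> Arr C" "Tgt C u = Src C f" "Tgt C v = Src C f" "Src C u = Src C v"
    by auto
  show "u = v"
    by (rule mono_morD[OF assms(1)]) (use uv assms eq in simp_all)
qed (use assms in simp)

lemma mono_comp:
  assumes "mono_mor C f" "mono_mor C g" "Tgt C f = Src C g"
  shows "mono_mor C (g \<cdot> f)"
proof -
  have fg: "f \<in> Arr C" "g \<in> Arr C"
    using assms by (simp_all add: mono_mor_arr)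
  show ?thesis
    unfolding mono_mor_def
  proof (intro conjI ballI impI)
    fix X u v
    assume "u \<in> Hom C X (Src C (g \<cdot> f))" "v \<in> Hom C X (Src C (g \<cdot> f))" "(g \<cdot> f) \<cdot> u = (g \<cdot> f) \<cdot> v"
    then have uv: "u \<in> Arr C" "v \<in> Arr C" "Tgt C u = Src C f" "Tgt C v = Src C f" "Src C u = Src C v"
      and "g \<cdot> (f \<cdot> u) = g \<cdot> (f \<cdot> v)"
      using fg assms by auto
    then have "f \<cdot> u = f \<cdot> v"
      by (rule_tac mono_morD[OF assms(2)]) (use uv fg assms in simp_all)
    then show "u = v"
      by (rule mono_morD[OF assms(1), rotated -1]) (use uv fg assms in simp_all)
  qed (use fg assms in simp)
qed

end

section \<open>Hom groups, and kernels and cokernels in terms of cancellation\<close>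

context preadditive_category
begin

lemma hom_group_simps:
  "carrier (hom_group C A B) = Hom C A B" "monoid.mult (hom_group C A B) = Plus C"
  "one (hom_group C A B) = ZeroMor C A B"
  by (simp_all add: hom_group_def)

lemma zero_arr [simp]:
  assumes "A \<in> Obj C" "B \<in> Obj C"
  shows "ZeroMor C A B \<in> Arr C" "Src C (ZeroMor C A B) = A" "Tgt C (ZeroMor C A B) = B"
proof -
  interpret comm_group "hom_group C A B"
    using assms by (rule hom_comm_group)
  show "ZeroMor C A B \<in> Arr C" "Src C (ZeroMor C A B) = A" "Tgt C (ZeroMor C A B) = B"
    using one_closed unfolding hom_group_simps by simp_all
qed

lemma plus_arr [simp]:
  assumes "f \<in> Arr C" "g \<in> Arr C" "Src C f = Src C g" "Tgt C f = Tgt C g"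
  shows "Plus C f g \<in> Arr C" "Src C (Plus C f g) = Src C g" "Tgt C (Plus C f g) = Tgt C g"
proof -
  interpret comm_group "hom_group C (Src C g) (Tgt C g)"
    using assms by (intro hom_comm_group) simp_all
  show "Plus C f g \<in> Arr C" "Src C (Plus C f g) = Src C g" "Tgt C (Plus C f g) = Tgt C g"
    using m_closed[of f g] assms unfolding hom_group_simps by simp_all
qed

lemma plus_commute:
  assumes "f \<in> Arr C" "g \<in> Arr C" "Src C f = Src C g" "Tgt C f = Tgt C g"
  shows "Plus C f g = Plus C g f"
proof -
  interpret comm_group "hom_group C (Src C g) (Tgt C g)"
    using assms by (intro hom_comm_group) simp_all
  show ?thesis
    using m_comm[of f g] assms unfolding hom_group_simps by simp
qed

lemma plus_zero [simp]:
  assumes "f \<in> Arr C" "Src C f = A" "Tgt C f = B"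
  shows "Plus C f (ZeroMor C A B) = f" "Plus C (ZeroMor C A B) f = f"
proof -
  interpret comm_group "hom_group C (Src C f) (Tgt C f)"
    using assms by (intro hom_comm_group) auto
  show "Plus C f (ZeroMor C A B) = f" "Plus C (ZeroMor C A B) f = f"
    using l_one[of f] r_one[of f] assms unfolding hom_group_simps by simp_all
qed

lemma plus_cancel [simp]:
  assumes "f \<in> Arr C" "g \<in> Arr C" "h \<in> Arr C" "Src C g = Src C f" "Tgt C g = Tgt C f"
     "Src C h = Src C f" "Tgt C h = Tgt C f"
  shows "Plus C f g = Plus C f h \<longleftrightarrow> g = h"
proof -
  interpret comm_group "hom_group C (Src C f) (Tgt C f)"
    using assms by (intro hom_comm_group) simp_all
  show ?thesis
    using Units_l_cancel[of f g h] Units_eq assms unfolding hom_group_simps by simp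
qed

lemma plus_eq_self [simp]:
  assumes "f \<in> Arr C" "g \<in> Arr C" "Src C g = Src C f" "Tgt C g = Tgt C f"
  shows "Plus C f g = f \<longleftrightarrow> g = ZeroMor C (Src C f) (Tgt C f)"
  using plus_cancel[of f g "ZeroMor C (Src C f) (Tgt C f)"] assms by simp

text \<open>The record has no subtraction; the Hom group supplies \<open>d = -g + f\<close>, and the
  form \<open>f = g + d\<close> lets later arguments work with addition alone.\<close>

lemma ex_diff:
  assumes "f \<in> Arr C" "g \<in> Arr C" "Src C f = Src C g" "Tgt C f = Tgt C g"
  obtains d where "d \<in> Arr C" "Src C d = Src C g" "Tgt C d = Tgt C g" "f = Plus C g d"
proof -
  interpret comm_group "hom_group C (Src C g) (Tgt C g)"
    using assms by (intro hom_comm_group) simp_all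
  let ?G = "hom_group C (Src C g) (Tgt C g)"
  have 1: "f \<in> carrier ?G" "g \<in> carrier ?G"
    using assms by (simp_all add: hom_group_simps)
  then have 2: "inv\<^bsub>?G\<^esub> g \<otimes>\<^bsub>?G\<^esub> f \<in> carrier ?G"
    by simp
  have "g \<otimes>\<^bsub>?G\<^esub> (inv\<^bsub>?G\<^esub> g \<otimes>\<^bsub>?G\<^esub> f) = f"
    using 1 by (simp add: m_assoc[symmetric])
  then show ?thesis
    using that[of "inv\<^bsub>?G\<^esub> g \<otimes>\<^bsub>?G\<^esub> f"] 2 unfolding hom_group_simps by simp
qed

lemma ex_neg:
  assumes "f \<in> Arr C"
  obtains d where "d \<in> Arr C" "Src C d = Src C f" "Tgt C d = Tgt C f"
    "Plus C f d = ZeroMor C (Src C f) (Tgt C f)"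
  using ex_diff[of "ZeroMor C (Src C f) (Tgt C f)" f] assms by (metis src_tgt_obj zero_arr)

lemma comp_plus [simp]:
  assumes "f \<in> Arr C" "g \<in> Arr C" "Src C f = Src C g" "Tgt C f = Tgt C g"
  shows "h \<in> Arr C \<Longrightarrow> Src C h = Tgt C g \<Longrightarrow> h \<cdot> Plus C f g = Plus C (h \<cdot> f) (h \<cdot> g)"
    "h \<in> Arr C \<Longrightarrow> Tgt C h = Src C g \<Longrightarrow> Plus C f g \<cdot> h = Plus C (f \<cdot> h) (g \<cdot> h)"
  using assms comp_plus_right[of f "Src C f" "Tgt C f" g h "Tgt C h"]
    comp_plus_left[of h "Src C h" "Tgt C h" f "Tgt C f" g] by simp_all

text \<open>By distributivity the composite equals its own double, which in a group forces it to be
  zero.\<close>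

lemma comp_zero [simp]:
  assumes "f \<in> Arr C"
  shows "Tgt C f = A \<Longrightarrow> B \<in> Obj C \<Longrightarrow> ZeroMor C A B \<cdot> f = ZeroMor C (Src C f) B"
    "Src C f = B \<Longrightarrow> A \<in> Obj C \<Longrightarrow> f \<cdot> ZeroMor C A B = ZeroMor C A (Tgt C f)"
proof -
  assume *: "Tgt C f = A" "B \<in> Obj C"
  let ?Z = "ZeroMor C A B"
  have A: "A \<in> Obj C"
    using * assms by auto
  have "Plus C (?Z \<cdot> f) (?Z \<cdot> f) = Plus C ?Z ?Z \<cdot> f"
    using * A assms by (subst comp_plus) simp_all
  also have "\<dots> = ?Z \<cdot> f"
    using * A by simp
  finally show "?Z \<cdot> f = ZeroMor C (Src C f) B"
    using * A assms by simp
next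
  assume *: "Src C f = B" "A \<in> Obj C"
  let ?Z = "ZeroMor C A B"
  have B: "B \<in> Obj C"
    using * assms by auto
  have "Plus C (f \<cdot> ?Z) (f \<cdot> ?Z) = f \<cdot> Plus C ?Z ?Z"
    using * B assms by (subst comp_plus) simp_all
  also have "\<dots> = f \<cdot> ?Z"
    using * B by simp
  finally show "f \<cdot> ?Z = ZeroMor C A (Tgt C f)"
    using * B assms by simp
qed

text \<open>Writing \<open>g = h + d\<close> reduces cancellation to the vanishing of
  \<open>d\<close>.\<close>

lemma mono_morI:
  assumes f: "f \<in> Arr C"
    and 0: "\<And>v. v \<in> Arr C \<Longrightarrow> Tgt C v = Src C f \<Longrightarrow> f \<cdot> v = ZeroMor C (Src C v) (Tgt C f) \<Longrightarrow>
      v = ZeroMor C (Src C v) (Src C f)"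
  shows "mono_mor C f"
  unfolding mono_mor_def
proof (intro conjI ballI impI f)
  fix X g h
  assume gh: "g \<in> Hom C X (Src C f)" "h \<in> Hom C X (Src C f)" "f \<cdot> g = f \<cdot> h"
  then obtain d where d: "d \<in> Arr C" "Src C d = X" "Tgt C d = Src C f" "g = Plus C h d"
    using ex_diff[of g h] by auto
  then have "f \<cdot> d = ZeroMor C X (Tgt C f)"
    using gh f by simp
  then have "d = ZeroMor C X (Src C f)"
    using 0[of d] d by simp
  then show "g = h"
    using d gh by simp
qed

lemma epi_morI:
  assumes f: "f \<in> Arr C"
    and 0: "\<And>v. v \<in> Arr C \<Longrightarrow> Src C v = Tgt C f \<Longrightarrow> v \<cdot> f = ZeroMor C (Src C f) (Tgt C v) \<Longrightarrow>
      v = ZeroMor C (Tgt C f) (Tgt C v)"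
  shows "epi_mor C f"
  unfolding epi_mor_def
proof (intro conjI ballI impI f)
  fix X g h
  assume gh: "g \<in> Hom C (Tgt C f) X" "h \<in> Hom C (Tgt C f) X" "g \<cdot> f = h \<cdot> f"
  then obtain d where d: "d \<in> Arr C" "Tgt C d = X" "Src C d = Tgt C f" "g = Plus C h d"
    using ex_diff[of g h] by auto
  then have "d \<cdot> f = ZeroMor C (Src C f) X"
    using gh f by simp
  then have "d = ZeroMor C (Tgt C f) X"
    using 0[of d] d by simp
  then show "g = h"
    using d gh by simp
qed

lemma mono_mor_zero:
  assumes "mono_mor C f" "v \<in> Arr C" "Tgt C v = Src C f" "f \<cdot> v = ZeroMor C (Src C v) (Tgt C f)"
  shows "v = ZeroMor C (Src C v) (Src C f)"
  by (rule mono_morD[OF assms(1)]) (use assms mono_mor_arr in simp_all)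

lemma epi_mor_zero:
  assumes "epi_mor C f" "v \<in> Arr C" "Src C v = Tgt C f" "v \<cdot> f = ZeroMor C (Src C f) (Tgt C v)"
  shows "v = ZeroMor C (Tgt C f) (Tgt C v)"
  by (rule epi_morD[OF assms(1)]) (use assms epi_mor_arr in simp_all)

lemma is_kernelD:
  assumes "is_kernel C f k"
  shows "f \<in> Arr C" "k \<in> Arr C" "Tgt C k = Src C f" "f \<cdot> k = ZeroMor C (Src C k) (Tgt C f)"
  using assms by (simp_all add: is_kernel_def)

lemma is_kernel_factor:
  assumes "is_kernel C f k" "h \<in> Arr C" "Tgt C h = Src C f" "f \<cdot> h = ZeroMor C (Src C h) (Tgt C f)"
  obtains u where "u \<in> Arr C" "Src C u = Src C h" "Tgt C u = Src C k" "k \<cdot> u = h"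
  using assms unfolding is_kernel_def by (metis Hom_iff src_obj)

text \<open>The zero map factors through \<open>k\<close> in only one way, and both \<open>v\<close>
  and the zero map are such factors.\<close>

lemma is_kernel_mono:
  assumes "is_kernel C f k"
  shows "mono_mor C k"
proof (rule mono_morI)
  note k = is_kernelD[OF assms]
  show "k \<in> Arr C"
    by (fact k)
  fix v
  assume v: "v \<in> Arr C" "Tgt C v = Src C k" "k \<cdot> v = ZeroMor C (Src C v) (Tgt C k)"
  have "\<exists>!u. u \<in> Hom C (Src C v) (Src C k) \<and> k \<cdot> u = ZeroMor C (Src C v) (Tgt C k)"
  proof -
    have "Src C v \<in> Obj C" "ZeroMor C (Src C v) (Tgt C k) \<in> Hom C (Src C v) (Src C f)"
      "f \<cdot> ZeroMor C (Src C v) (Tgt C k) = ZeroMor C (Src C v) (Tgt C f)"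
      using v k by simp_all
    then show ?thesis
      using assms unfolding is_kernel_def by blast
  qed
  moreover have "ZeroMor C (Src C v) (Src C k) \<in> Hom C (Src C v) (Src C k) \<and>
    k \<cdot> ZeroMor C (Src C v) (Src C k) = ZeroMor C (Src C v) (Tgt C k)"
    "v \<in> Hom C (Src C v) (Src C k) \<and> k \<cdot> v = ZeroMor C (Src C v) (Tgt C k)"
    using v k by simp_all
  ultimately show "v = ZeroMor C (Src C v) (Src C k)"
    by blast
qed

lemma is_kernelI:
  assumes "f \<in> Arr C" "mono_mor C k" "Tgt C k = Src C f" "f \<cdot> k = ZeroMor C (Src C k) (Tgt C f)"
    and "\<And>h. h \<in> Arr C \<Longrightarrow> Tgt C h = Src C f \<Longrightarrow> f \<cdot> h = ZeroMor C (Src C h) (Tgt C f) \<Longrightarrow>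
      \<exists>u\<in>Arr C. Src C u = Src C h \<and> Tgt C u = Src C k \<and> k \<cdot> u = h"
  shows "is_kernel C f k"
  unfolding is_kernel_def
proof (intro conjI ballI impI)
  fix X h
  assume h: "h \<in> Hom C X (Src C f)" "f \<cdot> h = ZeroMor C X (Tgt C f)"
  then obtain u where u: "u \<in> Arr C" "Src C u = X" "Tgt C u = Src C k" "k \<cdot> u = h"
    using assms(5)[of h] by auto
  show "\<exists>!u. u \<in> Hom C X (Src C k) \<and> k \<cdot> u = h"
  proof (rule ex1I[of _ u])
    fix u'
    assume u': "u' \<in> Hom C X (Src C k) \<and> k \<cdot> u' = h"
    show "u' = u"
      by (rule mono_morD[OF assms(2), of u' u]) (use u u' in auto)
  qed (use u in simp)
qed (use assms mono_mor_arr in simp_all)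

lemma is_cokernelD:
  assumes "is_cokernel C f c"
  shows "f \<in> Arr C" "c \<in> Arr C" "Src C c = Tgt C f" "c \<cdot> f = ZeroMor C (Src C f) (Tgt C c)"
  using assms by (simp_all add: is_cokernel_def)

lemma is_cokernel_factor:
  assumes "is_cokernel C f c" "h \<in> Arr C" "Src C h = Tgt C f" "h \<cdot> f = ZeroMor C (Src C f) (Tgt C h)"
  obtains u where "u \<in> Arr C" "Tgt C u = Tgt C h" "Src C u = Tgt C c" "u \<cdot> c = h"
  using assms unfolding is_cokernel_def by (metis Hom_iff tgt_obj)

lemma is_cokernel_epi:
  assumes "is_cokernel C f c"
  shows "epi_mor C c"
proof (rule epi_morI)
  note c = is_cokernelD[OF assms]
  show "c \<in> Arr C"
    by (fact c)
  fix v
  assume v: "v \<in> Arr C" "Src C v = Tgt C c" "v \<cdot> c = ZeroMor C (Src C c) (Tgt C v)"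
  have "\<exists>!u. u \<in> Hom C (Tgt C c) (Tgt C v) \<and> u \<cdot> c = ZeroMor C (Src C c) (Tgt C v)"
  proof -
    have "Tgt C v \<in> Obj C" "ZeroMor C (Src C c) (Tgt C v) \<in> Hom C (Tgt C f) (Tgt C v)"
      "ZeroMor C (Src C c) (Tgt C v) \<cdot> f = ZeroMor C (Src C f) (Tgt C v)"
      using v c by simp_all
    then show ?thesis
      using assms unfolding is_cokernel_def by blast
  qed
  moreover have "ZeroMor C (Tgt C c) (Tgt C v) \<in> Hom C (Tgt C c) (Tgt C v) \<and>
    ZeroMor C (Tgt C c) (Tgt C v) \<cdot> c = ZeroMor C (Src C c) (Tgt C v)"
    "v \<in> Hom C (Tgt C c) (Tgt C v) \<and> v \<cdot> c = ZeroMor C (Src C c) (Tgt C v)"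
    using v c by simp_all
  ultimately show "v = ZeroMor C (Tgt C c) (Tgt C v)"
    by blast
qed

lemma is_cokernelI:
  assumes "f \<in> Arr C" "epi_mor C c" "Src C c = Tgt C f" "c \<cdot> f = ZeroMor C (Src C f) (Tgt C c)"
    and "\<And>h. h \<in> Arr C \<Longrightarrow> Src C h = Tgt C f \<Longrightarrow> h \<cdot> f = ZeroMor C (Src C f) (Tgt C h) \<Longrightarrow>
      \<exists>u\<in>Arr C. Tgt C u = Tgt C h \<and> Src C u = Tgt C c \<and> u \<cdot> c = h"
  shows "is_cokernel C f c"
  unfolding is_cokernel_def
proof (intro conjI ballI impI)
  fix X h
  assume h: "h \<in> Hom C (Tgt C f) X" "h \<cdot> f = ZeroMor C (Src C f) X"
  then obtain u where u: "u \<in> Arr C" "Tgt C u = X" "Src C u = Tgt C c" "u \<cdot> c = h"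
    using assms(5)[of h] by auto
  show "\<exists>!u. u \<in> Hom C (Tgt C c) X \<and> u \<cdot> c = h"
  proof (rule ex1I[of _ u])
    fix u'
    assume u': "u' \<in> Hom C (Tgt C c) X \<and> u' \<cdot> c = h"
    show "u' = u"
      by (rule epi_morD[OF assms(2), of u' u]) (use u u' in auto)
  qed (use u in simp)
qed (use assms epi_mor_arr in simp_all)

end

section \<open>Normal monos and epis, biproducts, pullbacks of epis, images\<close>

context abelian_category
begin

text \<open>\<open>f\<close> is the kernel of some \<open>g\<close>, and \<open>g\<close> factors
  through \<open>c\<close> because it kills \<open>f\<close>. So whatever \<open>c\<close> kills is
  killed by \<open>g\<close> and factors through \<open>f\<close>.\<close>

lemma mono_is_kernel:
  assumes f: "mono_mor C f" and c: "is_cokernel C f c"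
  shows "is_kernel C c f"
proof -
  obtain g where g: "is_kernel C g f"
    using mono_normal f by blast
  note [simp] = is_kernelD[OF g] is_cokernelD[OF c]
  obtain w where w: "w \<in> Arr C" "Tgt C w = Tgt C g" "Src C w = Tgt C c" "w \<cdot> c = g"
    using is_cokernel_factor[OF c, of g] by auto
  show ?thesis
  proof (rule is_kernelI)
    fix h
    assume h: "h \<in> Arr C" "Tgt C h = Src C c" "c \<cdot> h = ZeroMor C (Src C h) (Tgt C c)"
    have "g \<cdot> h = w \<cdot> (c \<cdot> h)"
      using reassoc[OF w(4), of h] w h by simp
    then have "g \<cdot> h = ZeroMor C (Src C h) (Tgt C g)"
      using h w by simp
    then show "\<exists>u\<in>Arr C. Src C u = Src C h \<and> Tgt C u = Src C f \<and> f \<cdot> u = h"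
      using is_kernel_factor[OF g, of h] h by (metis is_cokernelD(3)[OF c] is_kernelD(3)[OF g])
  qed (use f in simp_all)
qed

lemma epi_is_cokernel:
  assumes f: "epi_mor C f" and k: "is_kernel C f k"
  shows "is_cokernel C k f"
proof -
  obtain g where g: "is_cokernel C g f"
    using epi_normal f by blast
  note [simp] = is_cokernelD[OF g] is_kernelD[OF k]
  obtain w where w: "w \<in> Arr C" "Src C w = Src C g" "Tgt C w = Src C k" "k \<cdot> w = g"
    using is_kernel_factor[OF k, of g] by auto
  show ?thesis
  proof (rule is_cokernelI)
    fix h
    assume h: "h \<in> Arr C" "Src C h = Tgt C k" "h \<cdot> k = ZeroMor C (Src C k) (Tgt C h)"
    have "h \<cdot> g = h \<cdot> (k \<cdot> w)"
      using w by simp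
    also have "\<dots> = ZeroMor C (Src C g) (Tgt C h)"
      using h w reassoc[OF h(3), of w] by simp
    finally show "\<exists>u\<in>Arr C. Tgt C u = Tgt C h \<and> Src C u = Tgt C f \<and> u \<cdot> f = h"
      using is_cokernel_factor[OF g, of h] h by (metis is_cokernelD(3)[OF g] is_kernelD(3)[OF k])
  qed (use f in simp_all)
qed

text \<open>Two kernels of the same \<open>c\<close> factor through each other, so they share the
  universal property for \<open>g\<close>. This bridges the gap that \<open>exact_pair\<close>
  speaks of some kernel of some cokernel and not of a given one.\<close>

lemma is_kernel_transfer:
  assumes k: "is_kernel C c k" and i: "is_kernel C c i" and g: "is_kernel C g k"
  shows "is_kernel C g i"
proof -
  note [simp] = is_kernelD[OF k] is_kernelD[OF i] is_kernelD[OF g]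
  have gc: "Src C c = Src C g"
    using is_kernelD(3)[OF k] is_kernelD(3)[OF g] by simp
  obtain u where u: "u \<in> Arr C" "Src C u = Src C i" "Tgt C u = Src C k" "k \<cdot> u = i"
    using is_kernel_factor[OF k, of i] gc by auto
  obtain v where v: "v \<in> Arr C" "Src C v = Src C k" "Tgt C v = Src C i" "i \<cdot> v = k"
    using is_kernel_factor[OF i, of k] gc by auto
  show ?thesis
  proof (rule is_kernelI)
    have "g \<cdot> i = g \<cdot> (k \<cdot> u)"
      using u by simp
    also have "\<dots> = ZeroMor C (Src C i) (Tgt C g)"
      using reassoc[OF is_kernelD(4)[OF g], of u] u gc by simp
    finally show "g \<cdot> i = ZeroMor C (Src C i) (Tgt C g)" .
    fix h
    assume h: "h \<in> Arr C" "Tgt C h = Src C g" "g \<cdot> h = ZeroMor C (Src C h) (Tgt C g)"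
    obtain w where w: "w \<in> Arr C" "Src C w = Src C h" "Tgt C w = Src C k" "k \<cdot> w = h"
      using is_kernel_factor[OF g, of h] h by blast
    have "i \<cdot> (v \<cdot> w) = h"
      using reassoc[OF v(4), of w] v w gc by simp
    then show "\<exists>u\<in>Arr C. Src C u = Src C h \<and> Tgt C u = Src C i \<and> i \<cdot> u = h"
      using v w by (intro bexI[of _ "v \<cdot> w"]) simp_all
  qed (use gc is_kernel_mono[OF i] in simp_all)
qed

lemma short_exactD:
  assumes "short_exact C \<iota> \<pi>"
  shows "is_kernel C \<pi> \<iota>" "is_cokernel C \<iota> \<pi>" "mono_mor C \<iota>" "epi_mor C \<pi>"
proof -
  obtain c k where ck: "is_cokernel C \<iota> c" "is_kernel C c k" "is_kernel C \<pi> k"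
    and me: "mono_mor C \<iota>" "epi_mor C \<pi>"
    using assms unfolding short_exact_def exact_pair_def by blast
  then show "is_kernel C \<pi> \<iota>"
    by (metis is_kernel_transfer mono_is_kernel)
  then show "is_cokernel C \<iota> \<pi>"
    using me epi_is_cokernel by blast
  show "mono_mor C \<iota>" "epi_mor C \<pi>"
    by fact+
qed

lemma short_exact_simps:
  assumes "short_exact C \<iota> \<pi>"
  shows "\<iota> \<in> Arr C" "\<pi> \<in> Arr C" "Tgt C \<iota> = Src C \<pi>" "\<pi> \<cdot> \<iota> = ZeroMor C (Src C \<iota>) (Tgt C \<pi>)"
  using is_kernelD[OF short_exactD(1)[OF assms]] by simp_all

lemma short_exact_kernelI:
  assumes "is_kernel C \<pi> \<iota>" "epi_mor C \<pi>"
  shows "short_exact C \<iota> \<pi>"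
  using assms epi_is_cokernel is_kernel_mono is_kernelD(3) unfolding short_exact_def exact_pair_def
  by blast

lemma short_exact_cokernelI:
  assumes "is_cokernel C \<iota> \<pi>" "mono_mor C \<iota>"
  shows "short_exact C \<iota> \<pi>"
  using assms mono_is_kernel is_cokernel_epi short_exact_kernelI by blast

text \<open>Only products are assumed. The injections are the maps with components (1, 0) and (0,
  1), and \<open>i \<cdot> p + j \<cdot> q\<close> has the same components as the identity.\<close>

lemma ex_biproduct:
  assumes "A \<in> Obj C" "B \<in> Obj C"
  obtains P p q i j where "p \<in> Hom C P A" "q \<in> Hom C P B" "i \<in> Hom C A P" "j \<in> Hom C B P" "P \<in> Obj C"
    "p \<cdot> i = Ident C A" "q \<cdot> j = Ident C B" "q \<cdot> i = ZeroMor C A B" "p \<cdot> j = ZeroMor C B A"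
    "Plus C (i \<cdot> p) (j \<cdot> q) = Ident C P"
proof -
  obtain P p q where P: "is_product C A B P p q"
    using ex_product assms by blast
  then have pq: "p \<in> Hom C P A" "q \<in> Hom C P B"
    and ex1: "\<And>X f g. X \<in> Obj C \<Longrightarrow> f \<in> Hom C X A \<Longrightarrow> g \<in> Hom C X B \<Longrightarrow>
      \<exists>!h. h \<in> Hom C X P \<and> p \<cdot> h = f \<and> q \<cdot> h = g"
    unfolding is_product_def by blast+
  have PO: "P \<in> Obj C"
    using pq by auto
  obtain i where i: "i \<in> Hom C A P" "p \<cdot> i = Ident C A" "q \<cdot> i = ZeroMor C A B"
    using ex1[of A "Ident C A" "ZeroMor C A B"] assms by auto
  obtain j where j: "j \<in> Hom C B P" "p \<cdot> j = ZeroMor C B A" "q \<cdot> j = Ident C B"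
    using ex1[of B "ZeroMor C B A" "Ident C B"] assms by auto
  let ?s = "Plus C (i \<cdot> p) (j \<cdot> q)"
  have "?s \<in> Hom C P P" "p \<cdot> ?s = p" "q \<cdot> ?s = q"
    using pq i(1) j(1) assms PO reassoc[OF i(2), of p] reassoc[OF i(3), of p]
      reassoc[OF j(2), of q] reassoc[OF j(3), of q] by simp_all
  moreover have "Ident C P \<in> Hom C P P" "p \<cdot> Ident C P = p" "q \<cdot> Ident C P = q"
    using pq PO by simp_all
  ultimately have "?s = Ident C P"
    using ex1[OF PO pq] by blast
  then show ?thesis
    using that[OF pq i(1) j(1) PO i(2) j(3) i(3) j(2)] by blast
qed

text \<open>The pullback is the kernel \<open>k\<close> of
  \<open>r = e \<cdot> p - y \<cdot> q\<close> on the biproduct. Since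
  \<open>r \<cdot> i = e\<close> is epi, so is \<open>r\<close>; hence \<open>r\<close> is the
  cokernel of \<open>k\<close>, and this makes the projection \<open>q \<cdot> k\<close>
  epi.\<close>

lemma epi_pullback:
  assumes e: "epi_mor C e" and y: "y \<in> Arr C" "Tgt C y = Tgt C e"
  obtains e' y' where "epi_mor C e'" "Tgt C e' = Src C y" "y' \<in> Arr C" "Src C y' = Src C e'"
    "Tgt C y' = Src C e" "e \<cdot> y' = y \<cdot> e'"
proof -
  note [simp] = epi_mor_arr[OF e] y
  obtain P p q i j where "p \<in> Hom C P (Src C e)" "q \<in> Hom C P (Src C y)"
    "i \<in> Hom C (Src C e) P" "j \<in> Hom C (Src C y) P" and P [simp]: "P \<in> Obj C"
    and bi: "p \<cdot> i = Ident C (Src C e)" "q \<cdot> j = Ident C (Src C y)"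
    "q \<cdot> i = ZeroMor C (Src C e) (Src C y)" "p \<cdot> j = ZeroMor C (Src C y) (Src C e)"
    "Plus C (i \<cdot> p) (j \<cdot> q) = Ident C P"
    by (rule ex_biproduct[of "Src C e" "Src C y"]) (simp, simp, rule that)
  then have [simp]: "p \<in> Arr C" "q \<in> Arr C" "i \<in> Arr C" "j \<in> Arr C"
    "Src C p = P" "Src C q = P" "Tgt C i = P" "Tgt C j = P"
    "Tgt C p = Src C e" "Tgt C q = Src C y" "Src C i = Src C e" "Src C j = Src C y"
    by simp_all
  note re = bi(1-4)[THEN reassoc]
  obtain m where m [simp]: "m \<in> Arr C" "Src C m = Src C y" "Tgt C m = Tgt C e"
    "Plus C y m = ZeroMor C (Src C y) (Tgt C e)"
    using ex_neg[of y] by auto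
  define r where "r = Plus C (e \<cdot> p) (m \<cdot> q)"
  have r [simp]: "r \<in> Arr C" "Src C r = P" "Tgt C r = Tgt C e" and ri: "r \<cdot> i = e"
    by (simp_all add: r_def bi)
  have r_epi: "epi_mor C r"
    by (rule epi_of_comp[of r i]) (use e ri in simp_all)
  obtain k where k: "is_kernel C r k"
    using ex_kernel[of r] by auto
  note [simp] = is_kernelD[OF k]
  have c: "is_cokernel C k r"
    using epi_is_cokernel[OF r_epi k] .
  show ?thesis
  proof (rule that[of "q \<cdot> k" "p \<cdot> k"])
    show "epi_mor C (q \<cdot> k)"
    proof (rule epi_morI)
      fix v
      assume v [simp]: "v \<in> Arr C" "Src C v = Tgt C (q \<cdot> k)"
        and v0: "v \<cdot> (q \<cdot> k) = ZeroMor C (Src C (q \<cdot> k)) (Tgt C v)"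
      \<comment> \<open>\<open>v \<cdot> q\<close> kills the kernel of \<open>r\<close>, so it
        factors through \<open>r\<close>. Restriction to the first summand shows that the factor
        \<open>w\<close> is zero, and restriction to the second that \<open>v\<close> is.\<close>
      obtain w where w [simp]: "w \<in> Arr C" "Tgt C w = Tgt C v" "Src C w = Tgt C r" "w \<cdot> r = v \<cdot> q"
        using is_cokernel_factor[OF c, of "v \<cdot> q"] v0 by auto
      have "w \<cdot> e = (w \<cdot> r) \<cdot> i"
        using ri by (simp del: w(4))
      also have "\<dots> = ZeroMor C (Src C e) (Tgt C v)"
        by (simp add: bi)
      finally have "w = ZeroMor C (Tgt C e) (Tgt C v)"
        using epi_mor_zero[OF e, of w] by simp
      then have "v \<cdot> q = ZeroMor C P (Tgt C v)"
        using w(4) by simp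
      then have "(v \<cdot> q) \<cdot> j = ZeroMor C (Src C y) (Tgt C v)"
        by simp
      then show "v = ZeroMor C (Tgt C (q \<cdot> k)) (Tgt C v)"
        by (simp add: bi)
    qed simp
    \<comment> \<open>The two sides of the square are compared after adding
      \<open>m \<cdot> (q \<cdot> k)\<close>, where \<open>m = -y\<close>: both sums are
      zero.\<close>
    have "Plus C (e \<cdot> (p \<cdot> k)) (m \<cdot> (q \<cdot> k)) = r \<cdot> k"
      by (simp add: r_def)
    also have "\<dots> = Plus C y m \<cdot> (q \<cdot> k)"
      by simp
    also have "\<dots> = Plus C (y \<cdot> (q \<cdot> k)) (m \<cdot> (q \<cdot> k))"
      by (subst comp_plus) simp_all
    finally show "e \<cdot> (p \<cdot> k) = y \<cdot> (q \<cdot> k)"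
      by (simp add: plus_commute[of _ "m \<cdot> (q \<cdot> k)"])
  qed simp_all
qed

text \<open>If \<open>v\<close> kills the factor \<open>e\<close>, then \<open>f\<close> factors
  through the possibly smaller subobject \<open>k \<cdot> j\<close>, with \<open>j\<close> the
  kernel of \<open>v\<close>. This subobject is the kernel of some \<open>g\<close>; as
  \<open>g\<close> kills \<open>f\<close>, it factors through \<open>c\<close> and therefore kills
  \<open>k\<close> as well. Hence \<open>j\<close> has a section and \<open>v = 0\<close>.\<close>

lemma ex_image:
  assumes f: "f \<in> Arr C" and c: "is_cokernel C f c" and k: "is_kernel C c k"
  obtains e where "epi_mor C e" "Src C e = Src C f" "Tgt C e = Src C k" "k \<cdot> e = f"
proof -
  note [simp] = f is_kernelD[OF k] is_cokernelD[OF c]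
  obtain e where e [simp]: "e \<in> Arr C" "Src C e = Src C f" "Tgt C e = Src C k" "k \<cdot> e = f"
    using is_kernel_factor[OF k, of f] by auto
  have "epi_mor C e"
  proof (rule epi_morI)
    fix v
    assume v [simp]: "v \<in> Arr C" "Src C v = Tgt C e" and v0: "v \<cdot> e = ZeroMor C (Src C e) (Tgt C v)"
    obtain j where j: "is_kernel C v j"
      using ex_kernel[of v] by auto
    note [simp] = is_kernelD[OF j]
    obtain e' where e' [simp]: "e' \<in> Arr C" "Src C e' = Src C e" "Tgt C e' = Src C j" "j \<cdot> e' = e"
      using is_kernel_factor[OF j, of e] v0 by auto
    have "mono_mor C (k \<cdot> j)"
      using mono_comp is_kernel_mono j k by simp
    then obtain g where g: "is_kernel C g (k \<cdot> j)"
      using mono_normal by blast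
    have gT: "Src C g = Src C c" and [simp]: "g \<in> Arr C"
      using is_kernelD[OF g] by simp_all
    have "g \<cdot> f = (g \<cdot> (k \<cdot> j)) \<cdot> e'"
      using gT by simp
    also have "\<dots> = ZeroMor C (Src C f) (Tgt C g)"
      unfolding is_kernelD(4)[OF g] by simp
    finally obtain w where w [simp]: "w \<in> Arr C" "Src C w = Tgt C c" "Tgt C w = Tgt C g" "w \<cdot> c = g"
      using is_cokernel_factor[OF c, of g] gT by auto
    have "g \<cdot> k = w \<cdot> (c \<cdot> k)"
      using reassoc[OF w(4), of k] by simp
    also have "\<dots> = ZeroMor C (Src C k) (Tgt C g)"
      by simp
    finally obtain s where s [simp]: "s \<in> Arr C" "Src C s = Src C k" "Tgt C s = Src C j"
      "k \<cdot> (j \<cdot> s) = k"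
      using is_kernel_factor[OF g, of k] gT by auto
    have "j \<cdot> s = Ident C (Src C k)"
      by (rule mono_morD[OF is_kernel_mono[OF k]]) simp_all
    then have "v = (v \<cdot> j) \<cdot> s"
      by (simp del: is_kernelD(4)[OF j])
    also have "\<dots> = ZeroMor C (Tgt C e) (Tgt C v)"
      by simp
    finally show "v = ZeroMor C (Tgt C e) (Tgt C v)" .
  qed simp
  then show ?thesis
    using that e by blast
qed

text \<open>Diagram chases are done with generalised elements \<open>x : X \<rightarrow> B\<close>; an element is lifted along
  a map only after restriction along some epimorphism.\<close>

lemma exact_pair_iff:
  "exact_pair C f g \<longleftrightarrow> f \<in> Arr C \<and> g \<in> Arr C \<and> Tgt C f = Src C g \<and>
     g \<cdot> f = ZeroMor C (Src C f) (Tgt C g) \<and>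
     (\<forall>x\<in>Arr C. Tgt C x = Src C g \<longrightarrow> g \<cdot> x = ZeroMor C (Src C x) (Tgt C g) \<longrightarrow>
       (\<exists>e y. epi_mor C e \<and> Tgt C e = Src C x \<and> y \<in> Arr C \<and> Src C y = Src C e \<and>
         Tgt C y = Src C f \<and> f \<cdot> y = x \<cdot> e))"
  (is "_ \<longleftrightarrow> ?R")
proof
  assume ex: "exact_pair C f g"
  then obtain c k where c: "is_cokernel C f c" and k: "is_kernel C c k" and gk: "is_kernel C g k"
    unfolding exact_pair_def by blast
  note [simp] = is_cokernelD[OF c] is_kernelD[OF k] is_kernelD[OF gk]
  have cg: "Src C g = Tgt C f"
    using is_kernelD(3)[OF k] is_kernelD(3)[OF gk] by simp
  obtain e where e: "epi_mor C e" and e_simps [simp]: "Src C e = Src C f" "Tgt C e = Src C k" "k \<cdot> e = f"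
    using ex_image[OF _ c k] by auto
  note [simp] = epi_mor_arr[OF e]
  show ?R
  proof (intro conjI ballI impI)
    have "g \<cdot> f = (g \<cdot> k) \<cdot> e"
      using cg by (simp del: is_kernelD(4)[OF gk])
    then show "g \<cdot> f = ZeroMor C (Src C f) (Tgt C g)"
      by simp
  next
    fix x
    assume x: "x \<in> Arr C" "Tgt C x = Src C g" "g \<cdot> x = ZeroMor C (Src C x) (Tgt C g)"
    then obtain y where y [simp]: "y \<in> Arr C" "Src C y = Src C x" "Tgt C y = Src C k" "k \<cdot> y = x"
      using is_kernel_factor[OF gk, of x] by blast
    \<comment> \<open>\<open>x\<close> factors as \<open>k \<cdot> y\<close> through the image;
      pulling the epi part \<open>e\<close> of \<open>f\<close> back along \<open>y\<close> lifts it
      to the source of \<open>f\<close>.\<close>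
    obtain e' y' where "epi_mor C e'" and *: "Tgt C e' = Src C y" "y' \<in> Arr C" "Src C y' = Src C e'"
      "Tgt C y' = Src C e" "e \<cdot> y' = y \<cdot> e'"
      using epi_pullback[OF e, of y] by auto
    moreover have "f \<cdot> y' = k \<cdot> (e \<cdot> y')"
      using * reassoc[of k e f y'] by simp
    then have "f \<cdot> y' = x \<cdot> e'"
      using * reassoc[of k y x e'] \<open>epi_mor C e'\<close>[THEN epi_mor_arr] by simp
    ultimately show "\<exists>e y. epi_mor C e \<and> Tgt C e = Src C x \<and> y \<in> Arr C \<and> Src C y = Src C e \<and>
         Tgt C y = Src C f \<and> f \<cdot> y = x \<cdot> e"
      by auto
  qed (use cg in simp_all)
next
  assume R: ?R
  then have fg [simp]: "f \<in> Arr C" "g \<in> Arr C" "Tgt C f = Src C g"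
    and gf: "g \<cdot> f = ZeroMor C (Src C f) (Tgt C g)"
    by blast+
  obtain c where c: "is_cokernel C f c"
    using ex_cokernel by force
  note [simp] = is_cokernelD[OF c]
  obtain k where k: "is_kernel C c k"
    using ex_kernel[of c] by auto
  note [simp] = is_kernelD[OF k]
  obtain w where w [simp]: "w \<in> Arr C" "Tgt C w = Tgt C g" "Src C w = Tgt C c" "w \<cdot> c = g"
    using is_cokernel_factor[OF c, of g] gf by auto
  have "is_kernel C g k"
  proof (rule is_kernelI)
    have "g \<cdot> k = w \<cdot> (c \<cdot> k)"
      using reassoc[OF w(4), of k] by simp
    then show "g \<cdot> k = ZeroMor C (Src C k) (Tgt C g)"
      by simp
    fix h
    assume h: "h \<in> Arr C" "Tgt C h = Src C g" "g \<cdot> h = ZeroMor C (Src C h) (Tgt C g)"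
    then obtain e y where e: "epi_mor C e" and y: "Tgt C e = Src C h" "y \<in> Arr C" "Src C y = Src C e"
      "Tgt C y = Src C f" "f \<cdot> y = h \<cdot> e"
      using R by blast
    \<comment> \<open>\<open>h\<close> is only known to lift along \<open>f\<close> after
      restriction along \<open>e\<close>; since \<open>e\<close> is epi,
      \<open>c \<cdot> h = 0\<close> follows all the same.\<close>
    have "c \<cdot> (h \<cdot> e) = (c \<cdot> f) \<cdot> y"
      using y by (simp del: is_cokernelD(4)[OF c])
    also have "\<dots> = ZeroMor C (Src C e) (Tgt C c)"
      using y by simp
    finally have "c \<cdot> h = ZeroMor C (Src C h) (Tgt C c)"
      using epi_mor_zero[OF e, of "c \<cdot> h"] h y e[THEN epi_mor_arr] by simp
    then show "\<exists>u\<in>Arr C. Src C u = Src C h \<and> Tgt C u = Src C k \<and> k \<cdot> u = h"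
      using is_kernel_factor[OF k, of h] h by (metis fg(3) is_cokernelD(3)[OF c])
  qed (use is_kernel_mono[OF k] in simp_all)
  then show "exact_pair C f g"
    using c k unfolding exact_pair_def by auto
qed

lemma exact_pairD:
  assumes "exact_pair C f g"
  shows "f \<in> Arr C" "g \<in> Arr C" "Tgt C f = Src C g" "g \<cdot> f = ZeroMor C (Src C f) (Tgt C g)"
  using assms exact_pair_iff by blast+

lemma exact_pair_lift:
  assumes "exact_pair C f g" "x \<in> Arr C" "Tgt C x = Src C g" "g \<cdot> x = ZeroMor C (Src C x) (Tgt C g)"
  obtains e y where "epi_mor C e" "e \<in> Arr C" "Tgt C e = Src C x" "y \<in> Arr C" "Src C y = Src C e"
    "Tgt C y = Src C f" "f \<cdot> y = x \<cdot> e"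
proof -
  obtain e y where ey: "epi_mor C e" "Tgt C e = Src C x" "y \<in> Arr C" "Src C y = Src C e"
    "Tgt C y = Src C f" "f \<cdot> y = x \<cdot> e"
    using assms(1)[unfolded exact_pair_iff] assms(2-4) by blast
  from that[OF ey(1) epi_mor_arr[OF ey(1)] ey(2-6)] show ?thesis .
qed

lemma exact_pairI:
  assumes "f \<in> Arr C" "g \<in> Arr C" "Tgt C f = Src C g" "g \<cdot> f = ZeroMor C (Src C f) (Tgt C g)"
    and "\<And>x. x \<in> Arr C \<Longrightarrow> Tgt C x = Src C g \<Longrightarrow> g \<cdot> x = ZeroMor C (Src C x) (Tgt C g) \<Longrightarrow>
       \<exists>e y. epi_mor C e \<and> Tgt C e = Src C x \<and> y \<in> Arr C \<and> Src C y = Src C e \<and>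
         Tgt C y = Src C f \<and> f \<cdot> y = x \<cdot> e"
  shows "exact_pair C f g"
  unfolding exact_pair_iff using assms by blast

text \<open>Vanishing becomes an equation between morphisms, which can be checked after a mono or on
  the maps into a colimit.\<close>

lemma zero_object_iff:
  "zero_object C Z \<longleftrightarrow> Z \<in> Obj C \<and> Ident C Z = ZeroMor C Z Z"
proof
  assume "zero_object C Z"
  then have "Z \<in> Obj C" "\<exists>!f. f \<in> Hom C Z Z"
    unfolding zero_object_def by blast+
  moreover from this(1) have "Ident C Z \<in> Hom C Z Z" "ZeroMor C Z Z \<in> Hom C Z Z"
    by simp_all
  ultimately show "Z \<in> Obj C \<and> Ident C Z = ZeroMor C Z Z"
    by blast
next
  assume Z: "Z \<in> Obj C \<and> Ident C Z = ZeroMor C Z Z"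
  have "f = ZeroMor C Z A" if "f \<in> Hom C Z A" for f A
  proof -
    have "f = f \<cdot> Ident C Z"
      using that by simp
    then show ?thesis
      using that Z by simp
  qed
  moreover have "f = ZeroMor C A Z" if "f \<in> Hom C A Z" for f A
  proof -
    have "f = Ident C Z \<cdot> f"
      using that by simp
    then show ?thesis
      using that Z by simp
  qed
  ultimately show "zero_object C Z"
    unfolding zero_object_def using Z
    by (auto intro!: ex1I[of _ "ZeroMor C _ _"] simp del: Hom_iff) (simp_all)
qed

lemma zero_object_arr:
  assumes "zero_object C Z" "f \<in> Arr C"
  shows "Src C f = Z \<Longrightarrow> f = ZeroMor C Z (Tgt C f)" "Tgt C f = Z \<Longrightarrow> f = ZeroMor C (Src C f) Z"
proof -
  show "f = ZeroMor C Z (Tgt C f)" if "Src C f = Z"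
    using assms that ident_comp(2)[of f Z] by (simp add: zero_object_iff)
  show "f = ZeroMor C (Src C f) Z" if "Tgt C f = Z"
    using assms that ident_comp(1)[of f Z] by (simp add: zero_object_iff)
qed

lemma projective_lift:
  assumes "projective C P" "epi_mor C e" "f \<in> Arr C" "Src C f = P" "Tgt C f = Tgt C e"
  obtains g where "g \<in> Arr C" "Src C g = P" "Tgt C g = Src C e" "e \<cdot> g = f"
  using assms unfolding projective_def by (metis Hom_iff)

end

section \<open>Left satellites\<close>

context abelian_category
begin

text \<open>Projectivity gives \<open>g\<close>, and
  \<open>\<pi> \<cdot> g \<cdot> i = f \<cdot> p \<cdot> i = 0\<close> makes it restrict to kernels.
  With \<open>f\<close> an identity this compares a resolution with an arbitrary short exact
  sequence.\<close>

lemma ex_lift: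
  assumes ip: "short_exact C i p" "projective C (Src C p)" and \<iota>\<pi>: "short_exact C \<iota> \<pi>"
    and f: "f \<in> Arr C" "Src C f = Tgt C p" "Tgt C f = Tgt C \<pi>"
  obtains g h where "g \<in> Arr C" "Src C g = Src C p" "Tgt C g = Src C \<pi>" "\<pi> \<cdot> g = f \<cdot> p"
    "h \<in> Arr C" "Src C h = Src C i" "Tgt C h = Src C \<iota>" "\<iota> \<cdot> h = g \<cdot> i"
proof -
  note [simp] = short_exact_simps[OF ip(1)] short_exact_simps[OF \<iota>\<pi>] f
  obtain g where g [simp]: "g \<in> Arr C" "Src C g = Src C p" "Tgt C g = Src C \<pi>"
    and eq: "\<pi> \<cdot> g = f \<cdot> p"
    using projective_lift[OF ip(2) short_exactD(4)[OF \<iota>\<pi>], of "f \<cdot> p"] by auto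
  have "\<pi> \<cdot> (g \<cdot> i) = ZeroMor C (Src C i) (Tgt C \<pi>)"
    using reassoc[OF eq, of i] by simp
  then obtain h where "h \<in> Arr C" "Src C h = Src C i" "Tgt C h = Src C \<iota>" "\<iota> \<cdot> h = g \<cdot> i"
    using is_kernel_factor[OF short_exactD(1)[OF \<iota>\<pi>], of "g \<cdot> i"] by auto
  then show ?thesis
    using that g eq by blast
qed

text \<open>The sequence obtained is \<open>0 \<rightarrow> K \<rightarrow> A \<oplus> P \<rightarrow> B \<rightarrow> 0\<close> with maps \<open>(h, i)\<close> and \<open>(\<iota>, -g)\<close>.\<close>

lemma short_exact_mapping_cone:
  assumes ip: "short_exact C i p" and \<iota>\<pi>: "short_exact C \<iota> \<pi>" and CC: "Tgt C p = Tgt C \<pi>"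
    and g: "g \<in> Arr C" "Src C g = Src C p" "Tgt C g = Src C \<pi>" "\<pi> \<cdot> g = p"
    and h: "h \<in> Arr C" "Src C h = Src C i" "Tgt C h = Src C \<iota>" "\<iota> \<cdot> h = g \<cdot> i"
  obtains k r a p' q' where "short_exact C k r" "p' \<in> Arr C" "q' \<in> Arr C" "a \<in> Arr C"
    "Src C a = Src C \<iota>" "Tgt C a = Src C r" "Src C p' = Src C r" "Src C q' = Src C r"
    "Tgt C p' = Src C \<iota>" "Tgt C q' = Src C p" "Src C k = Src C i" "Tgt C r = Src C \<pi>"
    "p' \<cdot> k = h" "q' \<cdot> k = i" "r \<cdot> a = \<iota>" "p' \<cdot> a = Ident C (Src C \<iota>)"
    "q' \<cdot> a = ZeroMor C (Src C \<iota>) (Src C p)"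
proof -
  note ipS [simp] = short_exact_simps(1-3)[OF ip] short_exact_simps(1-3)[OF \<iota>\<pi>] CC
  note gS [simp] = g(1-3) h(1-3)
  obtain P p' q' i' j' where "p' \<in> Hom C P (Src C \<iota>)" "q' \<in> Hom C P (Src C p)"
    "i' \<in> Hom C (Src C \<iota>) P" "j' \<in> Hom C (Src C p) P" and P [simp]: "P \<in> Obj C"
    and bi: "p' \<cdot> i' = Ident C (Src C \<iota>)" "q' \<cdot> j' = Ident C (Src C p)"
    "q' \<cdot> i' = ZeroMor C (Src C \<iota>) (Src C p)" "p' \<cdot> j' = ZeroMor C (Src C p) (Src C \<iota>)"
    and one: "Plus C (i' \<cdot> p') (j' \<cdot> q') = Ident C P"
    by (rule ex_biproduct[of "Src C \<iota>" "Src C p"]) (simp, simp, rule that)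
  then have [simp]: "p' \<in> Arr C" "q' \<in> Arr C" "i' \<in> Arr C" "j' \<in> Arr C"
    "Src C p' = P" "Src C q' = P" "Tgt C i' = P" "Tgt C j' = P"
    "Tgt C p' = Src C \<iota>" "Tgt C q' = Src C p" "Src C i' = Src C \<iota>" "Src C j' = Src C p"
    by simp_all
  obtain m where m [simp]: "m \<in> Arr C" "Src C m = Src C p" "Tgt C m = Src C \<pi>"
    and gm: "Plus C g m = ZeroMor C (Src C p) (Src C \<pi>)"
    using ex_neg[of g] by auto
  define r where "r = Plus C (\<iota> \<cdot> p') (m \<cdot> q')"
  have r [simp]: "r \<in> Arr C" "Src C r = P" "Tgt C r = Src C \<pi>"
    and ri: "r \<cdot> i' = \<iota>" and rj: "r \<cdot> j' = m"
    by (simp_all add: r_def bi)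
  define k where "k = Plus C (i' \<cdot> h) (j' \<cdot> i)"
  have k [simp]: "k \<in> Arr C" "Src C k = Src C i" "Tgt C k = P"
    by (simp_all add: k_def)
  have pk: "p' \<cdot> k = h" and qk: "q' \<cdot> k = i"
    by (simp_all add: k_def bi(1-4)[THEN reassoc])
  have gm': "Plus C (g \<cdot> x) (m \<cdot> x) = ZeroMor C (Src C x) (Src C \<pi>)"
    if "x \<in> Arr C" "Tgt C x = Src C p" for x
    using arg_cong[OF gm, of "\<lambda>u. u \<cdot> x"] that by (subst (asm) comp_plus) simp_all
  have k_mono: "mono_mor C k"
    by (rule mono_of_comp[of q']) (use short_exactD(3)[OF ip] qk in simp_all)
  have k_ker: "is_kernel C r k"
  proof (rule is_kernelI)
    have "r \<cdot> k = Plus C (\<iota> \<cdot> h) (m \<cdot> i)"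
      by (simp add: r_def pk qk)
    then show "r \<cdot> k = ZeroMor C (Src C k) (Tgt C r)"
      using gm'[of i] h(4) by simp
    fix x
    assume x [simp]: "x \<in> Arr C" "Tgt C x = Src C r" and x0: "r \<cdot> x = ZeroMor C (Src C x) (Tgt C r)"
    \<comment> \<open>Let \<open>a\<close> and \<open>b\<close> be the components of
      \<open>x\<close>. Since \<open>m = -g\<close>, the assumption says
      \<open>\<iota> \<cdot> a = g \<cdot> b\<close>. Then
      \<open>p \<cdot> b = \<pi> \<cdot> \<iota> \<cdot> a = 0\<close>, so
      \<open>b = i \<cdot> u\<close> for some \<open>u\<close>, and \<open>h \<cdot> u = a\<close>
      because \<open>\<iota>\<close> is mono.\<close>
    have "Plus C (\<iota> \<cdot> (p' \<cdot> x)) (m \<cdot> (q' \<cdot> x)) = r \<cdot> x"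
      by (simp add: r_def)
    also have "\<dots> = Plus C (g \<cdot> (q' \<cdot> x)) (m \<cdot> (q' \<cdot> x))"
      using x0 gm'[of "q' \<cdot> x"] by simp
    finally have ipx: "\<iota> \<cdot> (p' \<cdot> x) = g \<cdot> (q' \<cdot> x)"
      by (simp add: plus_commute[of _ "m \<cdot> (q' \<cdot> x)"])
    have "p \<cdot> (q' \<cdot> x) = \<pi> \<cdot> (g \<cdot> (q' \<cdot> x))"
      using reassoc[OF g(4), of "q' \<cdot> x"] by simp
    also have "\<dots> = ZeroMor C (Src C x) (Tgt C p)"
      unfolding ipx[symmetric]
      using reassoc[OF short_exact_simps(4)[OF \<iota>\<pi>], of "p' \<cdot> x"] by simp
    finally obtain u where u [simp]: "u \<in> Arr C" "Src C u = Src C x" "Tgt C u = Src C i"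
      and iu: "i \<cdot> u = q' \<cdot> x"
      using is_kernel_factor[OF short_exactD(1)[OF ip], of "q' \<cdot> x"] by auto
    have "\<iota> \<cdot> (h \<cdot> u) = \<iota> \<cdot> (p' \<cdot> x)"
      using ipx iu reassoc[OF h(4), of u] by simp
    then have hu: "h \<cdot> u = p' \<cdot> x"
      by (rule_tac mono_morD[OF short_exactD(3)[OF \<iota>\<pi>]]) simp_all
    have "k \<cdot> u = Plus C (i' \<cdot> p') (j' \<cdot> q') \<cdot> x"
      by (subst comp_plus) (simp_all add: k_def hu iu)
    then have "k \<cdot> u = x"
      using one by simp
    then show "\<exists>u\<in>Arr C. Src C u = Src C x \<and> Tgt C u = Src C k \<and> k \<cdot> u = x"
      by (intro bexI[of _ u]) simp_all
  qed (use k_mono in simp_all)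
  have "epi_mor C r"
  proof (rule epi_morI)
    fix v
    assume v [simp]: "v \<in> Arr C" "Src C v = Tgt C r" and v0: "v \<cdot> r = ZeroMor C (Src C r) (Tgt C v)"
    have "v \<cdot> \<iota> = (v \<cdot> r) \<cdot> i'"
      using ri by simp
    then have "v \<cdot> \<iota> = ZeroMor C (Src C \<iota>) (Tgt C v)"
      unfolding v0 by simp
    \<comment> \<open>As \<open>v\<close> kills \<open>\<iota>\<close>, it factors through
      \<open>\<pi>\<close>; the factor satisfies
      \<open>w \<cdot> p = w \<cdot> \<pi> \<cdot> g = v \<cdot> g = 0\<close>, and \<open>p\<close>
      is epi.\<close>
    then obtain w where w [simp]: "w \<in> Arr C" "Tgt C w = Tgt C v" "Src C w = Tgt C \<pi>" "w \<cdot> \<pi> = v"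
      using is_cokernel_factor[OF short_exactD(2)[OF \<iota>\<pi>], of v] by auto
    have "v \<cdot> m = (v \<cdot> r) \<cdot> j'"
      using rj by simp
    then have vm: "v \<cdot> m = ZeroMor C (Src C p) (Tgt C v)"
      unfolding v0 by simp
    have "v \<cdot> Plus C g m = ZeroMor C (Src C p) (Tgt C v)"
      using gm by simp
    then have "v \<cdot> g = ZeroMor C (Src C p) (Tgt C v)"
      using vm by (subst (asm) comp_plus) simp_all
    moreover have "w \<cdot> p = (w \<cdot> \<pi>) \<cdot> g"
      using g(4) by (simp del: w(4))
    ultimately have "w \<cdot> p = ZeroMor C (Src C p) (Tgt C v)"
      by simp
    then have "w = ZeroMor C (Tgt C p) (Tgt C w)"
      by (intro epi_mor_zero[OF short_exactD(4)[OF ip]]) simp_all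
    then show "v = ZeroMor C (Tgt C r) (Tgt C v)"
      using w by (metis CC comp_zero(1) ipS(5) r(3) src_tgt_obj(2))
  qed simp
  then have "short_exact C k r"
    using k_ker short_exact_kernelI by blast
  then show ?thesis
    using that[of k r p' q' i'] pk qk ri bi by simp
qed

text \<open>P -> B -> C is again an epi, and the kernels of P -> B and P -> C differ by A. For
  projective P this turns a resolution of B into one of C whose syzygy is an extension of A by the
  syzygy of B.\<close>

lemma short_exact_syzygy:
  assumes ip: "short_exact C i p" and \<iota>\<pi>: "short_exact C \<iota> \<pi>" and CC: "Tgt C p = Src C \<pi>"
  obtains j w q where "short_exact C j (\<pi> \<cdot> p)" "short_exact C w q" "Src C w = Src C i"
    "Tgt C w = Src C j" "Tgt C q = Src C \<iota>" "j \<cdot> w = i" "\<iota> \<cdot> q = p \<cdot> j"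
proof -
  note ipS [simp] = short_exact_simps(1-3)[OF ip] short_exact_simps(1-3)[OF \<iota>\<pi>] CC
  note ip0 = short_exact_simps(4)[OF ip] and \<iota>\<pi>0 = short_exact_simps(4)[OF \<iota>\<pi>]
  have epi: "epi_mor C (\<pi> \<cdot> p)"
    using epi_comp short_exactD(4) ip \<iota>\<pi> CC by blast
  obtain j where j: "is_kernel C (\<pi> \<cdot> p) j"
    using ex_kernel[of "\<pi> \<cdot> p"] by auto
  have [simp]: "j \<in> Arr C" "Tgt C j = Src C p"
    and pj: "\<pi> \<cdot> (p \<cdot> j) = ZeroMor C (Src C j) (Tgt C \<pi>)"
    using is_kernelD[OF j] by simp_all
  obtain q where q [simp]: "q \<in> Arr C" "Src C q = Src C j" "Tgt C q = Src C \<iota>" and qj: "\<iota> \<cdot> q = p \<cdot> j"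
    using is_kernel_factor[OF short_exactD(1)[OF \<iota>\<pi>], of "p \<cdot> j"] pj by auto
  obtain w where w [simp]: "w \<in> Arr C" "Src C w = Src C i" "Tgt C w = Src C j" and jw: "j \<cdot> w = i"
    using is_kernel_factor[OF j, of i] ip0 by auto
  have "mono_mor C w"
    by (rule mono_of_comp[of j]) (use jw short_exactD(3)[OF ip] in simp_all)
  moreover have "is_kernel C q w"
  proof (rule is_kernelI)
    have "\<iota> \<cdot> (q \<cdot> w) = \<iota> \<cdot> ZeroMor C (Src C w) (Tgt C q)"
      using reassoc[OF qj, of w] jw ip0 by simp
    then show "q \<cdot> w = ZeroMor C (Src C w) (Tgt C q)"
      by (rule_tac mono_morD[OF short_exactD(3)[OF \<iota>\<pi>]]) simp_all
    fix h
    assume h [simp]: "h \<in> Arr C" "Tgt C h = Src C q" and h0: "q \<cdot> h = ZeroMor C (Src C h) (Tgt C q)"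
    have "p \<cdot> (j \<cdot> h) = \<iota> \<cdot> (q \<cdot> h)"
      using reassoc[OF qj, of h] by simp
    then obtain u where u [simp]: "u \<in> Arr C" "Src C u = Src C h" "Tgt C u = Src C i"
      and iu: "i \<cdot> u = j \<cdot> h"
      using is_kernel_factor[OF short_exactD(1)[OF ip], of "j \<cdot> h"] h0 by auto
    have "j \<cdot> (w \<cdot> u) = j \<cdot> h"
      using reassoc[OF jw, of u] iu by simp
    then have "w \<cdot> u = h"
      by (rule_tac mono_morD[OF is_kernel_mono[OF j]]) simp_all
    then show "\<exists>u\<in>Arr C. Src C u = Src C h \<and> Tgt C u = Src C w \<and> w \<cdot> u = h"
      by (intro bexI[of _ u]) simp_all
  qed (use calculation in simp_all)
  moreover have "epi_mor C q"
  proof -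
    \<comment> \<open>Surjectivity of \<open>q\<close>: after restriction along an epi,
      \<open>\<iota>\<close> lifts along \<open>p\<close>; the lift dies in C and so comes from the
      kernel \<open>j\<close>.\<close>
    obtain e y where e: "epi_mor C e" and y [simp]: "Tgt C e = Src C \<iota>" "y \<in> Arr C" "Src C y = Src C e"
      "Tgt C y = Src C p" "p \<cdot> y = \<iota> \<cdot> e"
      using epi_pullback[OF short_exactD(4)[OF ip], of \<iota>] by auto
    note [simp] = epi_mor_arr[OF e]
    have "\<pi> \<cdot> (p \<cdot> y) = ZeroMor C (Src C e) (Tgt C \<pi>)"
      using reassoc[OF \<iota>\<pi>0, of e] by simp
    then obtain s where s [simp]: "s \<in> Arr C" "Src C s = Src C y" "Tgt C s = Src C j" and js: "j \<cdot> s = y"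
      using is_kernel_factor[OF j, of y] by auto
    have "\<iota> \<cdot> (q \<cdot> s) = \<iota> \<cdot> e"
      using reassoc[OF qj, of s] js by simp
    then have "q \<cdot> s = e"
      by (rule_tac mono_morD[OF short_exactD(3)[OF \<iota>\<pi>]]) simp_all
    then show ?thesis
      using epi_of_comp[of q s] e by simp
  qed
  ultimately have "short_exact C w q"
    using short_exact_kernelI by blast
  then show ?thesis
    using that[OF short_exact_kernelI[OF j epi]] jw qj by simp
qed

end

section \<open>Additive functors and their effect on lifts\<close>

locale two_abelian = C: abelian_category C + D: abelian_category D
  for C :: "('o, 'm) ab_cat" and D :: "('p, 'q) ab_cat"

locale additive_ftor = two_abelian C D
  for C :: "('o, 'm) ab_cat" and D :: "('p, 'q) ab_cat" +
  fixes F :: "('o, 'm, 'p, 'q) ftor"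
  assumes additive: "additive_functor C D F"
begin

lemma fobj_obj [simp]: "A \<in> Obj C \<Longrightarrow> fobj F A \<in> Obj D"
  and fmap_ident [simp]: "A \<in> Obj C \<Longrightarrow> fmap F (Ident C A) = Ident D (fobj F A)"
  using additive unfolding additive_functor_def by blast+

lemma fmap_arr [simp]:
  assumes "f \<in> Arr C"
  shows "fmap F f \<in> Arr D" "Src D (fmap F f) = fobj F (Src C f)" "Tgt D (fmap F f) = fobj F (Tgt C f)"
proof -
  have "f \<in> Hom C (Src C f) (Tgt C f)"
    using assms by simp
  then have "fmap F f \<in> Hom D (fobj F (Src C f)) (fobj F (Tgt C f))"
    using additive unfolding additive_functor_def by blast
  then show "fmap F f \<in> Arr D" "Src D (fmap F f) = fobj F (Src C f)" "Tgt D (fmap F f) = fobj F (Tgt C f)"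
    by simp_all
qed

lemma fmap_comp [simp]:
  assumes "f \<in> Arr C" "g \<in> Arr C" "Tgt C f = Src C g"
  shows "fmap F (g \<cdot>\<^bsub>C\<^esub> f) = fmap F g \<cdot>\<^bsub>D\<^esub> fmap F f"
proof -
  have "f \<in> Hom C (Src C f) (Src C g)" "g \<in> Hom C (Src C g) (Tgt C g)"
    using assms by simp_all
  then show ?thesis
    using additive unfolding additive_functor_def by blast
qed

lemma fmap_plus [simp]:
  assumes "f \<in> Arr C" "g \<in> Arr C" "Src C f = Src C g" "Tgt C f = Tgt C g"
  shows "fmap F (Plus C f g) = Plus D (fmap F f) (fmap F g)"
proof -
  have "f \<in> Hom C (Src C g) (Tgt C g)" "g \<in> Hom C (Src C g) (Tgt C g)"
    using assms by simp_all
  then show ?thesis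
    using additive unfolding additive_functor_def by blast
qed

lemma fmap_zero [simp]:
  assumes "A \<in> Obj C" "B \<in> Obj C"
  shows "fmap F (ZeroMor C A B) = ZeroMor D (fobj F A) (fobj F B)"
proof -
  let ?z = "fmap F (ZeroMor C A B)"
  have "Plus D ?z ?z = fmap F (Plus C (ZeroMor C A B) (ZeroMor C A B))"
    using assms by (subst fmap_plus) simp_all
  also have "\<dots> = ?z"
    using assms by simp
  finally show ?thesis
    using assms by simp
qed

lemma fmap_reassoc:
  assumes "g \<cdot>\<^bsub>C\<^esub> f = r" "f \<in> Arr C" "g \<in> Arr C" "Tgt C f = Src C g"
    "x \<in> Arr D" "Tgt D x = fobj F (Src C f)"
  shows "fmap F g \<cdot>\<^bsub>D\<^esub> (fmap F f \<cdot>\<^bsub>D\<^esub> x) = fmap F r \<cdot>\<^bsub>D\<^esub> x"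
  using assms by auto

text \<open>Two lifts of the same map differ by something factoring through \<open>i\<close>, which is killed on
  the kernel of \<open>F i\<close>.\<close>

lemma lift_unique:
  assumes ip': "is_kernel C p' i'" and i: "i \<in> Arr C"
    and g1: "g1 \<in> Arr C" "Src C g1 = Tgt C i" "Tgt C g1 = Src C p'"
    and g2: "g2 \<in> Arr C" "Src C g2 = Tgt C i" "Tgt C g2 = Src C p'"
    and h1: "h1 \<in> Arr C" "Src C h1 = Src C i" "Tgt C h1 = Src C i'" "i' \<cdot>\<^bsub>C\<^esub> h1 = g1 \<cdot>\<^bsub>C\<^esub> i"
    and h2: "h2 \<in> Arr C" "Src C h2 = Src C i" "Tgt C h2 = Src C i'" "i' \<cdot>\<^bsub>C\<^esub> h2 = g2 \<cdot>\<^bsub>C\<^esub> i"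
    and eq: "p' \<cdot>\<^bsub>C\<^esub> g1 = p' \<cdot>\<^bsub>C\<^esub> g2"
    and z: "z \<in> Arr D" "Tgt D z = fobj F (Src C i)"
      "fmap F i \<cdot>\<^bsub>D\<^esub> z = ZeroMor D (Src D z) (fobj F (Tgt C i))"
  shows "fmap F h1 \<cdot>\<^bsub>D\<^esub> z = fmap F h2 \<cdot>\<^bsub>D\<^esub> z"
proof -
  note [simp] = C.is_kernelD[OF ip'] i g1 g2 h1(1-3) h2(1-3) z
  obtain d where d [simp]: "d \<in> Arr C" "Src C d = Tgt C i" "Tgt C d = Src C p'" and g1d: "g1 = Plus C g2 d"
    using C.ex_diff[of g1 g2] by auto
  have "p' \<cdot>\<^bsub>C\<^esub> d = ZeroMor C (Src C d) (Tgt C p')"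
    using eq unfolding g1d by simp
  then obtain t where t [simp]: "t \<in> Arr C" "Src C t = Tgt C i" "Tgt C t = Src C i'" and it: "i' \<cdot>\<^bsub>C\<^esub> t = d"
    using C.is_kernel_factor[OF ip', of d] by auto
  have "i' \<cdot>\<^bsub>C\<^esub> h1 = i' \<cdot>\<^bsub>C\<^esub> Plus C h2 (t \<cdot>\<^bsub>C\<^esub> i)"
    using h1(4) h2(4) C.reassoc[OF it, of i] unfolding g1d by simp
  then have h1t: "h1 = Plus C h2 (t \<cdot>\<^bsub>C\<^esub> i)"
    by (rule_tac C.mono_morD[OF C.is_kernel_mono[OF ip']]) simp_all
  show ?thesis
    unfolding h1t by simp
qed

end

section \<open>The functor S^-1 F and its connecting map\<close>

locale satellite_data = two_abelian C D
  for C :: "('o, 'm) ab_cat" and D :: "('p, 'q) ab_cat" +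
  fixes i p :: "'o \<Rightarrow> 'm" and \<kappa> :: "'q \<Rightarrow> 'q"
  assumes choice: "satellite_choice C D i p \<kappa>"
begin

abbreviation "Sat \<equiv> satellite C D i p \<kappa>"

lemma resolution:
  assumes "M \<in> Obj C"
  shows "short_exact C (i M) (p M)" "projective C (Src C (p M))" "Tgt C (p M) = M"
  using assms choice unfolding satellite_choice_def by auto

lemma resolution_simps [simp]:
  assumes "M \<in> Obj C"
  shows "Tgt C (p M) = M" "i M \<in> Arr C" "p M \<in> Arr C" "Tgt C (i M) = Src C (p M)"
    "p M \<cdot>\<^bsub>C\<^esub> i M = ZeroMor C (Src C (i M)) M"
  using assms resolution[of M] C.short_exact_simps[of "i M" "p M"] by simp_all

lemma ex_resolution_lift:
  assumes "f \<in> Arr C"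
  obtains g h where "g \<in> Arr C" "Src C g = Src C (p (Src C f))" "Tgt C g = Src C (p (Tgt C f))"
    "p (Tgt C f) \<cdot>\<^bsub>C\<^esub> g = f \<cdot>\<^bsub>C\<^esub> p (Src C f)"
    "h \<in> Arr C" "Src C h = Src C (i (Src C f))" "Tgt C h = Src C (i (Tgt C f))"
    "i (Tgt C f) \<cdot>\<^bsub>C\<^esub> h = g \<cdot>\<^bsub>C\<^esub> i (Src C f)"
  using assms
  by (rule_tac C.ex_lift[of "i (Src C f)" "p (Src C f)" "i (Tgt C f)" "p (Tgt C f)" f])
    (simp_all add: resolution)

lemma ex_conn_lift:
  assumes "short_exact C \<iota> \<pi>"
  obtains g h where "g \<in> Arr C" "Src C g = Src C (p (Tgt C \<pi>))" "Tgt C g = Src C \<pi>"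
    "\<pi> \<cdot>\<^bsub>C\<^esub> g = p (Tgt C \<pi>)"
    "h \<in> Arr C" "Src C h = Src C (i (Tgt C \<pi>))" "Tgt C h = Src C \<iota>"
    "\<iota> \<cdot>\<^bsub>C\<^esub> h = g \<cdot>\<^bsub>C\<^esub> i (Tgt C \<pi>)"
  by (rule C.ex_lift[of "i (Tgt C \<pi>)" "p (Tgt C \<pi>)" \<iota> \<pi> "Ident C (Tgt C \<pi>)"])
    (use assms C.short_exact_simps[OF assms] in \<open>simp_all add: resolution\<close>)

end

locale satellite_ftor = satellite_data C D i p \<kappa> + additive_ftor C D F
  for C :: "('o, 'm) ab_cat" and D :: "('p, 'q) ab_cat" and i p \<kappa> F
begin

abbreviation "ker M \<equiv> \<kappa> (fmap F (i M))"

lemma ker: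
  assumes "M \<in> Obj C"
  shows "is_kernel D (fmap F (i M)) (ker M)"
  using assms choice unfolding satellite_choice_def by simp

lemma sat_obj: "fobj (Sat F) M = Src D (ker M)"
  by (simp add: satellite_def)

lemma ker_simps [simp]:
  assumes "M \<in> Obj C"
  shows "ker M \<in> Arr D" "Tgt D (ker M) = fobj F (Src C (i M))" "Src D (ker M) = fobj (Sat F) M"
    "fmap F (i M) \<cdot>\<^bsub>D\<^esub> ker M = ZeroMor D (fobj (Sat F) M) (fobj F (Src C (p M)))"
  using D.is_kernelD[OF ker[OF assms]] assms by (simp_all add: sat_obj)

lemma sat_obj_obj [simp]: "M \<in> Obj C \<Longrightarrow> fobj (Sat F) M \<in> Obj D"
  using D.src_tgt_obj(1)[OF ker_simps(1)] by simp

text \<open>S^-1 F(M) is a subobject of F(K), so equations between maps into it are checked after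
  the inclusion \<open>ker M\<close>.\<close>

lemma ker_cancel:
  assumes "M \<in> Obj C" "u \<in> Arr D" "v \<in> Arr D" "Src D u = Src D v" "Tgt D u = fobj (Sat F) M"
    "Tgt D v = fobj (Sat F) M" "ker M \<cdot>\<^bsub>D\<^esub> u = ker M \<cdot>\<^bsub>D\<^esub> v"
  shows "u = v"
  by (rule D.mono_morD[OF D.is_kernel_mono[OF ker[OF assms(1)]]]) (use assms in simp_all)

lemma ker_factor:
  assumes "M \<in> Obj C" "z \<in> Arr D" "Tgt D z = fobj F (Src C (i M))"
    "fmap F (i M) \<cdot>\<^bsub>D\<^esub> z = ZeroMor D (Src D z) (fobj F (Src C (p M)))"
  obtains u where "u \<in> Arr D" "Src D u = Src D z" "Tgt D u = fobj (Sat F) M" "ker M \<cdot>\<^bsub>D\<^esub> u = z"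
  using D.is_kernel_factor[OF ker[OF assms(1)], of z] assms by auto

lemma ker_zero:
  assumes "M \<in> Obj C" "x \<in> Arr D" "Tgt D x = fobj (Sat F) M"
  shows "fmap F (i M) \<cdot>\<^bsub>D\<^esub> (ker M \<cdot>\<^bsub>D\<^esub> x) = ZeroMor D (Src D x) (fobj F (Src C (p M)))"
  using D.reassoc[OF ker_simps(4)[OF assms(1)], of x] assms by simp

text \<open>\<open>F h\<close> respects the kernels, and \<open>lift_unique\<close> removes the
  dependence on the lift, so the definite description is proper. The result is stated for any given
  lift, which leaves the choice to each application.\<close>

lemma sat_map:
  assumes f: "f \<in> Arr C"
    and g: "g \<in> Arr C" "Src C g = Src C (p (Src C f))" "Tgt C g = Src C (p (Tgt C f))"
    "p (Tgt C f) \<cdot>\<^bsub>C\<^esub> g = f \<cdot>\<^bsub>C\<^esub> p (Src C f)"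
    and h: "h \<in> Arr C" "Src C h = Src C (i (Src C f))" "Tgt C h = Src C (i (Tgt C f))"
    "i (Tgt C f) \<cdot>\<^bsub>C\<^esub> h = g \<cdot>\<^bsub>C\<^esub> i (Src C f)"
  shows "fmap (Sat F) f \<in> Arr D" "Src D (fmap (Sat F) f) = fobj (Sat F) (Src C f)"
    "Tgt D (fmap (Sat F) f) = fobj (Sat F) (Tgt C f)"
    "ker (Tgt C f) \<cdot>\<^bsub>D\<^esub> fmap (Sat F) f = fmap F h \<cdot>\<^bsub>D\<^esub> ker (Src C f)"
proof -
  let ?M' = "Src C f" and ?M = "Tgt C f"
  note [simp] = f g(1-3) h(1-3)
  let ?P = "\<lambda>s. s \<in> Hom D (Src D (ker ?M')) (Src D (ker ?M)) \<and>
    (\<exists>g h. g \<in> Hom C (Src C (p ?M')) (Src C (p ?M)) \<and> p ?M \<cdot>\<^bsub>C\<^esub> g = f \<cdot>\<^bsub>C\<^esub> p ?M' \<and>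
      h \<in> Hom C (Src C (i ?M')) (Src C (i ?M)) \<and> i ?M \<cdot>\<^bsub>C\<^esub> h = g \<cdot>\<^bsub>C\<^esub> i ?M' \<and>
      ker ?M \<cdot>\<^bsub>D\<^esub> s = fmap F h \<cdot>\<^bsub>D\<^esub> ker ?M')"
  have THE: "fmap (Sat F) f = The ?P"
    by (simp only: satellite_def Let_def ftor.simps)
  have "fmap F (i ?M) \<cdot>\<^bsub>D\<^esub> (fmap F h \<cdot>\<^bsub>D\<^esub> ker ?M') = ZeroMor D (fobj (Sat F) ?M') (fobj F (Src C (p ?M)))"
    using fmap_reassoc[OF h(4), of "ker ?M'"] by simp
  then obtain s where s: "s \<in> Arr D" "Src D s = fobj (Sat F) ?M'" "Tgt D s = fobj (Sat F) ?M"
    and ks: "ker ?M \<cdot>\<^bsub>D\<^esub> s = fmap F h \<cdot>\<^bsub>D\<^esub> ker ?M'"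
    using ker_factor[of ?M "fmap F h \<cdot>\<^bsub>D\<^esub> ker ?M'"] by auto
  have "The ?P = s"
  proof (rule the_equality)
    show "?P s"
      by (intro conjI exI[of _ g] exI[of _ h]) (use s ks g(4) h(4) in simp_all)
    fix s'
    assume s': "?P s'"
    then obtain g' h' where *: "g' \<in> Arr C" "Src C g' = Src C (p ?M')" "Tgt C g' = Src C (p ?M)"
      "p ?M \<cdot>\<^bsub>C\<^esub> g' = f \<cdot>\<^bsub>C\<^esub> p ?M'"
      "h' \<in> Arr C" "Src C h' = Src C (i ?M')" "Tgt C h' = Src C (i ?M)" "i ?M \<cdot>\<^bsub>C\<^esub> h' = g' \<cdot>\<^bsub>C\<^esub> i ?M'"
      and ks': "ker ?M \<cdot>\<^bsub>D\<^esub> s' = fmap F h' \<cdot>\<^bsub>D\<^esub> ker ?M'"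
      by auto
    have "fmap F h' \<cdot>\<^bsub>D\<^esub> ker ?M' = fmap F h \<cdot>\<^bsub>D\<^esub> ker ?M'"
      by (rule lift_unique[of "p ?M" "i ?M" "i ?M'" g' g])
        (use * g h C.short_exactD[OF resolution(1)] in simp_all)
    then have "ker ?M \<cdot>\<^bsub>D\<^esub> s' = ker ?M \<cdot>\<^bsub>D\<^esub> s"
      using ks ks' by simp
    then show "s' = s"
      by (rule_tac ker_cancel[of ?M]) (use s s' in simp_all)
  qed
  then show "fmap (Sat F) f \<in> Arr D" "Src D (fmap (Sat F) f) = fobj (Sat F) (Src C f)"
    "Tgt D (fmap (Sat F) f) = fobj (Sat F) (Tgt C f)"
    "ker (Tgt C f) \<cdot>\<^bsub>D\<^esub> fmap (Sat F) f = fmap F h \<cdot>\<^bsub>D\<^esub> ker (Src C f)"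
    using s ks unfolding THE by simp_all
qed

lemma sat_map_arr [simp]:
  assumes "f \<in> Arr C"
  shows "fmap (Sat F) f \<in> Arr D" "Src D (fmap (Sat F) f) = fobj (Sat F) (Src C f)"
    "Tgt D (fmap (Sat F) f) = fobj (Sat F) (Tgt C f)"
proof -
  obtain g h where gh: "g \<in> Arr C" "Src C g = Src C (p (Src C f))" "Tgt C g = Src C (p (Tgt C f))"
    "p (Tgt C f) \<cdot>\<^bsub>C\<^esub> g = f \<cdot>\<^bsub>C\<^esub> p (Src C f)"
    "h \<in> Arr C" "Src C h = Src C (i (Src C f))" "Tgt C h = Src C (i (Tgt C f))"
    "i (Tgt C f) \<cdot>\<^bsub>C\<^esub> h = g \<cdot>\<^bsub>C\<^esub> i (Src C f)"
    using ex_resolution_lift[OF assms] .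
  show "fmap (Sat F) f \<in> Arr D" "Src D (fmap (Sat F) f) = fobj (Sat F) (Src C f)"
    "Tgt D (fmap (Sat F) f) = fobj (Sat F) (Tgt C f)"
    using sat_map[OF assms gh] by simp_all
qed

text \<open>Identities, composites and sums of lifts are lifts of identities, composites and sums,
  so each law is inherited from \<open>F\<close> by cancelling the kernel inclusion.\<close>

lemma sat_additive: "additive_functor C D (Sat F)"
  unfolding additive_functor_def
proof (intro conjI ballI allI)
  fix A
  assume A: "A \<in> Obj C"
  then show "fobj (Sat F) A \<in> Obj D"
    by simp
  have "ker A \<cdot>\<^bsub>D\<^esub> fmap (Sat F) (Ident C A) = fmap F (Ident C (Src C (i A))) \<cdot>\<^bsub>D\<^esub> ker A"
    using sat_map(4)[of "Ident C A" "Ident C (Src C (p A))" "Ident C (Src C (i A))"] A by simp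
  then show "fmap (Sat F) (Ident C A) = Ident D (fobj (Sat F) A)"
    by (rule_tac ker_cancel[OF A]) (use A in simp_all)
next
  fix A B f
  assume "f \<in> Hom C A B"
  then show "fmap (Sat F) f \<in> Hom D (fobj (Sat F) A) (fobj (Sat F) B)"
    by simp
next
  fix A B E f g
  assume "f \<in> Hom C A B" "g \<in> Hom C B E"
  then have fg [simp]: "f \<in> Arr C" "Src C f = A" "Tgt C f = B" "g \<in> Arr C" "Src C g = B" "Tgt C g = E"
    by simp_all
  have [simp]: "A \<in> Obj C" "B \<in> Obj C" "E \<in> Obj C"
    using C.src_tgt_obj[of f] C.src_tgt_obj[of g] by simp_all
  obtain f1 f2 where *: "f1 \<in> Arr C" "Src C f1 = Src C (p A)" "Tgt C f1 = Src C (p B)"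
    "p B \<cdot>\<^bsub>C\<^esub> f1 = f \<cdot>\<^bsub>C\<^esub> p A" "f2 \<in> Arr C" "Src C f2 = Src C (i A)"
    "Tgt C f2 = Src C (i B)" "i B \<cdot>\<^bsub>C\<^esub> f2 = f1 \<cdot>\<^bsub>C\<^esub> i A"
    using ex_resolution_lift[of f] by auto
  obtain g1 g2 where **: "g1 \<in> Arr C" "Src C g1 = Src C (p B)" "Tgt C g1 = Src C (p E)"
    "p E \<cdot>\<^bsub>C\<^esub> g1 = g \<cdot>\<^bsub>C\<^esub> p B" "g2 \<in> Arr C" "Src C g2 = Src C (i B)"
    "Tgt C g2 = Src C (i E)" "i E \<cdot>\<^bsub>C\<^esub> g2 = g1 \<cdot>\<^bsub>C\<^esub> i B"
    using ex_resolution_lift[of g] by auto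
  note 1 = sat_map(4)[of f f1 f2] sat_map(4)[of g g1 g2]
    sat_map(4)[of "g \<cdot>\<^bsub>C\<^esub> f" "g1 \<cdot>\<^bsub>C\<^esub> f1" "g2 \<cdot>\<^bsub>C\<^esub> f2"]
  have 2: "ker E \<cdot>\<^bsub>D\<^esub> fmap (Sat F) (g \<cdot>\<^bsub>C\<^esub> f) = fmap F g2 \<cdot>\<^bsub>D\<^esub> (fmap F f2 \<cdot>\<^bsub>D\<^esub> ker A)"
    using 1(3) * ** C.reassoc[OF *(4)] C.reassoc[OF *(8)] C.reassoc[OF **(4)] C.reassoc[OF **(8)] by simp
  have 3: "ker B \<cdot>\<^bsub>D\<^esub> fmap (Sat F) f = fmap F f2 \<cdot>\<^bsub>D\<^esub> ker A"
    using 1(1) * by simp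
  have 4: "ker E \<cdot>\<^bsub>D\<^esub> fmap (Sat F) g = fmap F g2 \<cdot>\<^bsub>D\<^esub> ker B"
    using 1(2) ** by simp
  have "ker E \<cdot>\<^bsub>D\<^esub> (fmap (Sat F) g \<cdot>\<^bsub>D\<^esub> fmap (Sat F) f) = fmap F g2 \<cdot>\<^bsub>D\<^esub> (ker B \<cdot>\<^bsub>D\<^esub> fmap (Sat F) f)"
    using D.reassoc[OF 4, of "fmap (Sat F) f"] ** by simp
  then show "fmap (Sat F) (g \<cdot>\<^bsub>C\<^esub> f) = fmap (Sat F) g \<cdot>\<^bsub>D\<^esub> fmap (Sat F) f"
    by (rule_tac ker_cancel[of E]) (simp_all add: 2 3)
next
  fix A B f g
  assume "f \<in> Hom C A B" "g \<in> Hom C A B"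
  then have fg [simp]: "f \<in> Arr C" "Src C f = A" "Tgt C f = B" "g \<in> Arr C" "Src C g = A" "Tgt C g = B"
    by simp_all
  have [simp]: "A \<in> Obj C" "B \<in> Obj C"
    using C.src_tgt_obj[of f] by simp_all
  obtain f1 f2 where *: "f1 \<in> Arr C" "Src C f1 = Src C (p A)" "Tgt C f1 = Src C (p B)"
    "p B \<cdot>\<^bsub>C\<^esub> f1 = f \<cdot>\<^bsub>C\<^esub> p A" "f2 \<in> Arr C" "Src C f2 = Src C (i A)"
    "Tgt C f2 = Src C (i B)" "i B \<cdot>\<^bsub>C\<^esub> f2 = f1 \<cdot>\<^bsub>C\<^esub> i A"
    using ex_resolution_lift[of f] by auto
  obtain g1 g2 where **: "g1 \<in> Arr C" "Src C g1 = Src C (p A)" "Tgt C g1 = Src C (p B)"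
    "p B \<cdot>\<^bsub>C\<^esub> g1 = g \<cdot>\<^bsub>C\<^esub> p A" "g2 \<in> Arr C" "Src C g2 = Src C (i A)"
    "Tgt C g2 = Src C (i B)" "i B \<cdot>\<^bsub>C\<^esub> g2 = g1 \<cdot>\<^bsub>C\<^esub> i A"
    using ex_resolution_lift[of g] by auto
  note 1 = sat_map(4)[of f f1 f2] sat_map(4)[of g g1 g2]
    sat_map(4)[of "Plus C f g" "Plus C f1 g1" "Plus C f2 g2"]
  have 2: "ker B \<cdot>\<^bsub>D\<^esub> fmap (Sat F) (Plus C f g) = Plus D (fmap F f2 \<cdot>\<^bsub>D\<^esub> ker A) (fmap F g2 \<cdot>\<^bsub>D\<^esub> ker A)"
    using 1(3) * ** by simp
  have "ker B \<cdot>\<^bsub>D\<^esub> fmap (Sat F) f = fmap F f2 \<cdot>\<^bsub>D\<^esub> ker A"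
    "ker B \<cdot>\<^bsub>D\<^esub> fmap (Sat F) g = fmap F g2 \<cdot>\<^bsub>D\<^esub> ker A"
    using 1(1,2) * ** by simp_all
  then show "fmap (Sat F) (Plus C f g) = Plus D (fmap (Sat F) f) (fmap (Sat F) g)"
    by (rule_tac ker_cancel[of B]) (simp_all add: 2)
qed

text \<open>The epi \<open>p P\<close> has a section \<open>s\<close>. The identity and
  \<open>s \<cdot> p P\<close> agree after \<open>p P\<close>, but on the syzygy they induce the
  identity and zero. By \<open>lift_unique\<close> these have the same effect on the kernel, so the
  kernel inclusion is zero.\<close>

lemma sat_projective:
  assumes "projective C P"
  shows "zero_object D (fobj (Sat F) P)"
proof -
  have P [simp]: "P \<in> Obj C"
    using assms by (simp add: projective_def)
  obtain s where s [simp]: "s \<in> Arr C" "Src C s = P" "Tgt C s = Src C (p P)" and ps: "p P \<cdot>\<^bsub>C\<^esub> s = Ident C P"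
    using C.projective_lift[OF assms C.short_exactD(4)[OF resolution(1)], of P "Ident C P"] by auto
  have "fmap F (Ident C (Src C (i P))) \<cdot>\<^bsub>D\<^esub> ker P
    = fmap F (ZeroMor C (Src C (i P)) (Src C (i P))) \<cdot>\<^bsub>D\<^esub> ker P"
    by (rule lift_unique[of "p P" "i P" "i P" "Ident C (Src C (p P))" "s \<cdot>\<^bsub>C\<^esub> p P"])
      (use C.reassoc[OF ps, of "p P"] in \<open>simp_all add: C.short_exactD[OF resolution(1)]\<close>)
  then have "ker P = ZeroMor D (fobj (Sat F) P) (fobj F (Src C (i P)))"
    by simp
  then have "Ident D (fobj (Sat F) P) = ZeroMor D (fobj (Sat F) P) (fobj (Sat F) P)"
    by (rule_tac ker_cancel[of P]) simp_all
  then show ?thesis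
    by (simp add: D.zero_object_iff)
qed

abbreviation "conn \<equiv> satellite_conn C D i p \<kappa> F"

lemma conn_eq:
  assumes \<iota>\<pi>: "short_exact C \<iota> \<pi>"
    and g: "g \<in> Arr C" "Src C g = Src C (p (Tgt C \<pi>))" "Tgt C g = Src C \<pi>" "\<pi> \<cdot>\<^bsub>C\<^esub> g = p (Tgt C \<pi>)"
    and h: "h \<in> Arr C" "Src C h = Src C (i (Tgt C \<pi>))" "Tgt C h = Src C \<iota>"
    "\<iota> \<cdot>\<^bsub>C\<^esub> h = g \<cdot>\<^bsub>C\<^esub> i (Tgt C \<pi>)"
  shows "conn \<iota> \<pi> = fmap F h \<cdot>\<^bsub>D\<^esub> ker (Tgt C \<pi>)"
proof -
  note [simp] = g(1-3) h(1-3) C.short_exact_simps(1-3)[OF \<iota>\<pi>]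
  let ?M = "Tgt C \<pi>"
  let ?P = "\<lambda>d. \<exists>h h'. h \<in> Hom C (Src C (p ?M)) (Src C \<pi>) \<and> \<pi> \<cdot>\<^bsub>C\<^esub> h = p ?M \<and>
        h' \<in> Hom C (Src C (i ?M)) (Src C \<iota>) \<and> \<iota> \<cdot>\<^bsub>C\<^esub> h' = h \<cdot>\<^bsub>C\<^esub> i ?M \<and>
        d = fmap F h' \<cdot>\<^bsub>D\<^esub> ker ?M"
  have "The ?P = fmap F h \<cdot>\<^bsub>D\<^esub> ker ?M"
  proof (rule the_equality)
    show "?P (fmap F h \<cdot>\<^bsub>D\<^esub> ker ?M)"
      by (intro conjI exI[of _ g] exI[of _ h]) (use g(4) h(4) in simp_all)
    fix d
    assume "?P d"
    then obtain g' h' where *: "g' \<in> Arr C" "Src C g' = Src C (p ?M)" "Tgt C g' = Src C \<pi>"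
      "\<pi> \<cdot>\<^bsub>C\<^esub> g' = p ?M"
      "h' \<in> Arr C" "Src C h' = Src C (i ?M)" "Tgt C h' = Src C \<iota>" "\<iota> \<cdot>\<^bsub>C\<^esub> h' = g' \<cdot>\<^bsub>C\<^esub> i ?M"
      and d: "d = fmap F h' \<cdot>\<^bsub>D\<^esub> ker ?M"
      by auto
    show "d = fmap F h \<cdot>\<^bsub>D\<^esub> ker ?M"
      unfolding d
      by (rule lift_unique[of \<pi> \<iota> "i ?M" g' g])
        (use * g h C.short_exactD[OF \<iota>\<pi>] in simp_all)
  qed
  then show ?thesis
    by (simp only: satellite_conn_def Let_def)
qed

lemma conn_arr [simp]:
  assumes "short_exact C \<iota> \<pi>"
  shows "conn \<iota> \<pi> \<in> Arr D" "Src D (conn \<iota> \<pi>) = fobj (Sat F) (Tgt C \<pi>)"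
    "Tgt D (conn \<iota> \<pi>) = fobj F (Src C \<iota>)"
proof -
  obtain g h where gh: "g \<in> Arr C" "Src C g = Src C (p (Tgt C \<pi>))" "Tgt C g = Src C \<pi>"
    "\<pi> \<cdot>\<^bsub>C\<^esub> g = p (Tgt C \<pi>)"
    "h \<in> Arr C" "Src C h = Src C (i (Tgt C \<pi>))" "Tgt C h = Src C \<iota>"
    "\<iota> \<cdot>\<^bsub>C\<^esub> h = g \<cdot>\<^bsub>C\<^esub> i (Tgt C \<pi>)"
    using ex_conn_lift[OF assms] .
  then show "conn \<iota> \<pi> \<in> Arr D" "Src D (conn \<iota> \<pi>) = fobj (Sat F) (Tgt C \<pi>)"
    "Tgt D (conn \<iota> \<pi>) = fobj F (Src C \<iota>)"
    using conn_eq[OF assms gh] C.short_exact_simps[OF assms] by simp_all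
qed

text \<open>Both sides are \<open>F\<close> of a map from the syzygy of \<open>Tgt C \<pi>\<close>
  to \<open>Src C \<iota>'\<close>, restricted to the kernel. These maps come from
  \<open>g' \<cdot> c1\<close> and \<open>b \<cdot> g\<close>, which both lift
  \<open>c \<cdot> p\<close>, so \<open>lift_unique\<close> identifies them.\<close>

lemma conn_natural:
  assumes \<iota>\<pi>: "short_exact C \<iota> \<pi>" "short_exact C \<iota>' \<pi>'"
    and a: "a \<in> Arr C" "Src C a = Src C \<iota>" "Tgt C a = Src C \<iota>'"
    and b: "b \<in> Arr C" "Src C b = Tgt C \<iota>" "Tgt C b = Tgt C \<iota>'"
    and c: "c \<in> Arr C" "Src C c = Tgt C \<pi>" "Tgt C c = Tgt C \<pi>'"
    and eq: "b \<cdot>\<^bsub>C\<^esub> \<iota> = \<iota>' \<cdot>\<^bsub>C\<^esub> a" "c \<cdot>\<^bsub>C\<^esub> \<pi> = \<pi>' \<cdot>\<^bsub>C\<^esub> b"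
  shows "conn \<iota>' \<pi>' \<cdot>\<^bsub>D\<^esub> fmap (Sat F) c = fmap F a \<cdot>\<^bsub>D\<^esub> conn \<iota> \<pi>"
proof -
  let ?M = "Tgt C \<pi>" and ?N = "Tgt C \<pi>'"
  note [simp] = C.short_exact_simps(1-3)[OF \<iota>\<pi>(1)] C.short_exact_simps(1-3)[OF \<iota>\<pi>(2)] a b c
  obtain g h where gh: "g \<in> Arr C" "Src C g = Src C (p ?M)" "Tgt C g = Src C \<pi>"
    "\<pi> \<cdot>\<^bsub>C\<^esub> g = p ?M"
    "h \<in> Arr C" "Src C h = Src C (i ?M)" "Tgt C h = Src C \<iota>" "\<iota> \<cdot>\<^bsub>C\<^esub> h = g \<cdot>\<^bsub>C\<^esub> i ?M"
    using ex_conn_lift[OF \<iota>\<pi>(1)] .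
  obtain g' h' where gh': "g' \<in> Arr C" "Src C g' = Src C (p ?N)" "Tgt C g' = Src C \<pi>'"
    "\<pi>' \<cdot>\<^bsub>C\<^esub> g' = p ?N"
    "h' \<in> Arr C" "Src C h' = Src C (i ?N)" "Tgt C h' = Src C \<iota>'" "\<iota>' \<cdot>\<^bsub>C\<^esub> h' = g' \<cdot>\<^bsub>C\<^esub> i ?N"
    using ex_conn_lift[OF \<iota>\<pi>(2)] .
  obtain c1 c2 where cc: "c1 \<in> Arr C" "Src C c1 = Src C (p ?M)" "Tgt C c1 = Src C (p ?N)"
    "p ?N \<cdot>\<^bsub>C\<^esub> c1 = c \<cdot>\<^bsub>C\<^esub> p ?M" "c2 \<in> Arr C" "Src C c2 = Src C (i ?M)"
    "Tgt C c2 = Src C (i ?N)" "i ?N \<cdot>\<^bsub>C\<^esub> c2 = c1 \<cdot>\<^bsub>C\<^esub> i ?M"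
    using ex_resolution_lift[of c] by auto
  note [simp] = gh(1-3,5-7) gh'(1-3,5-7) cc(1-3,5-7)
  have *: "ker ?N \<cdot>\<^bsub>D\<^esub> fmap (Sat F) c = fmap F c2 \<cdot>\<^bsub>D\<^esub> ker ?M"
    using sat_map(4)[of c c1 c2] cc by simp
  have "conn \<iota>' \<pi>' \<cdot>\<^bsub>D\<^esub> fmap (Sat F) c = fmap F (h' \<cdot>\<^bsub>C\<^esub> c2) \<cdot>\<^bsub>D\<^esub> ker ?M"
    using conn_eq[OF \<iota>\<pi>(2) gh'] * by simp
  also have "\<dots> = fmap F (a \<cdot>\<^bsub>C\<^esub> h) \<cdot>\<^bsub>D\<^esub> ker ?M"
  proof (rule lift_unique[of \<pi>' \<iota>' "i ?M" "g' \<cdot>\<^bsub>C\<^esub> c1" "b \<cdot>\<^bsub>C\<^esub> g"])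
    show "\<iota>' \<cdot>\<^bsub>C\<^esub> (h' \<cdot>\<^bsub>C\<^esub> c2) = (g' \<cdot>\<^bsub>C\<^esub> c1) \<cdot>\<^bsub>C\<^esub> i ?M"
      using C.reassoc[OF gh'(8), of c2] cc(8) by simp
    show "\<iota>' \<cdot>\<^bsub>C\<^esub> (a \<cdot>\<^bsub>C\<^esub> h) = (b \<cdot>\<^bsub>C\<^esub> g) \<cdot>\<^bsub>C\<^esub> i ?M"
      using C.reassoc[OF eq(1)[symmetric], of h] gh(8) by simp
    show "\<pi>' \<cdot>\<^bsub>C\<^esub> (g' \<cdot>\<^bsub>C\<^esub> c1) = \<pi>' \<cdot>\<^bsub>C\<^esub> (b \<cdot>\<^bsub>C\<^esub> g)"
      using C.reassoc[OF gh'(4), of c1] C.reassoc[OF eq(2)[symmetric], of g] cc(4) gh(4) by simp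
  qed (simp_all add: C.short_exactD[OF \<iota>\<pi>(2)])
  also have "\<dots> = fmap F a \<cdot>\<^bsub>D\<^esub> conn \<iota> \<pi>"
    using conn_eq[OF \<iota>\<pi>(1) gh] by simp
  finally show ?thesis .
qed

end

section \<open>The exact sequence of satellites of a half-exact functor\<close>

locale half_exact_ftor = satellite_ftor C D i p \<kappa> F
  for C :: "('o, 'm) ab_cat" and D :: "('p, 'q) ab_cat" and i p \<kappa> F +
  assumes half_exact: "short_exact C \<iota> \<pi> \<Longrightarrow> exact_pair D (fmap F \<iota>) (fmap F \<pi>)"
begin

text \<open>Half-exactness on the mapping cone sequence: the element (x, 0) dies in F(B), hence
  comes epi-locally from some \<open>y\<close>, and its two components read \<open>F h y = x\<close>
  and \<open>F j y = 0\<close>. It is applied to the given sequence and to the syzygy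
  sequence.\<close>

lemma connecting_lift:
  assumes jr: "short_exact C j r" and \<iota>\<pi>: "short_exact C \<iota> \<pi>" and CC: "Tgt C r = Tgt C \<pi>"
    and g: "g \<in> Arr C" "Src C g = Src C r" "Tgt C g = Src C \<pi>" "\<pi> \<cdot>\<^bsub>C\<^esub> g = r"
    and h: "h \<in> Arr C" "Src C h = Src C j" "Tgt C h = Src C \<iota>" "\<iota> \<cdot>\<^bsub>C\<^esub> h = g \<cdot>\<^bsub>C\<^esub> j"
    and x: "x \<in> Arr D" "Tgt D x = fobj F (Src C \<iota>)"
      "fmap F \<iota> \<cdot>\<^bsub>D\<^esub> x = ZeroMor D (Src D x) (fobj F (Tgt C \<iota>))"
  obtains e y where "epi_mor D e" "e \<in> Arr D" "Tgt D e = Src D x" "y \<in> Arr D" "Src D y = Src D e"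
    "Tgt D y = fobj F (Src C j)" "fmap F j \<cdot>\<^bsub>D\<^esub> y = ZeroMor D (Src D e) (fobj F (Tgt C j))"
    "fmap F h \<cdot>\<^bsub>D\<^esub> y = x \<cdot>\<^bsub>D\<^esub> e"
proof -
  note [simp] = C.short_exact_simps(1-3)[OF jr] C.short_exact_simps(1-3)[OF \<iota>\<pi>] g(1-3) h(1-3) x CC
  obtain k s a p' q' where ks: "short_exact C k s" and S: "p' \<in> Arr C" "q' \<in> Arr C" "a \<in> Arr C"
    "Src C a = Src C \<iota>" "Tgt C a = Src C s" "Src C p' = Src C s" "Src C q' = Src C s"
    "Tgt C p' = Src C \<iota>" "Tgt C q' = Src C r" "Src C k = Src C j" "Tgt C s = Src C \<pi>"
    and E: "p' \<cdot>\<^bsub>C\<^esub> k = h" "q' \<cdot>\<^bsub>C\<^esub> k = j" "s \<cdot>\<^bsub>C\<^esub> a = \<iota>" "p' \<cdot>\<^bsub>C\<^esub> a = Ident C (Src C \<iota>)"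
    "q' \<cdot>\<^bsub>C\<^esub> a = ZeroMor C (Src C \<iota>) (Src C r)"
    by (rule C.short_exact_mapping_cone[OF jr \<iota>\<pi> CC g h])
  note [simp] = S C.short_exact_simps(1-3)[OF ks]
  have "fmap F s \<cdot>\<^bsub>D\<^esub> (fmap F a \<cdot>\<^bsub>D\<^esub> x) = ZeroMor D (Src D x) (fobj F (Tgt C s))"
    using fmap_reassoc[OF E(3), of x] by simp
  then obtain e y where e: "epi_mor D e" "e \<in> Arr D" and y [simp]: "Tgt D e = Src D x" "y \<in> Arr D"
    "Src D y = Src D e" "Tgt D y = fobj F (Src C j)"
    and eq: "fmap F k \<cdot>\<^bsub>D\<^esub> y = (fmap F a \<cdot>\<^bsub>D\<^esub> x) \<cdot>\<^bsub>D\<^esub> e"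
    using D.exact_pair_lift[OF half_exact[OF ks], of "fmap F a \<cdot>\<^bsub>D\<^esub> x"] by auto
  note [simp] = e(2)
  have "fmap F h \<cdot>\<^bsub>D\<^esub> y = fmap F p' \<cdot>\<^bsub>D\<^esub> (fmap F k \<cdot>\<^bsub>D\<^esub> y)"
    using fmap_reassoc[OF E(1), of y] by simp
  also have "\<dots> = x \<cdot>\<^bsub>D\<^esub> e"
    unfolding eq using fmap_reassoc[OF E(4), of "x \<cdot>\<^bsub>D\<^esub> e"] by simp
  finally have hy: "fmap F h \<cdot>\<^bsub>D\<^esub> y = x \<cdot>\<^bsub>D\<^esub> e" .
  have "fmap F j \<cdot>\<^bsub>D\<^esub> y = fmap F q' \<cdot>\<^bsub>D\<^esub> (fmap F k \<cdot>\<^bsub>D\<^esub> y)"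
    using fmap_reassoc[OF E(2), of y] by simp
  also have "\<dots> = ZeroMor D (Src D e) (fobj F (Tgt C j))"
    unfolding eq using fmap_reassoc[OF E(5), of "x \<cdot>\<^bsub>D\<^esub> e"] by simp
  finally show ?thesis
    using that[OF e y(1-4) _ hy] by simp
qed

text \<open>\<open>connecting_lift\<close> yields elements of F(K) killed by F(i); these are the
  elements of S^-1 F(C), and on them the connecting map is \<open>F h\<close>.\<close>

lemma exact_conn_fmap:
  assumes \<iota>\<pi>: "short_exact C \<iota> \<pi>"
  shows "exact_pair D (conn \<iota> \<pi>) (fmap F \<iota>)"
proof -
  let ?M = "Tgt C \<pi>"
  note [simp] = C.short_exact_simps(1-3)[OF \<iota>\<pi>] conn_arr[OF \<iota>\<pi>]
  obtain g h where gh: "g \<in> Arr C" "Src C g = Src C (p ?M)" "Tgt C g = Src C \<pi>" "\<pi> \<cdot>\<^bsub>C\<^esub> g = p ?M"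
    "h \<in> Arr C" "Src C h = Src C (i ?M)" "Tgt C h = Src C \<iota>" "\<iota> \<cdot>\<^bsub>C\<^esub> h = g \<cdot>\<^bsub>C\<^esub> i ?M"
    using ex_conn_lift[OF \<iota>\<pi>] .
  note [simp] = gh(1-3,5-7)
  note conn = conn_eq[OF \<iota>\<pi> gh]
  show ?thesis
  proof (rule D.exact_pairI)
    show "fmap F \<iota> \<cdot>\<^bsub>D\<^esub> conn \<iota> \<pi> = ZeroMor D (Src D (conn \<iota> \<pi>)) (Tgt D (fmap F \<iota>))"
      using fmap_reassoc[OF gh(8), of "ker ?M"] conn_arr(2)[OF \<iota>\<pi>] unfolding conn by simp
    fix x
    assume x: "x \<in> Arr D" "Tgt D x = Src D (fmap F \<iota>)"
      "fmap F \<iota> \<cdot>\<^bsub>D\<^esub> x = ZeroMor D (Src D x) (Tgt D (fmap F \<iota>))"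
    obtain e y where e: "epi_mor D e" "e \<in> Arr D" "Tgt D e = Src D x" and y: "y \<in> Arr D"
      "Src D y = Src D e" "Tgt D y = fobj F (Src C (i ?M))"
      "fmap F (i ?M) \<cdot>\<^bsub>D\<^esub> y = ZeroMor D (Src D e) (fobj F (Tgt C (i ?M)))"
      "fmap F h \<cdot>\<^bsub>D\<^esub> y = x \<cdot>\<^bsub>D\<^esub> e"
      by (rule connecting_lift[of "i ?M" "p ?M" \<iota> \<pi> g h x]) (use \<iota>\<pi> resolution(1) gh x in simp_all)
    obtain u where u: "u \<in> Arr D" "Src D u = Src D y" "Tgt D u = fobj (Sat F) ?M" "ker ?M \<cdot>\<^bsub>D\<^esub> u = y"
      using ker_factor[of ?M y] y by auto
    have "conn \<iota> \<pi> \<cdot>\<^bsub>D\<^esub> u = x \<cdot>\<^bsub>D\<^esub> e"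
      unfolding conn using u y by simp
    then show "\<exists>e y. epi_mor D e \<and> Tgt D e = Src D x \<and> y \<in> Arr D \<and> Src D y = Src D e \<and>
      Tgt D y = Src D (conn \<iota> \<pi>) \<and> conn \<iota> \<pi> \<cdot>\<^bsub>D\<^esub> y = x \<cdot>\<^bsub>D\<^esub> e"
      using e u y by (intro exI[of _ e] exI[of _ u]) simp
  qed simp_all
qed

text \<open>Both positions are read off from E = ker(P_B -> C), a syzygy of C computed with the
  resolution of B, and from the sequence 0 -> K_B -> E -> A -> 0 with maps \<open>w\<close> and
  \<open>q\<close>. Exactness at S^-1 F(C) is half-exactness on that sequence; exactness at S^-1
  F(B) is \<open>connecting_lift\<close> for it. The map \<open>ub\<close> compares the chosen
  syzygy of C with E.\<close>

lemma exact_sat_conn_and_sat_half_exact: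
  assumes \<iota>\<pi>: "short_exact C \<iota> \<pi>"
  shows "exact_pair D (fmap (Sat F) \<pi>) (conn \<iota> \<pi>)"
    and "exact_pair D (fmap (Sat F) \<iota>) (fmap (Sat F) \<pi>)"
proof -
  let ?A = "Src C \<iota>" and ?B = "Src C \<pi>" and ?C = "Tgt C \<pi>"
  note [simp] = C.short_exact_simps(1-3)[OF \<iota>\<pi>] conn_arr[OF \<iota>\<pi>]
  interpret S: additive_ftor C D "Sat F"
    by unfold_locales (rule sat_additive)
  obtain j w q where jE: "short_exact C j (\<pi> \<cdot>\<^bsub>C\<^esub> p ?B)" and wq: "short_exact C w q"
    and S: "Src C w = Src C (i ?B)" "Tgt C w = Src C j" "Tgt C q = ?A"
    and jw: "j \<cdot>\<^bsub>C\<^esub> w = i ?B" and \<iota>q: "\<iota> \<cdot>\<^bsub>C\<^esub> q = p ?B \<cdot>\<^bsub>C\<^esub> j"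
    by (rule C.short_exact_syzygy[OF resolution(1) \<iota>\<pi>, of ?B]) simp_all
  have jS: "j \<in> Arr C" "Tgt C j = Src C (p ?B)" "w \<in> Arr C" "q \<in> Arr C" "Src C q = Src C j"
    and pj: "\<pi> \<cdot>\<^bsub>C\<^esub> (p ?B \<cdot>\<^bsub>C\<^esub> j) = ZeroMor C (Src C j) ?C"
    using C.short_exact_simps[OF jE] C.short_exact_simps[OF wq] S(2) by simp_all
  note [simp] = S jS
  obtain u ub where uS: "u \<in> Arr C" "Src C u = Src C (p ?C)" "Tgt C u = Src C (p ?B)"
    "ub \<in> Arr C" "Src C ub = Src C (i ?C)" "Tgt C ub = Src C j"
    and pu: "\<pi> \<cdot>\<^bsub>C\<^esub> (p ?B \<cdot>\<^bsub>C\<^esub> u) = p ?C" and jub: "j \<cdot>\<^bsub>C\<^esub> ub = u \<cdot>\<^bsub>C\<^esub> i ?C"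
    by (rule C.ex_lift[of "i ?C" "p ?C" j "\<pi> \<cdot>\<^bsub>C\<^esub> p ?B" "Ident C ?C"]) (use jE in \<open>simp_all add: resolution\<close>)
  note [simp] = uS
  obtain g h where ghS: "g \<in> Arr C" "Src C g = Src C (p ?B)" "Tgt C g = Src C (p ?C)"
    "h \<in> Arr C" "Src C h = Src C (i ?B)" "Tgt C h = Src C (i ?C)"
    and pg: "p ?C \<cdot>\<^bsub>C\<^esub> g = \<pi> \<cdot>\<^bsub>C\<^esub> p ?B" and ih: "i ?C \<cdot>\<^bsub>C\<^esub> h = g \<cdot>\<^bsub>C\<^esub> i ?B"
    by (rule ex_resolution_lift[of \<pi>]) (simp, rule that)
  note [simp] = ghS
  have sat_\<pi>: "ker ?C \<cdot>\<^bsub>D\<^esub> fmap (Sat F) \<pi> = fmap F h \<cdot>\<^bsub>D\<^esub> ker ?B"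
    using sat_map(4)[of \<pi> g h] pg ih by simp
  have "\<iota> \<cdot>\<^bsub>C\<^esub> (q \<cdot>\<^bsub>C\<^esub> ub) = p ?B \<cdot>\<^bsub>C\<^esub> (u \<cdot>\<^bsub>C\<^esub> i ?C)"
    using C.reassoc[OF \<iota>q, of ub] jub by simp
  \<comment> \<open>\<open>p \<cdot> u\<close> lifts the identity of C to B and induces
    \<open>q \<cdot> ub\<close> on syzygies, so it may serve to compute the connecting map.\<close>
  then have conn: "conn \<iota> \<pi> = fmap F (q \<cdot>\<^bsub>C\<^esub> ub) \<cdot>\<^bsub>D\<^esub> ker ?C"
    by (rule_tac conn_eq[OF \<iota>\<pi>, of "p ?B \<cdot>\<^bsub>C\<^esub> u"]) (use pu in simp_all)
  have quh: "\<iota> \<cdot>\<^bsub>C\<^esub> (q \<cdot>\<^bsub>C\<^esub> (ub \<cdot>\<^bsub>C\<^esub> h)) = p ?B \<cdot>\<^bsub>C\<^esub> (u \<cdot>\<^bsub>C\<^esub> (g \<cdot>\<^bsub>C\<^esub> i ?B))"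
    using C.reassoc[OF \<iota>q, of "ub \<cdot>\<^bsub>C\<^esub> h"] C.reassoc[OF jub, of h] ih by simp
  have pug: "\<pi> \<cdot>\<^bsub>C\<^esub> (p ?B \<cdot>\<^bsub>C\<^esub> (u \<cdot>\<^bsub>C\<^esub> g)) = \<pi> \<cdot>\<^bsub>C\<^esub> p ?B"
  proof -
    have "\<pi> \<cdot>\<^bsub>C\<^esub> (p ?B \<cdot>\<^bsub>C\<^esub> (u \<cdot>\<^bsub>C\<^esub> g)) = (\<pi> \<cdot>\<^bsub>C\<^esub> (p ?B \<cdot>\<^bsub>C\<^esub> u)) \<cdot>\<^bsub>C\<^esub> g"
      by simp
    then show ?thesis
      using pu pg by simp
  qed
  show "exact_pair D (fmap (Sat F) \<pi>) (conn \<iota> \<pi>)"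
  proof (rule D.exact_pairI)
    \<comment> \<open>The maps \<open>p \<cdot> u \<cdot> g\<close> and \<open>p\<close> from P_B to
      B agree after \<open>\<pi>\<close>; the second induces zero on the syzygy, because
      \<open>p \<cdot> i = 0\<close>.\<close>
    have "fmap F (q \<cdot>\<^bsub>C\<^esub> (ub \<cdot>\<^bsub>C\<^esub> h)) \<cdot>\<^bsub>D\<^esub> ker ?B = fmap F (ZeroMor C (Src C (i ?B)) ?A) \<cdot>\<^bsub>D\<^esub> ker ?B"
      by (rule lift_unique[of \<pi> \<iota> "i ?B" "p ?B \<cdot>\<^bsub>C\<^esub> (u \<cdot>\<^bsub>C\<^esub> g)" "p ?B"])
        (use quh pug C.short_exactD(1)[OF \<iota>\<pi>] in simp_all)
    then show "conn \<iota> \<pi> \<cdot>\<^bsub>D\<^esub> fmap (Sat F) \<pi> = ZeroMor D (Src D (fmap (Sat F) \<pi>)) (Tgt D (conn \<iota> \<pi>))"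
      using conn_arr(3)[OF \<iota>\<pi>] sat_\<pi> unfolding conn by simp
    fix x
    assume x: "x \<in> Arr D" "Tgt D x = Src D (conn \<iota> \<pi>)"
      "conn \<iota> \<pi> \<cdot>\<^bsub>D\<^esub> x = ZeroMor D (Src D x) (Tgt D (conn \<iota> \<pi>))"
    note [simp] = x(1,2)
    define z where "z = ker ?C \<cdot>\<^bsub>D\<^esub> x"
    have zS [simp]: "z \<in> Arr D" "Src D z = Src D x" "Tgt D z = fobj F (Src C (i ?C))"
      and iz: "fmap F (i ?C) \<cdot>\<^bsub>D\<^esub> z = ZeroMor D (Src D x) (fobj F (Src C (p ?C)))"
      using ker_zero[of ?C x] by (simp_all add: z_def)
    have "fmap F q \<cdot>\<^bsub>D\<^esub> (fmap F ub \<cdot>\<^bsub>D\<^esub> z) = ZeroMor D (Src D x) (fobj F ?A)"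
      using x(3) conn_arr(3)[OF \<iota>\<pi>] unfolding z_def conn by simp
    \<comment> \<open>The image of \<open>z\<close> in F(E) dies in F(A), so half-exactness on the
      syzygy sequence lifts it to F(K_B); the lift is then seen to lie in S^-1 F(B).\<close>
    then obtain e y where e: "epi_mor D e" and yS [simp]: "e \<in> Arr D" "Tgt D e = Src D x" "y \<in> Arr D"
      "Src D y = Src D e" "Tgt D y = fobj F (Src C (i ?B))"
      and wy: "fmap F w \<cdot>\<^bsub>D\<^esub> y = (fmap F ub \<cdot>\<^bsub>D\<^esub> z) \<cdot>\<^bsub>D\<^esub> e"
      using D.exact_pair_lift[OF half_exact[OF wq], of "fmap F ub \<cdot>\<^bsub>D\<^esub> z"] by auto
    have "fmap F (i ?B) \<cdot>\<^bsub>D\<^esub> y = fmap F j \<cdot>\<^bsub>D\<^esub> (fmap F w \<cdot>\<^bsub>D\<^esub> y)"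
      using fmap_reassoc[OF jw, of y] by simp
    also have "\<dots> = fmap F u \<cdot>\<^bsub>D\<^esub> ((fmap F (i ?C) \<cdot>\<^bsub>D\<^esub> z) \<cdot>\<^bsub>D\<^esub> e)"
      unfolding wy using fmap_reassoc[OF jub, of "z \<cdot>\<^bsub>D\<^esub> e"] by simp
    also have "\<dots> = ZeroMor D (Src D e) (fobj F (Src C (p ?B)))"
      unfolding iz by simp
    finally obtain y' where y'S [simp]: "y' \<in> Arr D" "Src D y' = Src D e" "Tgt D y' = fobj (Sat F) ?B"
      and ky': "ker ?B \<cdot>\<^bsub>D\<^esub> y' = y"
      using ker_factor[of ?B y] by auto
    have "p ?C \<cdot>\<^bsub>C\<^esub> (g \<cdot>\<^bsub>C\<^esub> j) = ZeroMor C (Src C j) ?C"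
      using C.reassoc[OF pg, of j] pj by simp
    \<comment> \<open>\<open>t\<close> compares in the direction opposite to \<open>ub\<close>. Both
      \<open>t \<cdot> ub\<close> and the identity lift the identity of C, so they agree on
      \<open>z\<close>; and \<open>t \<cdot> w = h\<close> turns the lift just found into a preimage
      of \<open>x\<close>.\<close>
    then obtain t where tS [simp]: "t \<in> Arr C" "Src C t = Src C j" "Tgt C t = Src C (i ?C)"
      and it: "i ?C \<cdot>\<^bsub>C\<^esub> t = g \<cdot>\<^bsub>C\<^esub> j"
      using C.is_kernel_factor[OF C.short_exactD(1)[OF resolution(1)], of ?C "g \<cdot>\<^bsub>C\<^esub> j"] by auto
    have "i ?C \<cdot>\<^bsub>C\<^esub> (t \<cdot>\<^bsub>C\<^esub> w) = i ?C \<cdot>\<^bsub>C\<^esub> h"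
      using C.reassoc[OF it, of w] jw ih by simp
    then have tw: "t \<cdot>\<^bsub>C\<^esub> w = h"
      by (rule_tac C.mono_morD[OF C.short_exactD(3)[OF resolution(1)[of ?C]]]) simp_all
    have pgu: "p ?C \<cdot>\<^bsub>C\<^esub> (g \<cdot>\<^bsub>C\<^esub> u) = p ?C"
      using C.reassoc[OF pg, of u] pu by simp
    have "fmap F (t \<cdot>\<^bsub>C\<^esub> ub) \<cdot>\<^bsub>D\<^esub> z = fmap F (Ident C (Src C (i ?C))) \<cdot>\<^bsub>D\<^esub> z"
      by (rule lift_unique[of "p ?C" "i ?C" "i ?C" "g \<cdot>\<^bsub>C\<^esub> u" "Ident C (Src C (p ?C))"])
        (use C.short_exactD(1)[OF resolution(1)] pgu C.reassoc[OF it, of ub] jub iz in simp_all)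
    then have tubz: "fmap F t \<cdot>\<^bsub>D\<^esub> (fmap F ub \<cdot>\<^bsub>D\<^esub> z) = z"
      by simp
    have "ker ?C \<cdot>\<^bsub>D\<^esub> (fmap (Sat F) \<pi> \<cdot>\<^bsub>D\<^esub> y') = fmap F h \<cdot>\<^bsub>D\<^esub> y"
      using D.reassoc[OF sat_\<pi>, of y'] ky' by simp
    also have "\<dots> = fmap F t \<cdot>\<^bsub>D\<^esub> (fmap F w \<cdot>\<^bsub>D\<^esub> y)"
      using fmap_reassoc[OF tw, of y] by simp
    also have "\<dots> = (fmap F t \<cdot>\<^bsub>D\<^esub> (fmap F ub \<cdot>\<^bsub>D\<^esub> z)) \<cdot>\<^bsub>D\<^esub> e"
      unfolding wy by simp
    also have "\<dots> = ker ?C \<cdot>\<^bsub>D\<^esub> (x \<cdot>\<^bsub>D\<^esub> e)"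
      unfolding tubz unfolding z_def by simp
    finally have "fmap (Sat F) \<pi> \<cdot>\<^bsub>D\<^esub> y' = x \<cdot>\<^bsub>D\<^esub> e"
      by (rule_tac ker_cancel[of ?C]) simp_all
    then show "\<exists>e y. epi_mor D e \<and> Tgt D e = Src D x \<and> y \<in> Arr D \<and> Src D y = Src D e \<and>
      Tgt D y = Src D (fmap (Sat F) \<pi>) \<and> fmap (Sat F) \<pi> \<cdot>\<^bsub>D\<^esub> y = x \<cdot>\<^bsub>D\<^esub> e"
      using e by (intro exI[of _ e] exI[of _ y']) simp
  qed simp_all
  show "exact_pair D (fmap (Sat F) \<iota>) (fmap (Sat F) \<pi>)"
  proof (rule D.exact_pairI)
    show "fmap (Sat F) \<pi> \<cdot>\<^bsub>D\<^esub> fmap (Sat F) \<iota> = ZeroMor D (Src D (fmap (Sat F) \<iota>)) (Tgt D (fmap (Sat F) \<pi>))"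
      using S.fmap_comp[of \<iota> \<pi>] C.short_exact_simps(4)[OF \<iota>\<pi>] by simp
    fix x
    assume x: "x \<in> Arr D" "Tgt D x = Src D (fmap (Sat F) \<pi>)"
      "fmap (Sat F) \<pi> \<cdot>\<^bsub>D\<^esub> x = ZeroMor D (Src D x) (Tgt D (fmap (Sat F) \<pi>))"
    note [simp] = x(1,2)
    define z where "z = ker ?B \<cdot>\<^bsub>D\<^esub> x"
    have zS [simp]: "z \<in> Arr D" "Src D z = Src D x" "Tgt D z = fobj F (Src C (i ?B))"
      and iz: "fmap F (i ?B) \<cdot>\<^bsub>D\<^esub> z = ZeroMor D (Src D x) (fobj F (Src C (p ?B)))"
      using ker_zero[of ?B x] by (simp_all add: z_def)
    have hz: "fmap F h \<cdot>\<^bsub>D\<^esub> z = ZeroMor D (Src D x) (fobj F (Src C (i ?C)))"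
      using D.reassoc[OF sat_\<pi>, of x] x(3) by (simp add: z_def)
    \<comment> \<open>The inclusion \<open>w\<close> of syzygies and the detour
      \<open>ub \<cdot> h\<close> are induced by maps that agree after
      \<open>\<pi> \<cdot> p\<close>. Hence \<open>F w\<close> kills \<open>z\<close> because
      \<open>F h\<close> does, and \<open>connecting_lift\<close> applies along \<open>w\<close> and
      \<open>q\<close>.\<close>
    have "fmap F (ub \<cdot>\<^bsub>C\<^esub> h) \<cdot>\<^bsub>D\<^esub> z = fmap F w \<cdot>\<^bsub>D\<^esub> z"
      by (rule lift_unique[of "\<pi> \<cdot>\<^bsub>C\<^esub> p ?B" j "i ?B" "u \<cdot>\<^bsub>C\<^esub> g" "Ident C (Src C (p ?B))"])
        (use C.short_exactD(1)[OF jE] C.reassoc[OF jub, of h] ih jw iz pug in simp_all)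
    then have wz: "fmap F w \<cdot>\<^bsub>D\<^esub> z = ZeroMor D (Src D x) (fobj F (Src C j))"
      using hz by simp
    obtain g' h' where gh'S: "g' \<in> Arr C" "Src C g' = Src C (p ?A)" "Tgt C g' = Src C q"
      "q \<cdot>\<^bsub>C\<^esub> g' = p ?A" "h' \<in> Arr C" "Src C h' = Src C (i ?A)" "Tgt C h' = Src C w"
      "w \<cdot>\<^bsub>C\<^esub> h' = g' \<cdot>\<^bsub>C\<^esub> i ?A"
      using ex_conn_lift[OF wq] by auto
    note [simp] = gh'S(1-3,5-7)
    obtain e y where e: "epi_mor D e" and yS [simp]: "e \<in> Arr D" "Tgt D e = Src D z" "y \<in> Arr D"
      "Src D y = Src D e" "Tgt D y = fobj F (Src C (i ?A))"
      and iy: "fmap F (i ?A) \<cdot>\<^bsub>D\<^esub> y = ZeroMor D (Src D e) (fobj F (Tgt C (i ?A)))"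
      and hy: "fmap F h' \<cdot>\<^bsub>D\<^esub> y = z \<cdot>\<^bsub>D\<^esub> e"
      by (rule connecting_lift[of "i ?A" "p ?A" w q g' h' z]) (use wq resolution(1) gh'S wz in simp_all)
    obtain y' where y'S [simp]: "y' \<in> Arr D" "Src D y' = Src D e" "Tgt D y' = fobj (Sat F) ?A"
      and ky': "ker ?A \<cdot>\<^bsub>D\<^esub> y' = y"
      using ker_factor[of ?A y] iy by auto
    \<comment> \<open>\<open>j \<cdot> g'\<close> lifts \<open>\<iota>\<close> to the projectives
      and induces the same \<open>h'\<close>, so the lift obtained above computes the satellite on
      \<open>\<iota>\<close>.\<close>
    have sat_\<iota>: "ker ?B \<cdot>\<^bsub>D\<^esub> fmap (Sat F) \<iota> = fmap F h' \<cdot>\<^bsub>D\<^esub> ker ?A"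
    proof -
      have "p ?B \<cdot>\<^bsub>C\<^esub> (j \<cdot>\<^bsub>C\<^esub> g') = \<iota> \<cdot>\<^bsub>C\<^esub> p ?A"
        using C.reassoc[OF \<iota>q, of g'] gh'S(4) by simp
      moreover have "i ?B \<cdot>\<^bsub>C\<^esub> h' = j \<cdot>\<^bsub>C\<^esub> (g' \<cdot>\<^bsub>C\<^esub> i ?A)"
        using C.reassoc[OF jw, of h'] gh'S(8) by simp
      ultimately show ?thesis
        using sat_map(4)[of \<iota> "j \<cdot>\<^bsub>C\<^esub> g'" h'] by simp
    qed
    have "ker ?B \<cdot>\<^bsub>D\<^esub> (fmap (Sat F) \<iota> \<cdot>\<^bsub>D\<^esub> y') = ker ?B \<cdot>\<^bsub>D\<^esub> (x \<cdot>\<^bsub>D\<^esub> e)"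
      using D.reassoc[OF sat_\<iota>, of y'] ky' hy by (simp add: z_def)
    then have "fmap (Sat F) \<iota> \<cdot>\<^bsub>D\<^esub> y' = x \<cdot>\<^bsub>D\<^esub> e"
      by (rule_tac ker_cancel[of ?B]) simp_all
    then show "\<exists>e y. epi_mor D e \<and> Tgt D e = Src D x \<and> y \<in> Arr D \<and> Src D y = Src D e \<and>
      Tgt D y = Src D (fmap (Sat F) \<iota>) \<and> fmap (Sat F) \<iota> \<cdot>\<^bsub>D\<^esub> y = x \<cdot>\<^bsub>D\<^esub> e"
      using e by (intro exI[of _ e] exI[of _ y']) simp
  qed simp_all
qed

text \<open>Half-exactness reproduces itself, which allows satellites to be iterated.\<close>

lemma sat_half_exact_ftor: "half_exact_ftor C D i p \<kappa> (Sat F)"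
  by unfold_locales (auto simp: sat_additive exact_sat_conn_and_sat_half_exact)

end

section \<open>Cohomological functors vanishing on projectives\<close>

context abelian_category
begin

text \<open>What \<open>g\<close> kills lifts, after an epi, through a zero object, and is therefore
  zero.\<close>

lemma exact_pair_zero_mono:
  assumes ex: "exact_pair C f g" and Z: "zero_object C (Src C f)"
  shows "mono_mor C g"
proof (rule mono_morI)
  note [simp] = exact_pairD[OF ex]
  fix v
  assume v: "v \<in> Arr C" "Tgt C v = Src C g" "g \<cdot> v = ZeroMor C (Src C v) (Tgt C g)"
  obtain e y where e: "epi_mor C e" "e \<in> Arr C" "Tgt C e = Src C v" and y: "y \<in> Arr C" "Src C y = Src C e"
    "Tgt C y = Src C f" "f \<cdot> y = v \<cdot> e"
    using exact_pair_lift[OF ex v] .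
  have "y = ZeroMor C (Src C e) (Src C f)"
    using zero_object_arr(2)[OF Z y(1,3)] y(2) by simp
  then have "v \<cdot> e = ZeroMor C (Src C e) (Tgt C v)"
    using y(2,4) e v by simp
  then show "v = ZeroMor C (Src C v) (Src C g)"
    using epi_mor_zero[OF e(1), of v] e v by simp
qed (use exact_pairD[OF ex] in simp)

lemma exact_pair_mono_kernel:
  assumes "exact_pair C f g" "mono_mor C f"
  shows "is_kernel C g f"
  using assms mono_is_kernel is_kernel_transfer unfolding exact_pair_def by blast

end

locale cohom_ftor = two_abelian C D
  for C :: "('o, 'm) ab_cat" and D :: "('p, 'q) ab_cat" +
  fixes T :: "('o, 'm, 'p, 'q) cohom"
  assumes cohomological: "cohomological_functor C D T"

sublocale cohom_ftor \<subseteq> Deg: additive_ftor C D "Deg T n" for n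
  using cohomological by unfold_locales (simp add: cohomological_functor_def)

context cohom_ftor
begin

lemma Conn_arr:
  assumes "short_exact C \<iota> \<pi>"
  shows "Conn T n \<iota> \<pi> \<in> Arr D" "Src D (Conn T n \<iota> \<pi>) = fobj (Deg T n) (Tgt C \<pi>)"
    "Tgt D (Conn T n \<iota> \<pi>) = fobj (Deg T (n + 1)) (Src C \<iota>)"
proof -
  have "Conn T n \<iota> \<pi> \<in> Hom D (fobj (Deg T n) (Tgt C \<pi>)) (fobj (Deg T (n + 1)) (Src C \<iota>))"
    using assms cohomological unfolding cohomological_functor_def by blast
  then show "Conn T n \<iota> \<pi> \<in> Arr D" "Src D (Conn T n \<iota> \<pi>) = fobj (Deg T n) (Tgt C \<pi>)"
    "Tgt D (Conn T n \<iota> \<pi>) = fobj (Deg T (n + 1)) (Src C \<iota>)"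
    by simp_all
qed

lemma Conn_exact:
  assumes "short_exact C \<iota> \<pi>"
  shows "exact_pair D (fmap (Deg T n) \<iota>) (fmap (Deg T n) \<pi>)"
    "exact_pair D (fmap (Deg T n) \<pi>) (Conn T n \<iota> \<pi>)"
    "exact_pair D (Conn T n \<iota> \<pi>) (fmap (Deg T (n + 1)) \<iota>)"
  using assms cohomological unfolding cohomological_functor_def by blast+

lemma Conn_natural:
  assumes "short_exact C \<iota> \<pi>" "short_exact C \<iota>' \<pi>'"
    and "a \<in> Arr C" "Src C a = Src C \<iota>" "Tgt C a = Src C \<iota>'"
    and "b \<in> Arr C" "Src C b = Tgt C \<iota>" "Tgt C b = Tgt C \<iota>'"
    and "c \<in> Arr C" "Src C c = Tgt C \<pi>" "Tgt C c = Tgt C \<pi>'"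
    and "b \<cdot>\<^bsub>C\<^esub> \<iota> = \<iota>' \<cdot>\<^bsub>C\<^esub> a" "c \<cdot>\<^bsub>C\<^esub> \<pi> = \<pi>' \<cdot>\<^bsub>C\<^esub> b"
  shows "Conn T n \<iota>' \<pi>' \<cdot>\<^bsub>D\<^esub> fmap (Deg T n) c = fmap (Deg T (n + 1)) a \<cdot>\<^bsub>D\<^esub> Conn T n \<iota> \<pi>"
proof -
  have "a \<in> Hom C (Src C \<iota>) (Src C \<iota>')" "b \<in> Hom C (Tgt C \<iota>) (Tgt C \<iota>')"
    "c \<in> Hom C (Tgt C \<pi>) (Tgt C \<pi>')"
    using assms by simp_all
  then show ?thesis
    using assms(1,2,12,13) cohomological unfolding cohomological_functor_def by blast
qed

end

text \<open>The square in degree \<open>k\<close> mentions degrees \<open>k\<close> and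
  \<open>k + 1\<close> only, so the conditions make sense from degree \<open>n\<close> on. Values
  below \<open>n\<close> stay free, which lets an extension by one degree be a function
  update.\<close>

definition cohom_morphism_from ::
  "('o, 'm) ab_cat \<Rightarrow> ('p, 'q) ab_cat \<Rightarrow> int \<Rightarrow> ('o, 'm, 'p, 'q) cohom \<Rightarrow> ('o, 'm, 'p, 'q) cohom
    \<Rightarrow> (int \<Rightarrow> 'o \<Rightarrow> 'q) \<Rightarrow> bool" where
  "cohom_morphism_from C D n T U \<nu> \<longleftrightarrow>
     (\<forall>k\<ge>n. natural_transformation C D (Deg T k) (Deg U k) (\<nu> k)) \<and>
     (\<forall>k\<ge>n. \<forall>\<iota> \<pi>. short_exact C \<iota> \<pi> \<longrightarrow>
        \<nu> (k + 1) (Src C \<iota>) \<cdot>\<^bsub>D\<^esub> Conn T k \<iota> \<pi> = Conn U k \<iota> \<pi> \<cdot>\<^bsub>D\<^esub> \<nu> k (Tgt C \<pi>))"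

lemma cohom_morphism_iff_from: "cohom_morphism C D T U \<nu> \<longleftrightarrow> (\<forall>n. cohom_morphism_from C D n T U \<nu>)"
  unfolding cohom_morphism_def cohom_morphism_from_def by blast

lemma cohom_morphism_from_cong:
  assumes "\<And>k. k \<ge> n \<Longrightarrow> \<nu> k = \<nu>' k" "cohom_morphism_from C D n T U \<nu>"
  shows "cohom_morphism_from C D n T U \<nu>'"
  using assms unfolding cohom_morphism_from_def by simp

lemma natural_transformationD:
  assumes "natural_transformation C D F G \<eta>"
  shows "M \<in> Obj C \<Longrightarrow> \<eta> M \<in> Arr D" "M \<in> Obj C \<Longrightarrow> Src D (\<eta> M) = fobj F M"
    "M \<in> Obj C \<Longrightarrow> Tgt D (\<eta> M) = fobj G M"
    "f \<in> Arr C \<Longrightarrow> fmap G f \<cdot>\<^bsub>D\<^esub> \<eta> (Src C f) = \<eta> (Tgt C f) \<cdot>\<^bsub>D\<^esub> fmap F f"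
  using assms unfolding natural_transformation_def by simp_all

lemma cohom_morphism_fromD:
  assumes "cohom_morphism_from C D n T U \<nu>" "k \<ge> n"
  shows "M \<in> Obj C \<Longrightarrow> \<nu> k M \<in> Arr D" "M \<in> Obj C \<Longrightarrow> Src D (\<nu> k M) = fobj (Deg T k) M"
    "M \<in> Obj C \<Longrightarrow> Tgt D (\<nu> k M) = fobj (Deg U k) M"
    "f \<in> Arr C \<Longrightarrow> fmap (Deg U k) f \<cdot>\<^bsub>D\<^esub> \<nu> k (Src C f) = \<nu> k (Tgt C f) \<cdot>\<^bsub>D\<^esub> fmap (Deg T k) f"
    "short_exact C \<iota> \<pi> \<Longrightarrow> \<nu> (k + 1) (Src C \<iota>) \<cdot>\<^bsub>D\<^esub> Conn T k \<iota> \<pi> = Conn U k \<iota> \<pi> \<cdot>\<^bsub>D\<^esub> \<nu> k (Tgt C \<pi>)"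
  using assms natural_transformationD[of C D "Deg T k" "Deg U k" "\<nu> k"]
  unfolding cohom_morphism_from_def by blast+

lemma cohom_morphismD:
  assumes "cohom_morphism C D T U \<nu>"
  shows "M \<in> Obj C \<Longrightarrow> \<nu> k M \<in> Arr D" "M \<in> Obj C \<Longrightarrow> Src D (\<nu> k M) = fobj (Deg T k) M"
    "M \<in> Obj C \<Longrightarrow> Tgt D (\<nu> k M) = fobj (Deg U k) M"
    "f \<in> Arr C \<Longrightarrow> fmap (Deg U k) f \<cdot>\<^bsub>D\<^esub> \<nu> k (Src C f) = \<nu> k (Tgt C f) \<cdot>\<^bsub>D\<^esub> fmap (Deg T k) f"
    "short_exact C \<iota> \<pi> \<Longrightarrow> \<nu> (k + 1) (Src C \<iota>) \<cdot>\<^bsub>D\<^esub> Conn T k \<iota> \<pi> = Conn U k \<iota> \<pi> \<cdot>\<^bsub>D\<^esub> \<nu> k (Tgt C \<pi>)"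
  using assms cohom_morphism_fromD[of C D k T U \<nu> k] unfolding cohom_morphism_iff_from by blast+

lemma cohom_morphismI:
  assumes "\<And>k M. M \<in> Obj C \<Longrightarrow> \<nu> k M \<in> Arr D \<and> Src D (\<nu> k M) = fobj (Deg T k) M \<and>
      Tgt D (\<nu> k M) = fobj (Deg U k) M"
    and "\<And>k f. f \<in> Arr C \<Longrightarrow>
      fmap (Deg U k) f \<cdot>\<^bsub>D\<^esub> \<nu> k (Src C f) = \<nu> k (Tgt C f) \<cdot>\<^bsub>D\<^esub> fmap (Deg T k) f"
    and "\<And>k \<iota> \<pi>. short_exact C \<iota> \<pi> \<Longrightarrow>
      \<nu> (k + 1) (Src C \<iota>) \<cdot>\<^bsub>D\<^esub> Conn T k \<iota> \<pi> = Conn U k \<iota> \<pi> \<cdot>\<^bsub>D\<^esub> \<nu> k (Tgt C \<pi>)"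
  shows "cohom_morphism C D T U \<nu>"
  unfolding cohom_morphism_def natural_transformation_def using assms by auto

lemma (in two_abelian) cohom_morphism_comp:
  assumes T: "cohom_ftor C D T" and U: "cohom_ftor C D U" and V: "cohom_ftor C D V"
    and \<mu>: "cohom_morphism C D T U \<mu>" and \<nu>: "cohom_morphism C D U V \<nu>"
  shows "cohom_morphism C D T V (\<lambda>k M. \<nu> k M \<cdot>\<^bsub>D\<^esub> \<mu> k M)"
proof -
  interpret T: cohom_ftor C D T by fact
  interpret U: cohom_ftor C D U by fact
  interpret V: cohom_ftor C D V by fact
  note [simp] = cohom_morphismD(1-3)[OF \<mu>] cohom_morphismD(1-3)[OF \<nu>]
    T.Conn_arr U.Conn_arr V.Conn_arr
  show ?thesis
  proof (rule cohom_morphismI)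
    fix k f
    assume [simp]: "f \<in> Arr C"
    show "fmap (Deg V k) f \<cdot>\<^bsub>D\<^esub> (\<nu> k (Src C f) \<cdot>\<^bsub>D\<^esub> \<mu> k (Src C f)) =
      (\<nu> k (Tgt C f) \<cdot>\<^bsub>D\<^esub> \<mu> k (Tgt C f)) \<cdot>\<^bsub>D\<^esub> fmap (Deg T k) f"
      using D.reassoc[OF cohom_morphismD(4)[OF \<nu>, of f k], of "\<mu> k (Src C f)"]
        cohom_morphismD(4)[OF \<mu>, of f k] by simp
  next
    fix k \<iota> \<pi>
    assume se [simp]: "short_exact C \<iota> \<pi>"
    note [simp] = C.short_exact_simps(1-3)[OF se]
    show "(\<nu> (k + 1) (Src C \<iota>) \<cdot>\<^bsub>D\<^esub> \<mu> (k + 1) (Src C \<iota>)) \<cdot>\<^bsub>D\<^esub> Conn T k \<iota> \<pi> =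
      Conn V k \<iota> \<pi> \<cdot>\<^bsub>D\<^esub> (\<nu> k (Tgt C \<pi>) \<cdot>\<^bsub>D\<^esub> \<mu> k (Tgt C \<pi>))"
      using D.reassoc[OF cohom_morphismD(5)[OF \<nu> se, of k, symmetric], of "\<mu> k (Tgt C \<pi>)"]
        cohom_morphismD(5)[OF \<mu> se, of k] by simp
  qed simp
qed

lemma (in cohom_ftor) cohom_morphism_ident: "cohom_morphism C D T T (\<lambda>k M. Ident D (fobj (Deg T k) M))"
proof (rule cohom_morphismI)
  fix k \<iota> \<pi>
  assume se: "short_exact C \<iota> \<pi>"
  then show "Ident D (fobj (Deg T (k + 1)) (Src C \<iota>)) \<cdot>\<^bsub>D\<^esub> Conn T k \<iota> \<pi> =
    Conn T k \<iota> \<pi> \<cdot>\<^bsub>D\<^esub> Ident D (fobj (Deg T k) (Tgt C \<pi>))"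
    using Conn_arr[OF se, of k] by simp
qed simp_all

section \<open>Extending morphisms to lower degrees\<close>

locale cohom_extension = satellite_data C D i p \<kappa> + T: cohom_ftor C D T + U: cohom_ftor C D U
  for C :: "('o, 'm) ab_cat" and D :: "('p, 'q) ab_cat" and i p \<kappa> T U +
  fixes n :: int
  assumes vanish: "k < n \<Longrightarrow> projective C P \<Longrightarrow> zero_object D (fobj (Deg U k) P)"
begin

text \<open>Vanishing at the projective makes the connecting map mono, and exactness at the syzygy
  turns this mono into a kernel.\<close>

lemma Conn_kernel:
  assumes "k < n" "M \<in> Obj C"
  shows "is_kernel D (fmap (Deg U (k + 1)) (i M)) (Conn U k (i M) (p M))"
proof -
  note ex = U.Conn_exact[OF resolution(1)[OF assms(2)], of k]
  have "mono_mor D (Conn U k (i M) (p M))"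
    using D.exact_pair_zero_mono[OF ex(2)] vanish[OF assms(1) resolution(2)] assms(2) by simp
  then show ?thesis
    using D.exact_pair_mono_kernel[OF ex(3)] by blast
qed

text \<open>The new component at \<open>M\<close> is induced on these kernels by degree
  \<open>k + 1\<close>. Naturality is tested after the mono connecting map; the square for an
  arbitrary short exact sequence is deduced from that of a resolution.\<close>

lemma extend_step:
  assumes k: "k < n" and \<eta>: "cohom_morphism_from C D (k + 1) T U \<eta>"
  shows "\<exists>\<theta>. cohom_morphism_from C D k T U (\<eta>(k := \<theta>))"
proof -
  note \<eta>D = cohom_morphism_fromD[OF \<eta>]
  let ?dT = "\<lambda>M. Conn T k (i M) (p M)" and ?dU = "\<lambda>M. Conn U k (i M) (p M)"
  note [simp] = \<eta>D(1-3) T.Conn_arr U.Conn_arr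
  have resS [simp]: "short_exact C (i M) (p M)" if "M \<in> Obj C" for M
    using that by (simp add: resolution)
  have "\<exists>\<theta>. \<theta> \<in> Hom D (fobj (Deg T k) M) (fobj (Deg U k) M) \<and>
    ?dU M \<cdot>\<^bsub>D\<^esub> \<theta> = \<eta> (k + 1) (Src C (i M)) \<cdot>\<^bsub>D\<^esub> ?dT M" if [simp]: "M \<in> Obj C" for M
  proof -
    let ?h = "\<eta> (k + 1) (Src C (i M)) \<cdot>\<^bsub>D\<^esub> ?dT M"
    have "fmap (Deg U (k + 1)) (i M) \<cdot>\<^bsub>D\<^esub> ?h =
        \<eta> (k + 1) (Tgt C (i M)) \<cdot>\<^bsub>D\<^esub> (fmap (Deg T (k + 1)) (i M) \<cdot>\<^bsub>D\<^esub> ?dT M)"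
      using D.reassoc[OF \<eta>D(4)[of "k + 1" "i M"], of "?dT M"] by simp
    also have "\<dots> = ZeroMor D (fobj (Deg T k) M) (fobj (Deg U (k + 1)) (Tgt C (i M)))"
      using D.exact_pairD(4)[OF T.Conn_exact(3)[OF resS[of M]], of k] by simp
    finally show ?thesis
      using D.is_kernel_factor[OF Conn_kernel[OF k], of M ?h] by auto
  qed
  then obtain \<theta> where \<theta>: "\<And>M. M \<in> Obj C \<Longrightarrow> \<theta> M \<in> Hom D (fobj (Deg T k) M) (fobj (Deg U k) M) \<and>
    ?dU M \<cdot>\<^bsub>D\<^esub> \<theta> M = \<eta> (k + 1) (Src C (i M)) \<cdot>\<^bsub>D\<^esub> ?dT M"
    by metis
  then have \<theta>S [simp]: "M \<in> Obj C \<Longrightarrow> \<theta> M \<in> Arr D" "M \<in> Obj C \<Longrightarrow> Src D (\<theta> M) = fobj (Deg T k) M"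
    "M \<in> Obj C \<Longrightarrow> Tgt D (\<theta> M) = fobj (Deg U k) M"
    and d\<theta>: "M \<in> Obj C \<Longrightarrow> ?dU M \<cdot>\<^bsub>D\<^esub> \<theta> M = \<eta> (k + 1) (Src C (i M)) \<cdot>\<^bsub>D\<^esub> ?dT M" for M
    by simp_all
  have nat: "natural_transformation C D (Deg T k) (Deg U k) \<theta>"
    unfolding natural_transformation_def
  proof (intro conjI ballI allI)
    fix A B f
    assume "f \<in> Hom C A B"
    then have [simp]: "f \<in> Arr C" "Src C f = A" "Tgt C f = B"
      by simp_all
    have [simp]: "A \<in> Obj C" "B \<in> Obj C"
      using C.src_tgt_obj[of f] by simp_all
    obtain g h where gh: "g \<in> Arr C" "Src C g = Src C (p A)" "Tgt C g = Src C (p B)"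
      "p B \<cdot>\<^bsub>C\<^esub> g = f \<cdot>\<^bsub>C\<^esub> p A" "h \<in> Arr C" "Src C h = Src C (i A)" "Tgt C h = Src C (i B)"
      "i B \<cdot>\<^bsub>C\<^esub> h = g \<cdot>\<^bsub>C\<^esub> i A"
      using ex_resolution_lift[of f] by auto
    note [simp] = gh(1-3,5-7)
    have T: "?dT B \<cdot>\<^bsub>D\<^esub> fmap (Deg T k) f = fmap (Deg T (k + 1)) h \<cdot>\<^bsub>D\<^esub> ?dT A"
      by (rule T.Conn_natural[of _ _ _ _ h g f]) (use gh in simp_all)
    have U: "?dU B \<cdot>\<^bsub>D\<^esub> fmap (Deg U k) f = fmap (Deg U (k + 1)) h \<cdot>\<^bsub>D\<^esub> ?dU A"
      by (rule U.Conn_natural[of _ _ _ _ h g f]) (use gh in simp_all)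
    have "?dU B \<cdot>\<^bsub>D\<^esub> (fmap (Deg U k) f \<cdot>\<^bsub>D\<^esub> \<theta> A) = fmap (Deg U (k + 1)) h \<cdot>\<^bsub>D\<^esub> (?dU A \<cdot>\<^bsub>D\<^esub> \<theta> A)"
      using D.reassoc[OF U, of "\<theta> A"] by simp
    also have "\<dots> = \<eta> (k + 1) (Tgt C h) \<cdot>\<^bsub>D\<^esub> (fmap (Deg T (k + 1)) h \<cdot>\<^bsub>D\<^esub> ?dT A)"
      using D.reassoc[OF \<eta>D(4)[of "k + 1" h], of "?dT A"] d\<theta>[of A] by simp
    also have "\<dots> = ?dU B \<cdot>\<^bsub>D\<^esub> (\<theta> B \<cdot>\<^bsub>D\<^esub> fmap (Deg T k) f)"
      unfolding T[symmetric] using D.reassoc[OF d\<theta>[of B], of "fmap (Deg T k) f"] by simp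
    finally show "fmap (Deg U k) f \<cdot>\<^bsub>D\<^esub> \<theta> A = \<theta> B \<cdot>\<^bsub>D\<^esub> fmap (Deg T k) f"
      by (rule_tac D.mono_morD[OF D.is_kernel_mono[OF Conn_kernel[OF k, of B]]]) simp_all
  qed simp
  have conn: "\<eta> (k + 1) (Src C \<iota>) \<cdot>\<^bsub>D\<^esub> Conn T k \<iota> \<pi> = Conn U k \<iota> \<pi> \<cdot>\<^bsub>D\<^esub> \<theta> (Tgt C \<pi>)"
    if se [simp]: "short_exact C \<iota> \<pi>" for \<iota> \<pi>
  proof -
    let ?M = "Tgt C \<pi>"
    note [simp] = C.short_exact_simps(1-3)[OF se]
    obtain g h where gh: "g \<in> Arr C" "Src C g = Src C (p ?M)" "Tgt C g = Src C \<pi>" "\<pi> \<cdot>\<^bsub>C\<^esub> g = p ?M"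
      "h \<in> Arr C" "Src C h = Src C (i ?M)" "Tgt C h = Src C \<iota>" "\<iota> \<cdot>\<^bsub>C\<^esub> h = g \<cdot>\<^bsub>C\<^esub> i ?M"
      using ex_conn_lift[OF se] .
    note [simp] = gh(1-3,5-7)
    \<comment> \<open>The resolution of \<open>M\<close> maps to the given sequence over the
      identity of \<open>M\<close>, so naturality expresses the connecting map through that of the
      resolution; likewise for \<open>U\<close>.\<close>
    have "Conn T k \<iota> \<pi> \<cdot>\<^bsub>D\<^esub> fmap (Deg T k) (Ident C ?M) = fmap (Deg T (k + 1)) h \<cdot>\<^bsub>D\<^esub> ?dT ?M"
      by (rule T.Conn_natural[of _ _ _ _ h g]) (use gh in simp_all)
    then have T: "Conn T k \<iota> \<pi> = fmap (Deg T (k + 1)) h \<cdot>\<^bsub>D\<^esub> ?dT ?M"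
      by simp
    have "Conn U k \<iota> \<pi> \<cdot>\<^bsub>D\<^esub> fmap (Deg U k) (Ident C ?M) = fmap (Deg U (k + 1)) h \<cdot>\<^bsub>D\<^esub> ?dU ?M"
      by (rule U.Conn_natural[of _ _ _ _ h g]) (use gh in simp_all)
    then have U: "Conn U k \<iota> \<pi> = fmap (Deg U (k + 1)) h \<cdot>\<^bsub>D\<^esub> ?dU ?M"
      by simp
    show ?thesis
      unfolding T U
      using D.reassoc[OF \<eta>D(4)[of "k + 1" h], of "?dT ?M"] d\<theta>[of ?M] by simp
  qed
  have "cohom_morphism_from C D k T U (\<eta>(k := \<theta>))"
    unfolding cohom_morphism_from_def
  proof (intro conjI allI impI)
    fix l
    assume "k \<le> l"
    then show "natural_transformation C D (Deg T l) (Deg U l) ((\<eta>(k := \<theta>)) l)"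
      using nat \<eta> unfolding cohom_morphism_from_def by auto
  next
    fix l \<iota> \<pi>
    assume l: "k \<le> l" and se: "short_exact C \<iota> \<pi>"
    show "(\<eta>(k := \<theta>)) (l + 1) (Src C \<iota>) \<cdot>\<^bsub>D\<^esub> Conn T l \<iota> \<pi> =
      Conn U l \<iota> \<pi> \<cdot>\<^bsub>D\<^esub> (\<eta>(k := \<theta>)) l (Tgt C \<pi>)"
      using l se conn \<eta>D(5)[of l \<iota> \<pi>] by (cases "l = k") auto
  qed
  then show ?thesis
    by blast
qed

text \<open>The degrees descend without end, so the single steps are collected by dependent choice
  into a sequence of partial morphisms that stabilises in every degree. Applied with
  \<open>U = T\<langle>m\<rangle>\<close> this gives the transition maps, and with \<open>U\<close>
  vanishing in all degrees the factorisations.\<close>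

lemma cohom_morphism_extend:
  assumes \<eta>: "cohom_morphism_from C D n T U \<eta>"
  obtains \<nu> where "cohom_morphism C D T U \<nu>" "\<And>k. k \<ge> n \<Longrightarrow> \<nu> k = \<eta> k"
proof -
  let ?P = "\<lambda>d \<mu>. cohom_morphism_from C D (n - int d) T U \<mu> \<and> (\<forall>k\<ge>n. \<mu> k = \<eta> k)"
  \<comment> \<open>Stage \<open>d\<close> reaches down to degree \<open>n - d\<close>; the next
    stage changes degree \<open>n - d - 1\<close> only.\<close>
  have "\<exists>f. \<forall>d. ?P d (f d) \<and> (\<forall>k\<ge>n - int d. f (Suc d) k = f d k)"
  proof (rule dependent_nat_choice)
    show "\<exists>\<mu>. ?P 0 \<mu>"
      using \<eta> by auto
    fix \<mu> d
    assume \<mu>: "?P d \<mu>"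
    then obtain \<theta> where "cohom_morphism_from C D (n - int (Suc d)) T U (\<mu>(n - int (Suc d) := \<theta>))"
      using extend_step[of "n - int (Suc d)" \<mu>] by auto
    then show "\<exists>\<mu>'. ?P (Suc d) \<mu>' \<and> (\<forall>k\<ge>n - int d. \<mu>' k = \<mu> k)"
      using \<mu> by (intro exI[of _ "\<mu>(n - int (Suc d) := \<theta>)"]) auto
  qed
  then obtain f where f: "\<And>d. cohom_morphism_from C D (n - int d) T U (f d)"
    and f\<eta>: "\<And>d k. k \<ge> n \<Longrightarrow> f d k = \<eta> k"
    and step: "\<And>d k. k \<ge> n - int d \<Longrightarrow> f (Suc d) k = f d k"
    by blast
  \<comment> \<open>Degree \<open>k\<close> is read off at the first stage that reaches it, which is
    stage 0 for \<open>k \<ge> n\<close>.\<close>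
  define \<nu> where "\<nu> k = f (nat (n - k)) k" for k
  have f\<nu>: "f d k = \<nu> k" if "k \<ge> n - int d" for d k
  proof -
    have "nat (n - k) \<le> d"
      using that by linarith
    then show ?thesis
    proof (induction d rule: dec_induct)
      case (step d)
      then show ?case
        using \<open>\<And>d k. k \<ge> n - int d \<Longrightarrow> f (Suc d) k = f d k\<close>[of d k] by simp
    qed (simp add: \<nu>_def)
  qed
  have "cohom_morphism_from C D l T U \<nu>" for l
  proof -
    \<comment> \<open>The bound is the minimum of \<open>n\<close> and \<open>l\<close>, so this
      stage covers all degrees from \<open>l\<close> on.\<close>
    have "cohom_morphism_from C D (n - int (nat (n - l))) T U \<nu>"
      using f\<nu> f cohom_morphism_from_cong by blast
    then show ?thesis
      unfolding cohom_morphism_from_def by auto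
  qed
  then show ?thesis
    using that f\<eta> unfolding cohom_morphism_iff_from \<nu>_def by blast
qed

text \<open>Descending induction: below \<open>n\<close> the connecting map of \<open>U\<close> at a
  resolution is mono, and its composite with degree \<open>k\<close> of a morphism is determined by
  degree \<open>k + 1\<close>.\<close>

lemma cohom_morphism_unique:
  assumes \<mu>: "cohom_morphism C D T U \<mu>" and \<nu>: "cohom_morphism C D T U \<nu>"
    and eq: "\<And>k M. k \<ge> n \<Longrightarrow> M \<in> Obj C \<Longrightarrow> \<mu> k M = \<nu> k M"
    and M: "M \<in> Obj C"
  shows "\<mu> k M = \<nu> k M"
proof -
  note [simp] = cohom_morphismD(1-3)[OF \<mu>] cohom_morphismD(1-3)[OF \<nu>]
  have "\<forall>M\<in>Obj C. \<forall>k\<ge>n - int d. \<mu> k M = \<nu> k M" for d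
  proof (induction d)
    case (Suc d)
    show ?case
    proof (intro ballI allI impI)
      fix M k
      assume [simp]: "M \<in> Obj C" and k: "n - int (Suc d) \<le> k"
      show "\<mu> k M = \<nu> k M"
      proof (cases "k < n - int d")
        case True
        have se: "short_exact C (i M) (p M)"
          by (simp add: resolution)
        have "\<mu> (k + 1) (Src C (i M)) = \<nu> (k + 1) (Src C (i M))"
          using Suc k by simp
        then have "Conn U k (i M) (p M) \<cdot>\<^bsub>D\<^esub> \<mu> k M = Conn U k (i M) (p M) \<cdot>\<^bsub>D\<^esub> \<nu> k M"
          using cohom_morphismD(5)[OF \<mu> se, of k] cohom_morphismD(5)[OF \<nu> se, of k] by simp
        then show ?thesis
          using D.mono_morD[OF D.is_kernel_mono[OF Conn_kernel[of k M]], of "\<mu> k M" "\<nu> k M"]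
            True U.Conn_arr[OF se] by simp
      qed (use Suc in simp)
    qed
  qed (use eq in simp)
  from this[of "nat (n - k)"] show ?thesis
    using M by simp
qed

end

section \<open>The truncations \<open>T\<langle>m\<rangle>\<close>\<close>

locale satellite_cohom = satellite_data C D i p \<kappa> + cohom_ftor C D T
  for C :: "('o, 'm) ab_cat" and D :: "('p, 'q) ab_cat" and i p \<kappa> T
begin

abbreviation "Tr \<equiv> satellite_truncation C D i p \<kappa> T"

lemma trunc_high [simp]:
  "k \<ge> int m \<Longrightarrow> Deg (Tr m) k = Deg T k" "k \<ge> int m \<Longrightarrow> Conn (Tr m) k = Conn T k"
  by (simp_all add: satellite_truncation_def)

lemma iterated_sat_half_exact: "half_exact_ftor C D i p \<kappa> ((Sat ^^ d) (Deg T n))"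
proof (induction d)
  case 0
  show ?case
    by unfold_locales (simp_all add: Deg.additive Conn_exact)
next
  case (Suc d)
  then show ?case
    by (simp add: half_exact_ftor.sat_half_exact_ftor)
qed

text \<open>Below \<open>m\<close> any two adjacent degrees are S^-1 F and F with the satellite
  connecting map. Degree \<open>m - 1\<close> is included, with F the zeroth iterate
  \<open>T^m\<close>, so the seam between the two halves of the definition is covered.\<close>

lemma trunc_low:
  assumes "k < int m"
  obtains F where "half_exact_ftor C D i p \<kappa> F" "Deg (Tr m) k = Sat F" "Deg (Tr m) (k + 1) = F"
    "Conn (Tr m) k = satellite_conn C D i p \<kappa> F"
proof -
  have "nat (int m - k) = Suc (nat (int m - k - 1))"
    using assms by linarith
  then show ?thesis
    using that[OF iterated_sat_half_exact[of "nat (int m - k - 1)" "int m"]] assms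
    by (cases "k + 1 = int m") (auto simp: satellite_truncation_def algebra_simps)
qed

text \<open>Each condition concerns two adjacent degrees. From \<open>m\<close> on these belong to
  \<open>T\<close>; otherwise \<open>trunc_low\<close> presents them as satellite and functor for a
  half-exact functor.\<close>

lemma trunc_cohomological: "cohomological_functor C D (Tr m)"
proof -
  have "additive_functor C D (Deg (Tr m) k)" for k
  proof (cases "k < int m")
    case True
    then show ?thesis
      by (metis half_exact_ftor.axioms(1) satellite_ftor.sat_additive trunc_low)
  qed (simp add: Deg.additive)
  moreover have "Conn (Tr m) k \<iota> \<pi> \<in> Hom D (fobj (Deg (Tr m) k) (Tgt C \<pi>)) (fobj (Deg (Tr m) (k + 1)) (Src C \<iota>)) \<and>
        exact_pair D (fmap (Deg (Tr m) k) \<iota>) (fmap (Deg (Tr m) k) \<pi>) \<and>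
        exact_pair D (fmap (Deg (Tr m) k) \<pi>) (Conn (Tr m) k \<iota> \<pi>) \<and>
        exact_pair D (Conn (Tr m) k \<iota> \<pi>) (fmap (Deg (Tr m) (k + 1)) \<iota>)"
    if se: "short_exact C \<iota> \<pi>" for k \<iota> \<pi>
  proof (cases "k < int m")
    case True
    then obtain F where "half_exact_ftor C D i p \<kappa> F" and [simp]: "Deg (Tr m) k = Sat F"
      "Deg (Tr m) (k + 1) = F" "Conn (Tr m) k = satellite_conn C D i p \<kappa> F"
      by (rule trunc_low)
    then interpret F: half_exact_ftor C D i p \<kappa> F
      by simp
    show ?thesis
      using se F.conn_arr[OF se] F.exact_conn_fmap[OF se] F.exact_sat_conn_and_sat_half_exact[OF se] by simp
  qed (simp add: se Conn_arr Conn_exact)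
  moreover have "Conn (Tr m) k \<iota>' \<pi>' \<cdot>\<^bsub>D\<^esub> fmap (Deg (Tr m) k) c =
      fmap (Deg (Tr m) (k + 1)) a \<cdot>\<^bsub>D\<^esub> Conn (Tr m) k \<iota> \<pi>"
    if "short_exact C \<iota> \<pi> \<and> short_exact C \<iota>' \<pi>' \<and>
        a \<in> Hom C (Src C \<iota>) (Src C \<iota>') \<and> b \<in> Hom C (Tgt C \<iota>) (Tgt C \<iota>') \<and>
        c \<in> Hom C (Tgt C \<pi>) (Tgt C \<pi>') \<and>
        b \<cdot>\<^bsub>C\<^esub> \<iota> = \<iota>' \<cdot>\<^bsub>C\<^esub> a \<and> c \<cdot>\<^bsub>C\<^esub> \<pi> = \<pi>' \<cdot>\<^bsub>C\<^esub> b" for k \<iota> \<pi> \<iota>' \<pi>' a b c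
  proof (cases "k < int m")
    case True
    then obtain F where "half_exact_ftor C D i p \<kappa> F" and [simp]: "Deg (Tr m) k = Sat F"
      "Deg (Tr m) (k + 1) = F" "Conn (Tr m) k = satellite_conn C D i p \<kappa> F"
      by (rule trunc_low)
    then interpret F: half_exact_ftor C D i p \<kappa> F
      by simp
    show ?thesis
      using that F.conn_natural[of \<iota> \<pi> \<iota>' \<pi>' a b c] by simp
  next
    case False
    then show ?thesis
      using that Conn_natural[of \<iota> \<pi> \<iota>' \<pi>' a b c k] by simp
  qed
  ultimately show ?thesis
    unfolding cohomological_functor_def by blast
qed

lemma trunc_projective:
  assumes "k < int m" "projective C P"
  shows "zero_object D (fobj (Deg (Tr m) k) P)"
  using assms by (metis half_exact_ftor.axioms(1) satellite_ftor.sat_projective trunc_low)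

end

section \<open>Exact direct limits of sequences\<close>

lemma direct_system_reindex:
  assumes f: "inj f" and ds: "direct_system D I r X \<phi>"
  shows "direct_system D (f ` I) (map_prod f f ` r) (X \<circ> inv_into UNIV f) (\<lambda>a b. \<phi> (inv_into UNIV f a) (inv_into UNIV f b))"
proof -
  note [simp] = inv_f_f[OF f]
  have dir: "directed_set I r"
    using ds by (simp add: direct_system_def)
  have "preorder_on (f ` I) (map_prod f f ` r)"
    using dir f unfolding directed_set_def preorder_on_def refl_on_def trans_def
    by (auto simp: inj_eq)
  moreover have "\<exists>c\<in>f ` I. (a, c) \<in> map_prod f f ` r \<and> (b, c) \<in> map_prod f f ` r"
    if ab: "a \<in> f ` I" "b \<in> f ` I" for a b
  proof -
    obtain i j where "i \<in> I" "j \<in> I" and [simp]: "a = f i" "b = f j"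
      using ab by blast
    then obtain k where "k \<in> I" "(i, k) \<in> r" "(j, k) \<in> r"
      using dir unfolding directed_set_def by blast
    then show ?thesis
      by (intro bexI[of _ "f k"] conjI) (auto intro: rev_image_eqI)
  qed
  ultimately have "directed_set (f ` I) (map_prod f f ` r)"
    using dir unfolding directed_set_def by simp
  moreover have "\<phi> (inv_into UNIV f j) (inv_into UNIV f k) \<cdot>\<^bsub>D\<^esub> \<phi> (inv_into UNIV f i) (inv_into UNIV f j) = \<phi> (inv_into UNIV f i) (inv_into UNIV f k)"
    if "(i, j) \<in> map_prod f f ` r" "(j, k) \<in> map_prod f f ` r" for i j k
    using that f ds unfolding direct_system_def by (auto simp: inj_eq)
  ultimately show ?thesis
    using ds unfolding direct_system_def by (auto simp del: Hom_iff)
qed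

lemma cocone_reindex:
  assumes "inj f"
  shows "cocone D (f ` I) (map_prod f f ` r) (X \<circ> inv_into UNIV f) (\<lambda>a b. \<phi> (inv_into UNIV f a) (inv_into UNIV f b)) Y y \<longleftrightarrow>
    cocone D I r X \<phi> Y (y \<circ> f)"
proof -
  note [simp] = inv_f_f[OF assms]
  have "(\<forall>a b. (a, b) \<in> map_prod f f ` r \<longrightarrow> P a b) \<longleftrightarrow> (\<forall>i j. (i, j) \<in> r \<longrightarrow> P (f i) (f j))" for P
    by auto
  then show ?thesis
    unfolding cocone_def by (simp del: Hom_iff)
qed

text \<open>The universal property quantifies over cocones, and composition with \<open>f\<close>
  reaches every cocone of the original system, because \<open>f\<close> has a left inverse.\<close>

lemma is_direct_limit_reindex:
  assumes f: "inj f" and ds: "direct_system D I r X \<phi>"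
  shows "is_direct_limit D (f ` I) (map_prod f f ` r) (X \<circ> inv_into UNIV f) (\<lambda>a b. \<phi> (inv_into UNIV f a) (inv_into UNIV f b)) L l \<longleftrightarrow>
    is_direct_limit D I r X \<phi> L (l \<circ> f)"
proof -
  note [simp] = inv_f_f[OF f]
  have "(\<forall>Y y. cocone D I r X \<phi> Y (y \<circ> f) \<longrightarrow> (\<exists>!u. u \<in> Hom D L Y \<and> (\<forall>i\<in>I. u \<cdot>\<^bsub>D\<^esub> l (f i) = y (f i)))) \<longleftrightarrow>
    (\<forall>Y y. cocone D I r X \<phi> Y y \<longrightarrow> (\<exists>!u. u \<in> Hom D L Y \<and> (\<forall>i\<in>I. u \<cdot>\<^bsub>D\<^esub> l (f i) = y i)))"
    (is "?L \<longleftrightarrow> ?R")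
  proof
    assume L: ?L
    show ?R
    proof (intro allI impI)
      fix Y y
      assume "cocone D I r X \<phi> Y y"
      then have "cocone D I r X \<phi> Y ((y \<circ> inv_into UNIV f) \<circ> f)"
        by (simp add: comp_def)
      then show "\<exists>!u. u \<in> Hom D L Y \<and> (\<forall>i\<in>I. u \<cdot>\<^bsub>D\<^esub> l (f i) = y i)"
        using L[rule_format, of Y "y \<circ> inv_into UNIV f"] by simp
    qed
  next
    assume R: ?R
    show ?L
    proof (intro allI impI)
      fix Y y
      assume "cocone D I r X \<phi> Y (y \<circ> f)"
      then show "\<exists>!u. u \<in> Hom D L Y \<and> (\<forall>i\<in>I. u \<cdot>\<^bsub>D\<^esub> l (f i) = y (f i))"
        using R[rule_format, of Y "y \<circ> f"] by (simp del: Hom_iff)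
    qed
  qed
  then show ?thesis
    unfolding is_direct_limit_def cocone_reindex[OF f]
    using ds direct_system_reindex[OF f ds] by simp
qed

text \<open>The index type acts as a universe: limits over it give limits over every type that
  embeds into it, in particular over nat.\<close>

lemma has_direct_limits_inj:
  fixes f :: "'j \<Rightarrow> 'i"
  assumes f: "inj f" and "has_direct_limits TYPE('i) D"
  shows "has_direct_limits TYPE('j) D"
  unfolding has_direct_limits_def
proof (intro allI impI)
  fix I :: "'j set" and r X \<phi>
  assume ds: "direct_system D I r X \<phi>"
  obtain L l where "is_direct_limit D (f ` I) (map_prod f f ` r) (X \<circ> inv_into UNIV f) (\<lambda>a b. \<phi> (inv_into UNIV f a) (inv_into UNIV f b)) L l"
    using direct_system_reindex[OF f ds] assms(2) unfolding has_direct_limits_def by blast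
  then show "\<exists>L l. is_direct_limit D I r X \<phi> L l"
    using is_direct_limit_reindex[OF f ds] by blast
qed

lemma exact_direct_limitsD:
  fixes I :: "'i set"
  assumes "exact_direct_limits TYPE('i) D"
    and "direct_system_morphism D I r X \<phi> Y \<psi> \<alpha>" "direct_system_morphism D I r Y \<psi> Z \<chi> \<beta>"
    and "\<forall>i\<in>I. short_exact D (\<alpha> i) (\<beta> i)"
    and "is_direct_limit D I r X \<phi> L l" "is_direct_limit D I r Y \<psi> M m"
      "is_direct_limit D I r Z \<chi> N n"
    and "u \<in> Hom D L M" "\<forall>i\<in>I. u \<cdot>\<^bsub>D\<^esub> l i = m i \<cdot>\<^bsub>D\<^esub> \<alpha> i"
    and "v \<in> Hom D M N" "\<forall>i\<in>I. v \<cdot>\<^bsub>D\<^esub> m i = n i \<cdot>\<^bsub>D\<^esub> \<beta> i"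
  shows "short_exact D u v"
proof -
  note all = assms(1)[unfolded exact_direct_limits_def, rule_format]
  show ?thesis
    by (rule all[of I r X \<phi> Y \<psi> \<alpha> Z \<chi> \<beta> L l M m N n u v]) (intro conjI assms(2-))
qed

text \<open>Systems, their morphisms and their limits are relabelled by the inverse of
  \<open>f\<close>, while \<open>u\<close> and \<open>v\<close> stay the same.\<close>

lemma exact_direct_limits_inj:
  fixes f :: "'j \<Rightarrow> 'i"
  assumes f: "inj f" and ex: "exact_direct_limits TYPE('i) D"
  shows "exact_direct_limits TYPE('j) D"
  unfolding exact_direct_limits_def
proof (intro allI impI, elim conjE)
  fix I :: "'j set" and r X \<phi> Y \<psi> Z \<chi> \<alpha> \<beta> L l M m N n u v
  assume \<alpha>: "direct_system_morphism D I r X \<phi> Y \<psi> \<alpha>" and \<beta>: "direct_system_morphism D I r Y \<psi> Z \<chi> \<beta>"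
    and se: "\<forall>i\<in>I. short_exact D (\<alpha> i) (\<beta> i)"
    and L: "is_direct_limit D I r X \<phi> L l" and M: "is_direct_limit D I r Y \<psi> M m"
    and N: "is_direct_limit D I r Z \<chi> N n"
    and u: "u \<in> Hom D L M" "\<forall>i\<in>I. u \<cdot>\<^bsub>D\<^esub> l i = m i \<cdot>\<^bsub>D\<^esub> \<alpha> i"
    and v: "v \<in> Hom D M N" "\<forall>i\<in>I. v \<cdot>\<^bsub>D\<^esub> m i = n i \<cdot>\<^bsub>D\<^esub> \<beta> i"
  note [simp] = inv_f_f[OF f]
  let ?g = "inv_into UNIV f"
  have mor: "direct_system_morphism D (f ` I) (map_prod f f ` r) (X' \<circ> ?g) (\<lambda>a b. \<phi>' (?g a) (?g b))
      (Y' \<circ> ?g) (\<lambda>a b. \<psi>' (?g a) (?g b)) (\<alpha>' \<circ> ?g)"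
    if "direct_system_morphism D I r X' \<phi>' Y' \<psi>' \<alpha>'" for X' \<phi>' Y' \<psi>' \<alpha>'
    using that unfolding direct_system_morphism_def by (auto simp del: Hom_iff)
  have lim: "is_direct_limit D (f ` I) (map_prod f f ` r) (X' \<circ> ?g) (\<lambda>a b. \<phi>' (?g a) (?g b)) L' (l' \<circ> ?g)"
    if "is_direct_limit D I r X' \<phi>' L' l'" for X' \<phi>' L' l'
  proof -
    have "(l' \<circ> ?g) \<circ> f = l'"
      by (simp add: comp_def)
    then show ?thesis
      using that is_direct_limit_reindex[OF f, of D I r X' \<phi>' L' "l' \<circ> ?g"]
      by (simp add: is_direct_limit_def)
  qed
  have "\<forall>i\<in>f ` I. short_exact D ((\<alpha> \<circ> ?g) i) ((\<beta> \<circ> ?g) i)"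
    "\<forall>i\<in>f ` I. u \<cdot>\<^bsub>D\<^esub> (l \<circ> ?g) i = (m \<circ> ?g) i \<cdot>\<^bsub>D\<^esub> (\<alpha> \<circ> ?g) i"
    "\<forall>i\<in>f ` I. v \<cdot>\<^bsub>D\<^esub> (m \<circ> ?g) i = (n \<circ> ?g) i \<cdot>\<^bsub>D\<^esub> (\<beta> \<circ> ?g) i"
    using se u v by simp_all
  then show "short_exact D u v"
    by (rule exact_direct_limitsD[OF ex mor[OF \<alpha>] mor[OF \<beta>] _ lim[OF L] lim[OF M] lim[OF N] u(1) _ v(1)])
qed

section \<open>Systems indexed by the natural numbers\<close>

abbreviation "nat_le \<equiv> {(m, n). m \<le> (n :: nat)}"

lemma directed_nat_le: "directed_set UNIV nat_le"
proof -
  have "\<exists>k. i \<le> k \<and> j \<le> k" for i j :: nat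
    by (rule exI[of _ "max i j"]) simp
  then show ?thesis
    unfolding directed_set_def preorder_on_def refl_on_def trans_def by auto
qed

context category
begin

lemma sequence_systemI:
  assumes "\<And>n. X n \<in> Obj C" "\<And>n. \<phi> n n = Ident C (X n)"
    and "\<And>m n. m \<le> n \<Longrightarrow> \<phi> m n \<in> Arr C \<and> Src C (\<phi> m n) = X m \<and> Tgt C (\<phi> m n) = X n"
    and "\<And>l m n. l \<le> m \<Longrightarrow> m \<le> n \<Longrightarrow> \<phi> m n \<cdot> \<phi> l m = \<phi> l n"
  shows "direct_system C UNIV nat_le X \<phi>"
  unfolding direct_system_def using directed_nat_le assms by simp

lemma sequence_systemD:
  assumes "direct_system C UNIV nat_le X \<phi>"
  shows "X n \<in> Obj C" "\<phi> n n = Ident C (X n)" "m \<le> n \<Longrightarrow> \<phi> m n \<in> Arr C"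
    "m \<le> n \<Longrightarrow> Src C (\<phi> m n) = X m" "m \<le> n \<Longrightarrow> Tgt C (\<phi> m n) = X n"
    "l \<le> m \<Longrightarrow> m \<le> n \<Longrightarrow> \<phi> m n \<cdot> \<phi> l m = \<phi> l n"
  using assms unfolding direct_system_def by (auto)

lemma sequence_limitD:
  assumes "is_direct_limit C UNIV nat_le X \<phi> L l"
  shows "L \<in> Obj C" "l n \<in> Arr C" "Src C (l n) = X n" "Tgt C (l n) = L"
    "m \<le> n \<Longrightarrow> l n \<cdot> \<phi> m n = l m" "direct_system C UNIV nat_le X \<phi>"
  using assms unfolding is_direct_limit_def cocone_def by auto

lemma sequence_limit_factor:
  assumes "is_direct_limit C UNIV nat_le X \<phi> L l" "Y \<in> Obj C"
    and "\<And>n. y n \<in> Arr C \<and> Src C (y n) = X n \<and> Tgt C (y n) = Y"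
    and "\<And>m n. m \<le> n \<Longrightarrow> y n \<cdot> \<phi> m n = y m"
  obtains u where "u \<in> Arr C" "Src C u = L" "Tgt C u = Y" "\<And>n. u \<cdot> l n = y n"
proof -
  have "cocone C UNIV nat_le X \<phi> Y y"
    unfolding cocone_def using assms by simp
  then have "\<exists>!u. u \<in> Hom C L Y \<and> (\<forall>i\<in>UNIV. u \<cdot> l i = y i)"
    using assms(1) unfolding is_direct_limit_def by blast
  then show ?thesis
    using that by auto
qed

lemma sequence_limit_unique:
  assumes lim: "is_direct_limit C UNIV nat_le X \<phi> L l"
    and u: "u \<in> Arr C" "Src C u = L" and v: "v \<in> Arr C" "Src C v = L" "Tgt C u = Tgt C v"
    and eq: "\<And>n. u \<cdot> l n = v \<cdot> l n"
  shows "u = v"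
proof -
  note [simp] = sequence_limitD[OF lim] u v sequence_systemD(3-5)[OF sequence_limitD(6)[OF lim]]
  have "cocone C UNIV nat_le X \<phi> (Tgt C v) (\<lambda>n. v \<cdot> l n)"
    unfolding cocone_def by simp
  then have "\<exists>!w. w \<in> Hom C L (Tgt C v) \<and> (\<forall>i\<in>UNIV. w \<cdot> l i = v \<cdot> l i)"
    using lim unfolding is_direct_limit_def by blast
  moreover have "u \<in> Hom C L (Tgt C v) \<and> (\<forall>i\<in>UNIV. u \<cdot> l i = v \<cdot> l i)"
    "v \<in> Hom C L (Tgt C v) \<and> (\<forall>i\<in>UNIV. v \<cdot> l i = v \<cdot> l i)"
    using eq by simp_all
  ultimately show ?thesis
    by blast
qed

lemma sequence_morphismI:
  assumes "\<And>n. \<alpha> n \<in> Arr C \<and> Src C (\<alpha> n) = X n \<and> Tgt C (\<alpha> n) = Y n"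
    and "\<And>m n. m \<le> n \<Longrightarrow> \<alpha> n \<cdot> \<phi> m n = \<psi> m n \<cdot> \<alpha> m"
  shows "direct_system_morphism C UNIV nat_le X \<phi> Y \<psi> \<alpha>"
  unfolding direct_system_morphism_def using assms by simp

lemma sequence_morphismD:
  assumes "direct_system_morphism C UNIV nat_le X \<phi> Y \<psi> \<alpha>"
  shows "\<alpha> n \<in> Arr C" "Src C (\<alpha> n) = X n" "Tgt C (\<alpha> n) = Y n"
    "m \<le> n \<Longrightarrow> \<alpha> n \<cdot> \<phi> m n = \<psi> m n \<cdot> \<alpha> m"
  using assms unfolding direct_system_morphism_def by auto

lemma sequence_limit_map:
  assumes \<alpha>: "direct_system_morphism C UNIV nat_le X \<phi> Y \<psi> \<alpha>"
    and L: "is_direct_limit C UNIV nat_le X \<phi> L l" and M: "is_direct_limit C UNIV nat_le Y \<psi> M m"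
  obtains u where "u \<in> Arr C" "Src C u = L" "Tgt C u = M" "\<And>n. u \<cdot> l n = m n \<cdot> \<alpha> n"
proof (rule sequence_limit_factor[OF L, of M "\<lambda>n. m n \<cdot> \<alpha> n"])
  note [simp] = sequence_limitD(1-5)[OF L] sequence_limitD(1-5)[OF M] sequence_morphismD(1-3)[OF \<alpha>]
    sequence_systemD(3-5)[OF sequence_limitD(6)[OF L]] sequence_systemD(3-5)[OF sequence_limitD(6)[OF M]]
  show "M \<in> Obj C" "m n \<cdot> \<alpha> n \<in> Arr C \<and> Src C (m n \<cdot> \<alpha> n) = X n \<and> Tgt C (m n \<cdot> \<alpha> n) = M" for n
    by simp_all
  show "(m b \<cdot> \<alpha> b) \<cdot> \<phi> a b = m a \<cdot> \<alpha> a" if [simp]: "a \<le> b" for a b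
    using sequence_morphismD(4)[OF \<alpha> that] reassoc[OF sequence_limitD(5)[OF M that], of "\<alpha> a"] by simp
qed (use that in blast)

text \<open>Compatibility with the transition maps can be tested after the monos \<open>k n\<close>,
  so factors chosen separately at each index form a morphism of systems.\<close>

lemma sequence_morphism_mono_factor:
  assumes \<phi>: "direct_system C UNIV nat_le X \<phi>" and \<psi>: "direct_system C UNIV nat_le Y \<psi>"
    and \<kappa>: "direct_system C UNIV nat_le K \<kappa>"
    and \<alpha>: "direct_system_morphism C UNIV nat_le X \<phi> Y \<psi> \<alpha>"
    and k: "direct_system_morphism C UNIV nat_le K \<kappa> Y \<psi> k" "\<And>n. mono_mor C (k n)"
    and a: "\<And>n. a n \<in> Arr C \<and> Src C (a n) = X n \<and> Tgt C (a n) = K n \<and> k n \<cdot> a n = \<alpha> n"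
  shows "direct_system_morphism C UNIV nat_le X \<phi> K \<kappa> a"
proof (rule sequence_morphismI)
  note [simp] = sequence_systemD(3-5)[OF \<phi>] sequence_systemD(3-5)[OF \<psi>] sequence_systemD(3-5)[OF \<kappa>]
    sequence_morphismD(1-3)[OF \<alpha>] sequence_morphismD(1-3)[OF k(1)]
  have aS [simp]: "a n \<in> Arr C" "Src C (a n) = X n" "Tgt C (a n) = K n" and ka: "k n \<cdot> a n = \<alpha> n" for n
    using a by simp_all
  fix m n :: nat
  assume mn [simp]: "m \<le> n"
  have "k n \<cdot> (a n \<cdot> \<phi> m n) = k n \<cdot> (\<kappa> m n \<cdot> a m)"
    using reassoc[OF ka[of n], of "\<phi> m n"] sequence_morphismD(4)[OF \<alpha> mn] ka[of m]
      reassoc[OF sequence_morphismD(4)[OF k(1) mn], of "a m"] by simp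
  then show "a n \<cdot> \<phi> m n = \<kappa> m n \<cdot> a m"
    by (rule_tac mono_morD[OF k(2)]) simp_all
qed (use a in simp)

lemma sequence_morphism_epi_factor:
  assumes \<phi>: "direct_system C UNIV nat_le X \<phi>" and \<psi>: "direct_system C UNIV nat_le Y \<psi>"
    and \<kappa>: "direct_system C UNIV nat_le K \<kappa>"
    and \<alpha>: "direct_system_morphism C UNIV nat_le X \<phi> Y \<psi> \<alpha>"
    and c: "direct_system_morphism C UNIV nat_le X \<phi> K \<kappa> c" "\<And>n. epi_mor C (c n)"
    and a: "\<And>n. a n \<in> Arr C \<and> Src C (a n) = K n \<and> Tgt C (a n) = Y n \<and> a n \<cdot> c n = \<alpha> n"
  shows "direct_system_morphism C UNIV nat_le K \<kappa> Y \<psi> a"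
proof (rule sequence_morphismI)
  note [simp] = sequence_systemD(3-5)[OF \<phi>] sequence_systemD(3-5)[OF \<psi>] sequence_systemD(3-5)[OF \<kappa>]
    sequence_morphismD(1-3)[OF \<alpha>] sequence_morphismD(1-3)[OF c(1)]
  have aS [simp]: "a n \<in> Arr C" "Src C (a n) = K n" "Tgt C (a n) = Y n" and ac: "a n \<cdot> c n = \<alpha> n" for n
    using a by simp_all
  fix m n :: nat
  assume mn [simp]: "m \<le> n"
  have "(a n \<cdot> \<kappa> m n) \<cdot> c m = (\<psi> m n \<cdot> a m) \<cdot> c m"
    using reassoc[OF ac[of n], of "\<phi> m n"] sequence_morphismD(4)[OF \<alpha> mn] ac[of m]
      sequence_morphismD(4)[OF c(1) mn, symmetric] by simp
  then show "a n \<cdot> \<kappa> m n = \<psi> m n \<cdot> a m"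
    by (rule_tac epi_morD[OF c(2)[of m]]) simp_all
qed (use a in simp)

end

context abelian_category
begin

text \<open>The transition maps between the chosen kernels are forced by the inclusions
  \<open>k n\<close>; cancelling these monos gives the identity and composition laws.\<close>

lemma ex_kernel_system:
  assumes \<phi>: "direct_system C UNIV nat_le X \<phi>" and \<psi>: "direct_system C UNIV nat_le Y \<psi>"
    and \<alpha>: "direct_system_morphism C UNIV nat_le X \<phi> Y \<psi> \<alpha>"
    and k: "\<And>n. is_kernel C (\<alpha> n) (k n)"
  obtains \<kappa> where "direct_system C UNIV nat_le (\<lambda>n. Src C (k n)) \<kappa>"
    "direct_system_morphism C UNIV nat_le (\<lambda>n. Src C (k n)) \<kappa> X \<phi> k"
proof -
  note [simp] = sequence_systemD(1,3-5)[OF \<phi>] sequence_systemD(1,3-5)[OF \<psi>] sequence_morphismD(1-3)[OF \<alpha>]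
  have kS [simp]: "k n \<in> Arr C" "Tgt C (k n) = X n"
    and \<alpha>k: "\<alpha> n \<cdot> k n = ZeroMor C (Src C (k n)) (Y n)" for n
    using is_kernelD[OF k[of n]] by simp_all
  have "\<exists>s. s \<in> Hom C (Src C (k m)) (Src C (k n)) \<and> k n \<cdot> s = \<phi> m n \<cdot> k m" if [simp]: "m \<le> n" for m n
  proof -
    have "\<alpha> n \<cdot> (\<phi> m n \<cdot> k m) = ZeroMor C (Src C (k m)) (Y n)"
      using reassoc[OF sequence_morphismD(4)[OF \<alpha> that], of "k m"] \<alpha>k[of m] by simp
    then show ?thesis
      using is_kernel_factor[OF k[of n], of "\<phi> m n \<cdot> k m"] by auto
  qed
  then obtain \<kappa> where "\<And>m n. m \<le> n \<Longrightarrow> \<kappa> m n \<in> Hom C (Src C (k m)) (Src C (k n)) \<and> k n \<cdot> \<kappa> m n = \<phi> m n \<cdot> k m"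
    by metis
  then have \<kappa>S [simp]: "m \<le> n \<Longrightarrow> \<kappa> m n \<in> Arr C" "m \<le> n \<Longrightarrow> Src C (\<kappa> m n) = Src C (k m)"
    "m \<le> n \<Longrightarrow> Tgt C (\<kappa> m n) = Src C (k n)" and k\<kappa>: "m \<le> n \<Longrightarrow> k n \<cdot> \<kappa> m n = \<phi> m n \<cdot> k m" for m n
    by simp_all
  have "direct_system C UNIV nat_le (\<lambda>n. Src C (k n)) \<kappa>"
  proof (rule sequence_systemI)
    fix l m n :: nat
    assume [simp]: "l \<le> m" "m \<le> n"
    then have [simp]: "l \<le> n"
      by (rule order_trans)
    have "k n \<cdot> (\<kappa> m n \<cdot> \<kappa> l m) = k n \<cdot> \<kappa> l n"
      using reassoc[OF k\<kappa>[of m n], of "\<kappa> l m"] k\<kappa>[of l m] k\<kappa>[of l n]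
        reassoc[OF sequence_systemD(6)[OF \<phi>, of l m n], of "k l"] by simp
    then show "\<kappa> m n \<cdot> \<kappa> l m = \<kappa> l n"
      by (rule_tac mono_morD[OF is_kernel_mono[OF k[of n]]]) simp_all
  next
    fix n
    have "k n \<cdot> \<kappa> n n = k n \<cdot> Ident C (Src C (k n))"
      using k\<kappa>[of n n] sequence_systemD(2)[OF \<phi>, of n] by simp
    then show "\<kappa> n n = Ident C (Src C (k n))"
      by (rule_tac mono_morD[OF is_kernel_mono[OF k[of n]]]) simp_all
  qed simp_all
  moreover have "direct_system_morphism C UNIV nat_le (\<lambda>n. Src C (k n)) \<kappa> X \<phi> k"
    by (rule sequence_morphismI) (simp_all add: k\<kappa>)
  ultimately show ?thesis
    using that by blast
qed

lemma ex_cokernel_system: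
  assumes \<phi>: "direct_system C UNIV nat_le X \<phi>" and \<psi>: "direct_system C UNIV nat_le Y \<psi>"
    and \<alpha>: "direct_system_morphism C UNIV nat_le X \<phi> Y \<psi> \<alpha>"
    and c: "\<And>n. is_cokernel C (\<alpha> n) (c n)"
  obtains \<kappa> where "direct_system C UNIV nat_le (\<lambda>n. Tgt C (c n)) \<kappa>"
    "direct_system_morphism C UNIV nat_le Y \<psi> (\<lambda>n. Tgt C (c n)) \<kappa> c"
proof -
  note [simp] = sequence_systemD(1,3-5)[OF \<phi>] sequence_systemD(1,3-5)[OF \<psi>] sequence_morphismD(1-3)[OF \<alpha>]
  have cS [simp]: "c n \<in> Arr C" "Src C (c n) = Y n"
    and c\<alpha>: "c n \<cdot> \<alpha> n = ZeroMor C (X n) (Tgt C (c n))" for n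
    using is_cokernelD[OF c[of n]] by simp_all
  have "\<exists>s. s \<in> Hom C (Tgt C (c m)) (Tgt C (c n)) \<and> s \<cdot> c m = c n \<cdot> \<psi> m n" if [simp]: "m \<le> n" for m n
  proof -
    have "(c n \<cdot> \<psi> m n) \<cdot> \<alpha> m = ZeroMor C (X m) (Tgt C (c n))"
      using sequence_morphismD(4)[OF \<alpha> that, symmetric] reassoc[OF c\<alpha>[of n], of "\<phi> m n"] by simp
    then show ?thesis
      using is_cokernel_factor[OF c[of m], of "c n \<cdot> \<psi> m n"] by auto
  qed
  then obtain \<kappa> where "\<And>m n. m \<le> n \<Longrightarrow> \<kappa> m n \<in> Hom C (Tgt C (c m)) (Tgt C (c n)) \<and> \<kappa> m n \<cdot> c m = c n \<cdot> \<psi> m n"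
    by metis
  then have \<kappa>S [simp]: "m \<le> n \<Longrightarrow> \<kappa> m n \<in> Arr C" "m \<le> n \<Longrightarrow> Src C (\<kappa> m n) = Tgt C (c m)"
    "m \<le> n \<Longrightarrow> Tgt C (\<kappa> m n) = Tgt C (c n)" and \<kappa>c: "m \<le> n \<Longrightarrow> \<kappa> m n \<cdot> c m = c n \<cdot> \<psi> m n" for m n
    by simp_all
  have "direct_system C UNIV nat_le (\<lambda>n. Tgt C (c n)) \<kappa>"
  proof (rule sequence_systemI)
    fix l m n :: nat
    assume [simp]: "l \<le> m" "m \<le> n"
    then have [simp]: "l \<le> n"
      by (rule order_trans)
    have "(\<kappa> m n \<cdot> \<kappa> l m) \<cdot> c l = \<kappa> l n \<cdot> c l"
      using reassoc[OF \<kappa>c[of m n], of "\<psi> l m"] \<kappa>c[of l m] \<kappa>c[of l n]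
        sequence_systemD(6)[OF \<psi>, of l m n] by simp
    then show "\<kappa> m n \<cdot> \<kappa> l m = \<kappa> l n"
      by (rule_tac epi_morD[OF is_cokernel_epi[OF c[of l]]]) simp_all
  next
    fix n
    have "\<kappa> n n \<cdot> c n = Ident C (Tgt C (c n)) \<cdot> c n"
      using \<kappa>c[of n n] sequence_systemD(2)[OF \<psi>, of n] by simp
    then show "\<kappa> n n = Ident C (Tgt C (c n))"
      by (rule_tac epi_morD[OF is_cokernel_epi[OF c[of n]]]) simp_all
  qed simp_all
  moreover have "direct_system_morphism C UNIV nat_le Y \<psi> (\<lambda>n. Tgt C (c n)) \<kappa> c"
    by (rule sequence_morphismI) (simp_all add: \<kappa>c)
  ultimately show ?thesis
    using that by blast
qed

text \<open>The inclusion \<open>k\<close> is itself killed by \<open>g\<close>, hence lifts to some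
  \<open>y\<close> with \<open>f \<cdot> y = k \<cdot> e\<close>; cancelling \<open>k\<close> gives
  \<open>a \<cdot> y = e\<close>, which is epi.\<close>

lemma exact_pair_epi_image:
  assumes ex: "exact_pair C f g" and k: "is_kernel C g k"
    and a: "a \<in> Arr C" "Src C a = Src C f" "Tgt C a = Src C k" "k \<cdot> a = f"
  shows "epi_mor C a"
proof -
  note [simp] = exact_pairD(1-3)[OF ex] is_kernelD[OF k] a(1-3)
  obtain e y where e: "epi_mor C e" and [simp]: "e \<in> Arr C" "Tgt C e = Src C k" "y \<in> Arr C"
    "Src C y = Src C e" "Tgt C y = Src C f" and fy: "f \<cdot> y = k \<cdot> e"
    using exact_pair_lift[OF ex, of k] by auto
  have "k \<cdot> (a \<cdot> y) = k \<cdot> e"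
    using reassoc[OF a(4), of y] fy by simp
  then have "a \<cdot> y = e"
    by (rule_tac mono_morD[OF is_kernel_mono[OF k]]) simp_all
  then show ?thesis
    using epi_of_comp[of a y] e by simp
qed

text \<open>If \<open>b\<close> kills \<open>v\<close>, lift \<open>v\<close> along the epi
  \<open>c\<close> to some \<open>y\<close>, after an epi \<open>e\<close>. Then
  \<open>g \<cdot> y = 0\<close>, so \<open>y\<close> comes from \<open>k\<close>, which
  \<open>c\<close> kills; thus \<open>v \<cdot> e = 0\<close>.\<close>

lemma coimage_mono:
  assumes k: "is_kernel C g k" and c: "is_cokernel C k c"
    and b: "b \<in> Arr C" "Src C b = Tgt C c" "b \<cdot> c = g"
  shows "mono_mor C b"
proof (rule mono_morI)
  have bT: "Tgt C b = Tgt C g"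
    using b is_cokernelD[OF c] by auto
  note [simp] = is_kernelD[OF k] is_cokernelD(2-4)[OF c] b(1,2) bT
  fix v
  assume [simp]: "v \<in> Arr C" "Tgt C v = Src C b" and bv: "b \<cdot> v = ZeroMor C (Src C v) (Tgt C b)"
  obtain e y where e: "epi_mor C e" and [simp]: "Tgt C e = Src C v" "y \<in> Arr C" "Src C y = Src C e"
    "Tgt C y = Src C c" and cy: "c \<cdot> y = v \<cdot> e"
    using epi_pullback[OF is_cokernel_epi[OF c], of v] by auto
  note [simp] = epi_mor_arr[OF e]
  have "g \<cdot> y = ZeroMor C (Src C y) (Tgt C g)"
    using reassoc[OF b(3), of y] cy reassoc[OF bv, of e] by simp
  then obtain s where [simp]: "s \<in> Arr C" "Src C s = Src C y" "Tgt C s = Src C k" and ks: "k \<cdot> s = y"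
    using is_kernel_factor[OF k, of y] by auto
  have "c \<cdot> y = (c \<cdot> k) \<cdot> s"
    using ks by (simp del: is_cokernelD(4)[OF c])
  then have "v \<cdot> e = ZeroMor C (Src C e) (Tgt C v)"
    using cy by simp
  then show "v = ZeroMor C (Src C v) (Src C b)"
    using epi_mor_zero[OF e, of v] by simp
qed (rule b(1))

end

section \<open>Sequential limits of exact pairs\<close>

locale exact_sequence_limits = abelian_category +
  assumes has_limits: "has_direct_limits TYPE(nat) C"
    and exact_limits: "exact_direct_limits TYPE(nat) C"
begin

lemma ex_sequence_limit:
  assumes "direct_system C UNIV nat_le X \<phi>"
  obtains L l where "is_direct_limit C UNIV nat_le X \<phi> L l"
  using assms has_limits unfolding has_direct_limits_def by blast

lemma sequence_limit_short_exact:
  assumes "direct_system_morphism C UNIV nat_le X \<phi> Y \<psi> \<alpha>" "direct_system_morphism C UNIV nat_le Y \<psi> Z \<chi> \<beta>"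
    and "\<And>n. short_exact C (\<alpha> n) (\<beta> n)"
    and "is_direct_limit C UNIV nat_le X \<phi> L l" "is_direct_limit C UNIV nat_le Y \<psi> M m"
      "is_direct_limit C UNIV nat_le Z \<chi> N n"
    and "u \<in> Arr C" "Src C u = L" "Tgt C u = M" "\<And>i. u \<cdot> l i = m i \<cdot> \<alpha> i"
    and "v \<in> Arr C" "Src C v = M" "Tgt C v = N" "\<And>i. v \<cdot> m i = n i \<cdot> \<beta> i"
  shows "short_exact C u v"
proof -
  have "u \<in> Hom C L M" "\<forall>i\<in>UNIV. u \<cdot> l i = m i \<cdot> \<alpha> i" "v \<in> Hom C M N" "\<forall>i\<in>UNIV. v \<cdot> m i = n i \<cdot> \<beta> i"
    "\<forall>i\<in>UNIV. short_exact C (\<alpha> i) (\<beta> i)"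
    using assms by simp_all
  then show ?thesis
    using exact_direct_limitsD[OF exact_limits assms(1,2) _ assms(4-6)] by blast
qed

text \<open>Exactness of limits is given for short exact sequences, so X -> Y -> Z is cut at the
  kernel K of \<open>\<beta>\<close> and at the cokernel of K -> Y. The three resulting systems of
  short exact sequences show that in the limit \<open>u\<close> is an epi followed by the kernel of
  \<open>uc\<close>, and \<open>v\<close> is \<open>uc\<close> followed by a mono.\<close>

lemma sequence_limit_exact:
  assumes \<alpha>: "direct_system_morphism C UNIV nat_le X \<phi> Y \<psi> \<alpha>" and \<beta>: "direct_system_morphism C UNIV nat_le Y \<psi> Z \<chi> \<beta>"
    and ex: "\<And>n. exact_pair C (\<alpha> n) (\<beta> n)"
    and L: "is_direct_limit C UNIV nat_le X \<phi> L l" and M: "is_direct_limit C UNIV nat_le Y \<psi> M m"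
    and N: "is_direct_limit C UNIV nat_le Z \<chi> N n"
    and u: "u \<in> Arr C" "Src C u = L" "Tgt C u = M" "\<And>i. u \<cdot> l i = m i \<cdot> \<alpha> i"
    and v: "v \<in> Arr C" "Src C v = M" "Tgt C v = N" "\<And>i. v \<cdot> m i = n i \<cdot> \<beta> i"
  shows "exact_pair C u v"
proof -
  note \<phi> = sequence_limitD(6)[OF L] and \<psi> = sequence_limitD(6)[OF M] and \<chi> = sequence_limitD(6)[OF N]
  note \<alpha>S [simp] = sequence_morphismD(1-3)[OF \<alpha>] and \<beta>S [simp] = sequence_morphismD(1-3)[OF \<beta>]
  obtain k where k: "\<And>n. is_kernel C (\<beta> n) (k n)"
    using choice[OF allI, of "\<lambda>n. is_kernel C (\<beta> n)", OF ex_kernel[OF \<beta>S(1)]] by blast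
  have kS [simp]: "k n \<in> Arr C" "Tgt C (k n) = Y n" for n
    using is_kernelD[OF k[of n]] by simp_all
  obtain \<kappa> where \<kappa>: "direct_system C UNIV nat_le (\<lambda>n. Src C (k n)) \<kappa>"
    and km: "direct_system_morphism C UNIV nat_le (\<lambda>n. Src C (k n)) \<kappa> Y \<psi> k"
    using ex_kernel_system[OF \<psi> \<chi> \<beta> k] .
  have "\<exists>a. a \<in> Arr C \<and> Src C a = X n \<and> Tgt C a = Src C (k n) \<and> k n \<cdot> a = \<alpha> n" for n
    using is_kernel_factor[OF k[of n], of "\<alpha> n"] exact_pairD(4)[OF ex[of n]] by auto
  then obtain a where a: "\<And>n. a n \<in> Arr C \<and> Src C (a n) = X n \<and> Tgt C (a n) = Src C (k n) \<and> k n \<cdot> a n = \<alpha> n"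
    by metis
  then have aS [simp]: "a n \<in> Arr C" "Src C (a n) = X n" "Tgt C (a n) = Src C (k n)"
    and ka: "k n \<cdot> a n = \<alpha> n" for n
    by simp_all
  have am: "direct_system_morphism C UNIV nat_le X \<phi> (\<lambda>n. Src C (k n)) \<kappa> a"
    by (rule sequence_morphism_mono_factor[OF \<phi> \<psi> \<kappa> \<alpha> km is_kernel_mono[OF k] a])
  have ae: "epi_mor C (a n)" for n
    by (rule exact_pair_epi_image[OF ex[of n] k[of n]]) (simp_all add: ka)
  obtain r where r: "\<And>n. is_kernel C (a n) (r n)"
    using choice[OF allI, of "\<lambda>n. is_kernel C (a n)", OF ex_kernel[OF aS(1)]] by blast
  obtain \<rho> where \<rho>: "direct_system C UNIV nat_le (\<lambda>n. Src C (r n)) \<rho>"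
    and rm: "direct_system_morphism C UNIV nat_le (\<lambda>n. Src C (r n)) \<rho> X \<phi> r"
    using ex_kernel_system[OF \<phi> \<kappa> am r] .
  \<comment> \<open>\<open>c n\<close> is the coimage of \<open>\<beta> n\<close>, so the induced
    \<open>b n\<close> is mono, and its cokernel \<open>d n\<close> completes the third short exact
    sequence.\<close>
  obtain c where c: "\<And>n. is_cokernel C (k n) (c n)"
    using choice[OF allI, of "\<lambda>n. is_cokernel C (k n)", OF ex_cokernel[OF kS(1)]] by blast
  have cS [simp]: "c n \<in> Arr C" "Src C (c n) = Y n" for n
    using is_cokernelD[OF c[of n]] by simp_all
  obtain \<gamma> where \<gamma>: "direct_system C UNIV nat_le (\<lambda>n. Tgt C (c n)) \<gamma>"
    and cm: "direct_system_morphism C UNIV nat_le Y \<psi> (\<lambda>n. Tgt C (c n)) \<gamma> c"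
    using ex_cokernel_system[OF \<kappa> \<psi> km c] .
  have "\<exists>b. b \<in> Arr C \<and> Src C b = Tgt C (c n) \<and> Tgt C b = Z n \<and> b \<cdot> c n = \<beta> n" for n
    using is_cokernel_factor[OF c[of n], of "\<beta> n"] is_kernelD(4)[OF k[of n]] by auto
  then obtain b where b: "\<And>n. b n \<in> Arr C \<and> Src C (b n) = Tgt C (c n) \<and> Tgt C (b n) = Z n \<and> b n \<cdot> c n = \<beta> n"
    by metis
  then have bS [simp]: "b n \<in> Arr C" "Src C (b n) = Tgt C (c n)" "Tgt C (b n) = Z n"
    and bc: "b n \<cdot> c n = \<beta> n" for n
    by simp_all
  have bm: "direct_system_morphism C UNIV nat_le (\<lambda>n. Tgt C (c n)) \<gamma> Z \<chi> b"
    by (rule sequence_morphism_epi_factor[OF \<psi> \<chi> \<gamma> \<beta> cm is_cokernel_epi[OF c] b])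
  have b_mono: "mono_mor C (b n)" for n
    by (rule coimage_mono[OF k[of n] c[of n]]) (simp_all add: bc)
  obtain d where d: "\<And>n. is_cokernel C (b n) (d n)"
    using choice[OF allI, of "\<lambda>n. is_cokernel C (b n)", OF ex_cokernel[OF bS(1)]] by blast
  obtain \<delta> where \<delta>: "direct_system C UNIV nat_le (\<lambda>n. Tgt C (d n)) \<delta>"
    and dm: "direct_system_morphism C UNIV nat_le Z \<chi> (\<lambda>n. Tgt C (d n)) \<delta> d"
    using ex_cokernel_system[OF \<gamma> \<chi> bm d] .
  obtain LK lk where LK: "is_direct_limit C UNIV nat_le (\<lambda>n. Src C (k n)) \<kappa> LK lk"
    using ex_sequence_limit[OF \<kappa>] .
  obtain LR lr where LR: "is_direct_limit C UNIV nat_le (\<lambda>n. Src C (r n)) \<rho> LR lr"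
    using ex_sequence_limit[OF \<rho>] .
  obtain LC lc where LC: "is_direct_limit C UNIV nat_le (\<lambda>n. Tgt C (c n)) \<gamma> LC lc"
    using ex_sequence_limit[OF \<gamma>] .
  obtain LD ld where LD: "is_direct_limit C UNIV nat_le (\<lambda>n. Tgt C (d n)) \<delta> LD ld"
    using ex_sequence_limit[OF \<delta>] .
  obtain ur where ur: "ur \<in> Arr C" "Src C ur = LR" "Tgt C ur = L" "\<And>n. ur \<cdot> lr n = l n \<cdot> r n"
    using sequence_limit_map[OF rm LR L] by blast
  obtain ua where ua: "ua \<in> Arr C" "Src C ua = L" "Tgt C ua = LK" "\<And>n. ua \<cdot> l n = lk n \<cdot> a n"
    using sequence_limit_map[OF am L LK] by blast
  obtain uk where uk: "uk \<in> Arr C" "Src C uk = LK" "Tgt C uk = M" "\<And>n. uk \<cdot> lk n = m n \<cdot> k n"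
    using sequence_limit_map[OF km LK M] by blast
  obtain uc where uc: "uc \<in> Arr C" "Src C uc = M" "Tgt C uc = LC" "\<And>n. uc \<cdot> m n = lc n \<cdot> c n"
    using sequence_limit_map[OF cm M LC] by blast
  obtain ub where ub: "ub \<in> Arr C" "Src C ub = LC" "Tgt C ub = N" "\<And>i. ub \<cdot> lc i = n i \<cdot> b i"
    using sequence_limit_map[OF bm LC N] by blast
  obtain ud where ud: "ud \<in> Arr C" "Src C ud = N" "Tgt C ud = LD" "\<And>i. ud \<cdot> n i = ld i \<cdot> d i"
    using sequence_limit_map[OF dm N LD] by blast
  have se1: "short_exact C ur ua"
    by (rule sequence_limit_short_exact[OF rm am short_exact_kernelI[OF r ae] LR L LK ur ua])
  have se2: "short_exact C uk uc"
    by (rule sequence_limit_short_exact[OF km cm short_exact_cokernelI[OF c is_kernel_mono[OF k]] LK M LC uk uc])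
  have se3: "short_exact C ub ud"
    by (rule sequence_limit_short_exact[OF bm dm short_exact_cokernelI[OF d b_mono] LC N LD ub ud])
  note [simp] = u(1-3) v(1-3) ua(1-3) uk(1-3) uc(1-3) ub(1-3) sequence_limitD(1-4)[OF L]
    sequence_limitD(1-4)[OF M] sequence_limitD(1-4)[OF N] sequence_limitD(1-4)[OF LK] sequence_limitD(1-4)[OF LC]
  \<comment> \<open>Maps out of a limit are determined on the members of the system, where the
    factorisations of \<open>\<alpha>\<close> and \<open>\<beta>\<close> hold.\<close>
  have u_eq: "uk \<cdot> ua = u"
  proof (rule sequence_limit_unique[OF L])
    show "(uk \<cdot> ua) \<cdot> l i = u \<cdot> l i" for i
      using ua(4)[of i] reassoc[OF uk(4)[of i], of "a i"] ka[of i] u(4)[of i] by simp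
  qed simp_all
  have v_eq: "ub \<cdot> uc = v"
  proof (rule sequence_limit_unique[OF M])
    show "(ub \<cdot> uc) \<cdot> m i = v \<cdot> m i" for i
      using uc(4)[of i] reassoc[OF ub(4)[of i], of "c i"] bc[of i] v(4)[of i] by simp
  qed simp_all
  show ?thesis
  proof (rule exact_pairI)
    have "(ub \<cdot> uc) \<cdot> (uk \<cdot> ua) = ub \<cdot> ((uc \<cdot> uk) \<cdot> ua)"
      by simp
    then show "v \<cdot> u = ZeroMor C (Src C u) (Tgt C v)"
      unfolding u_eq v_eq short_exact_simps(4)[OF se2] by simp
    fix x
    assume x [simp]: "x \<in> Arr C" "Tgt C x = Src C v" and vx: "v \<cdot> x = ZeroMor C (Src C x) (Tgt C v)"
    \<comment> \<open>Since \<open>ub\<close> is mono, \<open>uc\<close> kills \<open>x\<close>, so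
      \<open>x\<close> comes from the limit of the kernels; the epi \<open>ua\<close> lifts it on to
      \<open>L\<close> after restriction along \<open>e\<close>.\<close>
    have "ub \<cdot> (uc \<cdot> x) = ZeroMor C (Src C x) N"
      using reassoc[OF v_eq, of x] vx by simp
    then have "uc \<cdot> x = ZeroMor C (Src C x) (Tgt C uc)"
      using mono_mor_zero[OF short_exactD(3)[OF se3], of "uc \<cdot> x"] by simp
    then obtain y where [simp]: "y \<in> Arr C" "Src C y = Src C x" "Tgt C y = LK" and y: "uk \<cdot> y = x"
      using is_kernel_factor[OF short_exactD(1)[OF se2], of x] by auto
    obtain e z where e: "epi_mor C e" and [simp]: "Tgt C e = Src C x" "z \<in> Arr C" "Src C z = Src C e"
      "Tgt C z = L" and z: "ua \<cdot> z = y \<cdot> e"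
      using epi_pullback[OF short_exactD(4)[OF se1], of y] by auto
    note [simp] = epi_mor_arr[OF e]
    have "u \<cdot> z = x \<cdot> e"
      using reassoc[OF u_eq, of z] z reassoc[OF y, of e] by simp
    then show "\<exists>e y. epi_mor C e \<and> Tgt C e = Src C x \<and> y \<in> Arr C \<and> Src C y = Src C e \<and>
      Tgt C y = Src C u \<and> u \<cdot> y = x \<cdot> e"
      using e by (intro exI[of _ e] exI[of _ z]) simp
  qed simp_all
qed

end

section \<open>The Mislin completion\<close>

lemma cohom_morphism_cong:
  assumes "\<And>k M. M \<in> Obj C \<Longrightarrow> \<mu> k M = \<nu> k M" "cohom_morphism C D T U \<mu>" "category C"
  shows "cohom_morphism C D T U \<nu>"
proof -
  interpret category C by fact
  have "Src C \<iota> \<in> Obj C \<and> Tgt C \<pi> \<in> Obj C" if "short_exact C \<iota> \<pi>" for \<iota> \<pi>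
    using that mono_mor_arr[of \<iota>] epi_mor_arr[of \<pi>] unfolding short_exact_def by simp
  then show ?thesis
    using assms(2) cohom_morphismD[OF assms(2)] assms(1)[symmetric] by (intro cohom_morphismI) simp_all
qed

lemma (in two_abelian) cohom_morphism_from_ident:
  assumes T: "cohom_ftor C D T"
    and eq: "\<And>k. k \<ge> n \<Longrightarrow> Deg U k = Deg T k" "\<And>k. k \<ge> n \<Longrightarrow> Conn U k = Conn T k"
  shows "cohom_morphism_from C D n T U (\<lambda>k M. Ident D (fobj (Deg T k) M))"
proof -
  have "cohom_morphism_from C D n T T (\<lambda>k M. Ident D (fobj (Deg T k) M))"
    using cohom_ftor.cohom_morphism_ident[OF T] cohom_morphism_iff_from by blast
  then show ?thesis
    unfolding cohom_morphism_from_def using eq by simp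
qed

locale satellite_limits = satellite_cohom C D i p \<kappa> T + D: exact_sequence_limits D
  for C :: "('o, 'm) ab_cat" and D :: "('p, 'q) ab_cat" and i p \<kappa> T
begin

lemma trunc_ftor: "cohom_ftor C D (Tr m)"
  by unfold_locales (rule trunc_cohomological)

sublocale trunc: cohom_ftor C D "Tr m" for m
  by (rule trunc_ftor)

lemma extension_trunc:
  assumes "cohom_ftor C D V"
  shows "cohom_extension C D i p \<kappa> V (Tr m) (int m)"
proof -
  interpret V: cohom_ftor C D V by fact
  show ?thesis
    by unfold_locales (rule trunc_projective)
qed

text \<open>The bound \<open>n\<close> is free here, so uniqueness applies from whatever degree on
  two morphisms are known to agree.\<close>

lemma extension_vanishing:
  assumes "cohom_ftor C D V" "cohomological_functor C D U" "vanishes_on_projectives C D U"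
  shows "cohom_extension C D i p \<kappa> V U n"
proof -
  interpret V: cohom_ftor C D V by fact
  show ?thesis
    by unfold_locales (use assms in \<open>simp_all add: vanishes_on_projectives_def\<close>)
qed

text \<open>Identities form a partial morphism into \<open>T\<langle>n\<rangle>\<close> from degree
  \<open>n\<close> on, and this extends downward. \<open>V = T\<close> produces
  \<open>\<Phi>\<close>, and \<open>V = T\<langle>m\<rangle>\<close> with \<open>m \<le> n\<close>
  produces \<open>\<Psi>\<close>.\<close>

lemma ex_to_trunc:
  assumes V: "cohom_ftor C D V" and eq: "\<And>k. k \<ge> int n \<Longrightarrow> Deg V k = Deg T k" "\<And>k. k \<ge> int n \<Longrightarrow> Conn V k = Conn T k"
  shows "\<exists>\<nu>. cohom_morphism C D V (Tr n) \<nu> \<and> (\<forall>k\<ge>int n. \<forall>M\<in>Obj C. \<nu> k M = Ident D (fobj (Deg T k) M))"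
proof -
  have "cohom_morphism_from C D (int n) V (Tr n) (\<lambda>k M. Ident D (fobj (Deg V k) M))"
    by (rule cohom_morphism_from_ident[OF V]) (simp_all add: eq)
  then obtain \<nu> where "cohom_morphism C D V (Tr n) \<nu>"
    and "\<And>k. k \<ge> int n \<Longrightarrow> \<nu> k = (\<lambda>M. Ident D (fobj (Deg V k) M))"
    using cohom_extension.cohom_morphism_extend[OF extension_trunc[OF V]] by blast
  then show ?thesis
    using eq(1) by (intro exI[of _ \<nu>]) simp
qed

end

section \<open>An arbitrary limit of the truncations\<close>

locale satellite_limit = satellite_limits C D i p \<kappa> T
  for C :: "('o, 'm) ab_cat" and D :: "('p, 'q) ab_cat" and i p \<kappa> T +
  fixes T' :: "('o, 'm, 'p, 'q) cohom" and \<Phi> \<Psi> l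
  assumes \<Phi>: "cohom_morphism C D T (Tr m) (\<Phi> m)"
    and \<Phi>_ident: "k \<ge> int m \<Longrightarrow> M \<in> Obj C \<Longrightarrow> \<Phi> m k M = Ident D (fobj (Deg T k) M)"
    and \<Psi>: "m \<le> n \<Longrightarrow> cohom_morphism C D (Tr m) (Tr n) (\<Psi> m n)"
    and \<Psi>_ident: "m \<le> n \<Longrightarrow> k \<ge> int n \<Longrightarrow> M \<in> Obj C \<Longrightarrow> \<Psi> m n k M = Ident D (fobj (Deg T k) M)"
    and lim: "M \<in> Obj C \<Longrightarrow> is_direct_limit D UNIV nat_le (\<lambda>m. fobj (Deg (Tr m) k) M) (\<lambda>m n. \<Psi> m n k M)
      (fobj (Deg T' k) M) (\<lambda>m. l m k M)"
    and lim_map: "f \<in> Arr C \<Longrightarrow> fmap (Deg T' k) f \<in> Hom D (fobj (Deg T' k) (Src C f)) (fobj (Deg T' k) (Tgt C f))"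
      "f \<in> Arr C \<Longrightarrow> fmap (Deg T' k) f \<cdot>\<^bsub>D\<^esub> l m k (Src C f) = l m k (Tgt C f) \<cdot>\<^bsub>D\<^esub> fmap (Deg (Tr m) k) f"
    and lim_Conn: "short_exact C \<iota> \<pi> \<Longrightarrow>
        Conn T' k \<iota> \<pi> \<in> Hom D (fobj (Deg T' k) (Tgt C \<pi>)) (fobj (Deg T' (k + 1)) (Src C \<iota>))"
      "short_exact C \<iota> \<pi> \<Longrightarrow> Conn T' k \<iota> \<pi> \<cdot>\<^bsub>D\<^esub> l m k (Tgt C \<pi>)
        = l m (k + 1) (Src C \<iota>) \<cdot>\<^bsub>D\<^esub> Conn (Tr m) k \<iota> \<pi>"
begin

lemma lim_simps [simp]:
  assumes "M \<in> Obj C"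
  shows "fobj (Deg T' k) M \<in> Obj D" "l m k M \<in> Arr D" "Src D (l m k M) = fobj (Deg (Tr m) k) M"
    "Tgt D (l m k M) = fobj (Deg T' k) M"
  using D.sequence_limitD[OF lim[OF assms]] by simp_all

lemma lim_map_simps [simp]:
  assumes "f \<in> Arr C"
  shows "fmap (Deg T' k) f \<in> Arr D" "Src D (fmap (Deg T' k) f) = fobj (Deg T' k) (Src C f)"
    "Tgt D (fmap (Deg T' k) f) = fobj (Deg T' k) (Tgt C f)"
  using lim_map(1)[OF assms] by simp_all

lemma lim_Conn_simps:
  assumes "short_exact C \<iota> \<pi>"
  shows "Conn T' k \<iota> \<pi> \<in> Arr D" "Src D (Conn T' k \<iota> \<pi>) = fobj (Deg T' k) (Tgt C \<pi>)"
    "Tgt D (Conn T' k \<iota> \<pi>) = fobj (Deg T' (k + 1)) (Src C \<iota>)"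
  using lim_Conn(1)[OF assms] by simp_all

text \<open>Maps out of the limit are tested on all \<open>l m\<close>; this reduces functoriality
  of \<open>T'\<close> and naturality of its connecting maps to the truncations.\<close>

lemma lim_unique:
  assumes "M \<in> Obj C" "u \<in> Arr D" "v \<in> Arr D" "Src D u = fobj (Deg T' k) M" "Src D v = fobj (Deg T' k) M"
    "Tgt D u = Tgt D v" "\<And>m. u \<cdot>\<^bsub>D\<^esub> l m k M = v \<cdot>\<^bsub>D\<^esub> l m k M"
  shows "u = v"
  using D.sequence_limit_unique[OF lim[OF assms(1)]] assms by blast

lemma lim_\<Psi>: "M \<in> Obj C \<Longrightarrow> m \<le> n \<Longrightarrow> l n k M \<cdot>\<^bsub>D\<^esub> \<Psi> m n k M = l m k M"
  using D.sequence_limitD(5)[OF lim] .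

lemma lim_additive: "additive_functor C D (Deg T' k)"
  unfolding additive_functor_def
proof (intro conjI ballI allI)
  fix A
  assume A [simp]: "A \<in> Obj C"
  show "fobj (Deg T' k) A \<in> Obj D"
    by simp
  show "fmap (Deg T' k) (Ident C A) = Ident D (fobj (Deg T' k) A)"
    by (rule lim_unique[OF A, of _ _ k]) (use lim_map(2)[of "Ident C A" k] in simp_all)
next
  fix A B f
  assume "f \<in> Hom C A B"
  then show "fmap (Deg T' k) f \<in> Hom D (fobj (Deg T' k) A) (fobj (Deg T' k) B)"
    by simp
next
  fix A B E f g
  assume "f \<in> Hom C A B" "g \<in> Hom C B E"
  then have fg [simp]: "f \<in> Arr C" "Src C f = A" "Tgt C f = B" "g \<in> Arr C" "Src C g = B" "Tgt C g = E"
    by simp_all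
  have [simp]: "A \<in> Obj C" "B \<in> Obj C" "E \<in> Obj C"
    using C.src_tgt_obj[of f] C.src_tgt_obj[of g] by simp_all
  show "fmap (Deg T' k) (g \<cdot>\<^bsub>C\<^esub> f) = fmap (Deg T' k) g \<cdot>\<^bsub>D\<^esub> fmap (Deg T' k) f"
  proof (rule lim_unique[of A _ _ k])
    fix m
    show "fmap (Deg T' k) (g \<cdot>\<^bsub>C\<^esub> f) \<cdot>\<^bsub>D\<^esub> l m k A =
      (fmap (Deg T' k) g \<cdot>\<^bsub>D\<^esub> fmap (Deg T' k) f) \<cdot>\<^bsub>D\<^esub> l m k A"
      using lim_map(2)[of "g \<cdot>\<^bsub>C\<^esub> f" k m] lim_map(2)[of f k m]
        D.reassoc[OF lim_map(2)[of g k m], of "fmap (Deg (Tr m) k) f"] by simp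
  qed simp_all
next
  fix A B f g
  assume "f \<in> Hom C A B" "g \<in> Hom C A B"
  then have fg [simp]: "f \<in> Arr C" "Src C f = A" "Tgt C f = B" "g \<in> Arr C" "Src C g = A" "Tgt C g = B"
    by simp_all
  have [simp]: "A \<in> Obj C" "B \<in> Obj C"
    using C.src_tgt_obj[of f] by simp_all
  show "fmap (Deg T' k) (Plus C f g) = Plus D (fmap (Deg T' k) f) (fmap (Deg T' k) g)"
  proof (rule lim_unique[of A _ _ k])
    fix m
    show "fmap (Deg T' k) (Plus C f g) \<cdot>\<^bsub>D\<^esub> l m k A =
      Plus D (fmap (Deg T' k) f) (fmap (Deg T' k) g) \<cdot>\<^bsub>D\<^esub> l m k A"
      using lim_map(2)[of "Plus C f g" k m] lim_map(2)[of f k m] lim_map(2)[of g k m] by simp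
  qed simp_all
qed

lemma map_system_morphism:
  assumes f [simp]: "f \<in> Arr C"
  shows "direct_system_morphism D UNIV nat_le (\<lambda>m. fobj (Deg (Tr m) k) (Src C f)) (\<lambda>m n. \<Psi> m n k (Src C f))
    (\<lambda>m. fobj (Deg (Tr m) k) (Tgt C f)) (\<lambda>m n. \<Psi> m n k (Tgt C f)) (\<lambda>m. fmap (Deg (Tr m) k) f)"
proof (rule D.sequence_morphismI)
  show "fmap (Deg (Tr n) k) f \<cdot>\<^bsub>D\<^esub> \<Psi> m n k (Src C f) = \<Psi> m n k (Tgt C f) \<cdot>\<^bsub>D\<^esub> fmap (Deg (Tr m) k) f"
    if "m \<le> n" for m n
    using cohom_morphismD(4)[OF \<Psi>[OF that] f] .
qed simp

lemma Conn_system_morphism: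
  assumes se: "short_exact C \<iota> \<pi>"
  shows "direct_system_morphism D UNIV nat_le (\<lambda>m. fobj (Deg (Tr m) k) (Tgt C \<pi>)) (\<lambda>m n. \<Psi> m n k (Tgt C \<pi>))
    (\<lambda>m. fobj (Deg (Tr m) (k + 1)) (Src C \<iota>)) (\<lambda>m n. \<Psi> m n (k + 1) (Src C \<iota>)) (\<lambda>m. Conn (Tr m) k \<iota> \<pi>)"
proof (rule D.sequence_morphismI)
  show "Conn (Tr n) k \<iota> \<pi> \<cdot>\<^bsub>D\<^esub> \<Psi> m n k (Tgt C \<pi>) = \<Psi> m n (k + 1) (Src C \<iota>) \<cdot>\<^bsub>D\<^esub> Conn (Tr m) k \<iota> \<pi>"
    if "m \<le> n" for m n
    using cohom_morphismD(5)[OF \<Psi>[OF that] se, of k] by simp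
qed (simp add: trunc.Conn_arr[OF se])

lemma lim_exact:
  assumes se: "short_exact C \<iota> \<pi>"
  shows "exact_pair D (fmap (Deg T' k) \<iota>) (fmap (Deg T' k) \<pi>)"
    "exact_pair D (fmap (Deg T' k) \<pi>) (Conn T' k \<iota> \<pi>)"
    "exact_pair D (Conn T' k \<iota> \<pi>) (fmap (Deg T' (k + 1)) \<iota>)"
proof -
  note S [simp] = C.short_exact_simps(1-3)[OF se] lim_Conn_simps[OF se]
  have AB: "Src C \<iota> \<in> Obj C" "Tgt C \<iota> \<in> Obj C" "Tgt C \<pi> \<in> Obj C"
    by (simp_all del: S(3))
  note m\<iota> = map_system_morphism[OF S(1)] and m\<pi> = map_system_morphism[OF S(2), folded S(3)]
    and mC = Conn_system_morphism[OF se] and ex = trunc.Conn_exact[OF se]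
  note limA = lim[OF AB(1)] and limB = lim[OF AB(2)] and limC = lim[OF AB(3)]
  show "exact_pair D (fmap (Deg T' k) \<iota>) (fmap (Deg T' k) \<pi>)"
    by (rule D.sequence_limit_exact[OF m\<iota>[of k] m\<pi>[of k] ex(1) limA limB limC])
      (use lim_map(2)[OF S(1), of k] lim_map(2)[OF S(2), of k] in simp_all)
  show "exact_pair D (fmap (Deg T' k) \<pi>) (Conn T' k \<iota> \<pi>)"
    by (rule D.sequence_limit_exact[OF m\<pi>[of k] mC[of k] ex(2) limB limC limA])
      (use lim_map(2)[OF S(2), of k] lim_Conn(2)[OF se, of k] in simp_all)
  show "exact_pair D (Conn T' k \<iota> \<pi>) (fmap (Deg T' (k + 1)) \<iota>)"
    by (rule D.sequence_limit_exact[OF mC[of k] m\<iota>[of "k + 1"] ex(3) limC limA limB])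
      (use lim_map(2)[OF S(1), of "k + 1"] lim_Conn(2)[OF se, of k] in simp_all)
qed

lemma lim_Conn_natural:
  assumes se: "short_exact C \<iota> \<pi>" "short_exact C \<iota>' \<pi>'"
    and a: "a \<in> Hom C (Src C \<iota>) (Src C \<iota>')" and b: "b \<in> Hom C (Tgt C \<iota>) (Tgt C \<iota>')"
    and c: "c \<in> Hom C (Tgt C \<pi>) (Tgt C \<pi>')"
    and eq: "b \<cdot>\<^bsub>C\<^esub> \<iota> = \<iota>' \<cdot>\<^bsub>C\<^esub> a" "c \<cdot>\<^bsub>C\<^esub> \<pi> = \<pi>' \<cdot>\<^bsub>C\<^esub> b"
  shows "Conn T' k \<iota>' \<pi>' \<cdot>\<^bsub>D\<^esub> fmap (Deg T' k) c = fmap (Deg T' (k + 1)) a \<cdot>\<^bsub>D\<^esub> Conn T' k \<iota> \<pi>"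
proof -
  note [simp] = C.short_exact_simps(1-3)[OF se(1)] C.short_exact_simps(1-3)[OF se(2)]
    lim_Conn_simps[OF se(1)] lim_Conn_simps[OF se(2)] trunc.Conn_arr[OF se(1)] trunc.Conn_arr[OF se(2)]
  have [simp]: "a \<in> Arr C" "Src C a = Src C \<iota>" "Tgt C a = Src C \<iota>'"
    "c \<in> Arr C" "Src C c = Tgt C \<pi>" "Tgt C c = Tgt C \<pi>'"
    using a c by simp_all
  show ?thesis
  proof (rule lim_unique[of "Tgt C \<pi>" _ _ k])
    fix m
    have "Conn (Tr m) k \<iota>' \<pi>' \<cdot>\<^bsub>D\<^esub> fmap (Deg (Tr m) k) c = fmap (Deg (Tr m) (k + 1)) a \<cdot>\<^bsub>D\<^esub> Conn (Tr m) k \<iota> \<pi>"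
      by (rule trunc.Conn_natural[OF se, of a b c]) (use a b c eq in simp_all)
    then show "(Conn T' k \<iota>' \<pi>' \<cdot>\<^bsub>D\<^esub> fmap (Deg T' k) c) \<cdot>\<^bsub>D\<^esub> l m k (Tgt C \<pi>)
        = (fmap (Deg T' (k + 1)) a \<cdot>\<^bsub>D\<^esub> Conn T' k \<iota> \<pi>) \<cdot>\<^bsub>D\<^esub> l m k (Tgt C \<pi>)"
      using lim_map(2)[of c k m] D.reassoc[OF lim_Conn(2)[OF se(2), of k m], of "fmap (Deg (Tr m) k) c"]
        lim_Conn(2)[OF se(1), of k m] D.reassoc[OF lim_map(2)[of a "k + 1" m], of "Conn (Tr m) k \<iota> \<pi>"]
      by simp
  qed simp_all
qed

lemma lim_cohomological: "cohomological_functor C D T'"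
  unfolding cohomological_functor_def
proof (intro conjI allI impI; (elim conjE)?)
  fix k \<iota> \<pi> \<iota>' \<pi>' a b c
  assume "short_exact C \<iota> \<pi>" "short_exact C \<iota>' \<pi>'" "a \<in> Hom C (Src C \<iota>) (Src C \<iota>')"
    "b \<in> Hom C (Tgt C \<iota>) (Tgt C \<iota>')" "c \<in> Hom C (Tgt C \<pi>) (Tgt C \<pi>')"
    "b \<cdot>\<^bsub>C\<^esub> \<iota> = \<iota>' \<cdot>\<^bsub>C\<^esub> a" "c \<cdot>\<^bsub>C\<^esub> \<pi> = \<pi>' \<cdot>\<^bsub>C\<^esub> b"
  then show "Conn T' k \<iota>' \<pi>' \<cdot>\<^bsub>D\<^esub> fmap (Deg T' k) c = fmap (Deg T' (k + 1)) a \<cdot>\<^bsub>D\<^esub> Conn T' k \<iota> \<pi>"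
    by (rule lim_Conn_natural)
qed (fact lim_additive lim_Conn(1) lim_exact)+

lemma lim_ftor: "cohom_ftor C D T'"
  by unfold_locales (rule lim_cohomological)

lemma lim_vanishes: "vanishes_on_projectives C D T'"
  unfolding vanishes_on_projectives_def
proof (intro allI impI)
  fix k P
  assume P: "projective C P"
  then have [simp]: "P \<in> Obj C"
    by (simp add: projective_def)
  have l0: "l m k P = ZeroMor D (fobj (Deg (Tr m) k) P) (fobj (Deg T' k) P)" for m
  proof -
    \<comment> \<open>An index at least \<open>m\<close> and beyond \<open>k\<close>: the source of
      \<open>l n\<close> at \<open>P\<close> is zero, and \<open>l m\<close> factors through
      \<open>l n\<close>. Taking \<open>nat (k + 1)\<close> also covers negative
      \<open>k\<close>.\<close>
    define n where "n = max m (nat (k + 1))"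
    have n: "m \<le> n" "k < int n"
      unfolding n_def by linarith+
    have "l n k P = ZeroMor D (fobj (Deg (Tr n) k) P) (fobj (Deg T' k) P)"
      using D.zero_object_arr(1)[OF trunc_projective[OF n(2) P], of "l n k P"] by simp
    then show ?thesis
      using lim_\<Psi>[of P m n k] n(1) cohom_morphismD(1-3)[OF \<Psi>[OF n(1)], of P k] by simp
  qed
  have "Ident D (fobj (Deg T' k) P) = ZeroMor D (fobj (Deg T' k) P) (fobj (Deg T' k) P)"
  proof (rule lim_unique[of P _ _ k])
    show "Ident D (fobj (Deg T' k) P) \<cdot>\<^bsub>D\<^esub> l m k P =
      ZeroMor D (fobj (Deg T' k) P) (fobj (Deg T' k) P) \<cdot>\<^bsub>D\<^esub> l m k P" for m
      using l0[of m] by simp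
  qed simp_all
  then show "zero_object D (fobj (Deg T' k) P)"
    by (simp add: D.zero_object_iff)
qed

lemma lim_morphism: "cohom_morphism C D (Tr m) T' (l m)"
proof (rule cohom_morphismI)
  fix k \<iota> \<pi>
  assume "short_exact C \<iota> \<pi>"
  then show "l m (k + 1) (Src C \<iota>) \<cdot>\<^bsub>D\<^esub> Conn (Tr m) k \<iota> \<pi> = Conn T' k \<iota> \<pi> \<cdot>\<^bsub>D\<^esub> l m k (Tgt C \<pi>)"
    using lim_Conn(2) by simp
qed (simp_all add: lim_map(2))

text \<open>The uniqueness clause asks for agreement with \<open>\<mu>\<close> only in degrees
  \<open>k \<ge> m\<close>: there \<open>\<Phi> m\<close> is the identity, so a condition on the
  composite with the canonical morphism is one on the composite with \<open>l m\<close>. Below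
  \<open>m\<close> agreement is forced by the vanishing of \<open>U\<close> on projectives.\<close>

lemma ex_factor:
  assumes U: "cohomological_functor C D U" and U0: "vanishes_on_projectives C D U"
    and \<mu>: "cohom_morphism C D T U \<mu>"
  obtains \<rho> where "cohom_morphism C D T' U \<rho>"
    "\<And>k M. M \<in> Obj C \<Longrightarrow> \<rho> k M \<cdot>\<^bsub>D\<^esub> (l 0 k M \<cdot>\<^bsub>D\<^esub> \<Phi> 0 k M) = \<mu> k M"
    "\<And>\<rho>' k M. cohom_morphism C D T' U \<rho>' \<Longrightarrow>
      (\<And>m k M. k \<ge> int m \<Longrightarrow> M \<in> Obj C \<Longrightarrow> \<rho>' k M \<cdot>\<^bsub>D\<^esub> l m k M = \<mu> k M) \<Longrightarrow> M \<in> Obj C \<Longrightarrow> \<rho>' k M = \<rho> k M"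
proof -
  interpret U: cohom_ftor C D U
    by unfold_locales (rule U)
  note ext = extension_vanishing[OF _ U U0]
  \<comment> \<open>\<open>T\<close> and \<open>T\<langle>m\<rangle>\<close> coincide from degree
    \<open>m\<close> on, so there \<open>\<mu>\<close> already is a morphism out of
    \<open>T\<langle>m\<rangle>\<close>.\<close>
  have \<mu>_from: "cohom_morphism_from C D (int m) (Tr m) U \<mu>" for m
    using \<mu>[unfolded cohom_morphism_iff_from, rule_format, of "int m"] unfolding cohom_morphism_from_def by simp
  have "\<exists>r. cohom_morphism C D (Tr m) U r \<and> (\<forall>k\<ge>int m. r k = \<mu> k)" for m
    using cohom_extension.cohom_morphism_extend[OF ext[OF trunc_ftor] \<mu>_from] by metis
  then obtain r where r: "\<And>m. cohom_morphism C D (Tr m) U (r m)" and r\<mu>: "\<And>m k. k \<ge> int m \<Longrightarrow> r m k = \<mu> k"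
    by metis
  note [simp] = cohom_morphismD(1-3)[OF r] cohom_morphismD(1-3)[OF \<mu>] cohom_morphismD(1-3)[OF \<Phi>]
  \<comment> \<open>Both sides are morphisms from \<open>T\<langle>m\<rangle>\<close> to
    \<open>U\<close> that equal \<open>\<mu>\<close> in degrees \<open>\<ge> n\<close>, where
    \<open>\<Psi> m n\<close> is the identity. So the \<open>r m\<close> form a cocone.\<close>
  have r\<Psi>: "r n k M \<cdot>\<^bsub>D\<^esub> \<Psi> m n k M = r m k M" if mn: "m \<le> n" and M: "M \<in> Obj C" for m n k M
  proof (rule cohom_extension.cohom_morphism_unique[OF ext[OF trunc_ftor], of m _ _ "int n"])
    show "cohom_morphism C D (Tr m) U (\<lambda>k M. r n k M \<cdot>\<^bsub>D\<^esub> \<Psi> m n k M)"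
      by (rule cohom_morphism_comp[OF trunc_ftor trunc_ftor U.cohom_ftor_axioms \<Psi>[OF mn] r])
    show "r n k M \<cdot>\<^bsub>D\<^esub> \<Psi> m n k M = r m k M" if "k \<ge> int n" "M \<in> Obj C" for k M
      using that mn \<Psi>_ident[OF mn that] r\<mu>[of n k] r\<mu>[of m k] by simp
  qed (use r M in simp_all)
  have ex_\<rho>: "\<exists>u. u \<in> Hom D (fobj (Deg T' k) M) (fobj (Deg U k) M) \<and> (\<forall>m. u \<cdot>\<^bsub>D\<^esub> l m k M = r m k M)"
    if M [simp]: "M \<in> Obj C" for k M
    by (rule D.sequence_limit_factor[OF lim[OF M, of k], of "fobj (Deg U k) M" "\<lambda>m. r m k M"])
      (auto simp: r\<Psi>)
  have "\<exists>\<rho>. \<forall>k M. M \<in> Obj C \<longrightarrow> \<rho> k M \<in> Hom D (fobj (Deg T' k) M) (fobj (Deg U k) M) \<and>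
    (\<forall>m. \<rho> k M \<cdot>\<^bsub>D\<^esub> l m k M = r m k M)"
    by (intro Hilbert_Choice.choice allI) (use ex_\<rho> in blast)
  then obtain \<rho> where \<rho>: "\<And>k M. M \<in> Obj C \<Longrightarrow> \<rho> k M \<in> Hom D (fobj (Deg T' k) M) (fobj (Deg U k) M) \<and>
    (\<forall>m. \<rho> k M \<cdot>\<^bsub>D\<^esub> l m k M = r m k M)"
    by blast
  then have \<rho>S [simp]: "M \<in> Obj C \<Longrightarrow> \<rho> k M \<in> Arr D" "M \<in> Obj C \<Longrightarrow> Src D (\<rho> k M) = fobj (Deg T' k) M"
    "M \<in> Obj C \<Longrightarrow> Tgt D (\<rho> k M) = fobj (Deg U k) M"
    and \<rho>l: "M \<in> Obj C \<Longrightarrow> \<rho> k M \<cdot>\<^bsub>D\<^esub> l m k M = r m k M" for k m M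
    by simp_all
  show ?thesis
  proof (rule that)
    show "cohom_morphism C D T' U \<rho>"
    proof (rule cohom_morphismI)
      fix k f
      assume f [simp]: "f \<in> Arr C"
      show "fmap (Deg U k) f \<cdot>\<^bsub>D\<^esub> \<rho> k (Src C f) = \<rho> k (Tgt C f) \<cdot>\<^bsub>D\<^esub> fmap (Deg T' k) f"
      proof (rule lim_unique[of "Src C f" _ _ k])
        fix m
        show "(fmap (Deg U k) f \<cdot>\<^bsub>D\<^esub> \<rho> k (Src C f)) \<cdot>\<^bsub>D\<^esub> l m k (Src C f) =
          (\<rho> k (Tgt C f) \<cdot>\<^bsub>D\<^esub> fmap (Deg T' k) f) \<cdot>\<^bsub>D\<^esub> l m k (Src C f)"
          using \<rho>l[of "Src C f" k m] lim_map(2)[OF f, of k m] cohom_morphismD(4)[OF r f, of k m]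
            D.reassoc[OF \<rho>l[of "Tgt C f" k m], of "fmap (Deg (Tr m) k) f"] by simp
      qed simp_all
    next
      fix k \<iota> \<pi>
      assume se: "short_exact C \<iota> \<pi>"
      note [simp] = C.short_exact_simps(1-3)[OF se] U.Conn_arr[OF se] trunc.Conn_arr[OF se] lim_Conn_simps[OF se]
      show "\<rho> (k + 1) (Src C \<iota>) \<cdot>\<^bsub>D\<^esub> Conn T' k \<iota> \<pi> = Conn U k \<iota> \<pi> \<cdot>\<^bsub>D\<^esub> \<rho> k (Tgt C \<pi>)"
      proof (rule lim_unique[of "Tgt C \<pi>" _ _ k])
        fix m
        show "(\<rho> (k + 1) (Src C \<iota>) \<cdot>\<^bsub>D\<^esub> Conn T' k \<iota> \<pi>) \<cdot>\<^bsub>D\<^esub> l m k (Tgt C \<pi>) =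
          (Conn U k \<iota> \<pi> \<cdot>\<^bsub>D\<^esub> \<rho> k (Tgt C \<pi>)) \<cdot>\<^bsub>D\<^esub> l m k (Tgt C \<pi>)"
          using \<rho>l[of "Tgt C \<pi>" k m] lim_Conn(2)[OF se, of k m] cohom_morphismD(5)[OF r se, of m k]
            D.reassoc[OF \<rho>l[of "Src C \<iota>" "k + 1" m], of "Conn (Tr m) k \<iota> \<pi>"] by simp
      qed simp_all
    qed simp
  next
    fix k M
    assume M [simp]: "M \<in> Obj C"
    \<comment> \<open>Index 0 suffices: in degrees \<open>\<ge> 0\<close> both sides are
      \<open>\<mu>\<close>, and uniqueness carries this to negative degrees.\<close>
    have "r 0 k M \<cdot>\<^bsub>D\<^esub> \<Phi> 0 k M = \<mu> k M"
    proof (rule cohom_extension.cohom_morphism_unique[OF ext[OF cohom_ftor_axioms], of _ _ 0])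
      show "cohom_morphism C D T U (\<lambda>k M. r 0 k M \<cdot>\<^bsub>D\<^esub> \<Phi> 0 k M)"
        by (rule cohom_morphism_comp[OF cohom_ftor_axioms trunc_ftor U.cohom_ftor_axioms \<Phi> r])
      show "r 0 k M \<cdot>\<^bsub>D\<^esub> \<Phi> 0 k M = \<mu> k M" if "k \<ge> 0" "M \<in> Obj C" for k M
        using that \<Phi>_ident[of 0 k M] r\<mu>[of 0 k] by simp
    qed (use \<mu> M in simp_all)
    then show "\<rho> k M \<cdot>\<^bsub>D\<^esub> (l 0 k M \<cdot>\<^bsub>D\<^esub> \<Phi> 0 k M) = \<mu> k M"
      using D.reassoc[OF \<rho>l[OF M, of k 0], of "\<Phi> 0 k M"] by simp
  next
    fix \<rho>' k M
    assume \<rho>': "cohom_morphism C D T' U \<rho>'"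
      and eq: "\<And>m k M. k \<ge> int m \<Longrightarrow> M \<in> Obj C \<Longrightarrow> \<rho>' k M \<cdot>\<^bsub>D\<^esub> l m k M = \<mu> k M"
      and M [simp]: "M \<in> Obj C"
    note [simp] = cohom_morphismD(1-3)[OF \<rho>']
    \<comment> \<open>Both sides agree with \<open>\<mu>\<close> from degree \<open>m\<close> on and
      hence everywhere; as the \<open>l m\<close> jointly determine maps out of the limit,
      \<open>\<rho>'\<close> equals \<open>\<rho>\<close>.\<close>
    have "\<rho>' k M \<cdot>\<^bsub>D\<^esub> l m k M = r m k M" for m
    proof (rule cohom_extension.cohom_morphism_unique[OF ext[OF trunc_ftor], of m _ _ "int m"])
      show "cohom_morphism C D (Tr m) U (\<lambda>k M. \<rho>' k M \<cdot>\<^bsub>D\<^esub> l m k M)"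
        by (rule cohom_morphism_comp[OF trunc_ftor lim_ftor U.cohom_ftor_axioms lim_morphism \<rho>'])
    qed (use r r\<mu> eq M in simp_all)
    then show "\<rho>' k M = \<rho> k M"
      by (rule_tac lim_unique[OF M, of _ _ k]) (simp_all add: \<rho>l)
  qed
qed

text \<open>\<open>\<nu>\<close> is \<open>l m\<close> after \<open>\<Phi> m\<close> for every
  \<open>m\<close> at once. Index 0 shows that it is a morphism, while in degree \<open>k\<close>
  each \<open>m\<close> with \<open>int m \<le> k\<close> gives \<open>\<nu> = l m\<close>, the form
  in which \<open>ex_factor\<close> wants its uniqueness condition.\<close>

lemma lim_mislin_completion:
  assumes \<nu>: "\<And>m k M. M \<in> Obj C \<Longrightarrow> \<nu> k M = l m k M \<cdot>\<^bsub>D\<^esub> \<Phi> m k M"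
  shows "mislin_completion C D T T' \<nu>"
proof -
  have "cohom_morphism C D T T' (\<lambda>k M. l 0 k M \<cdot>\<^bsub>D\<^esub> \<Phi> 0 k M)"
    by (rule cohom_morphism_comp[OF cohom_ftor_axioms trunc_ftor lim_ftor \<Phi> lim_morphism])
  then have "cohom_morphism C D T T' \<nu>"
    by (rule cohom_morphism_cong[rotated]) (simp_all add: \<nu>[of _ _ 0] C.category_axioms)
  moreover have "\<exists>\<rho>. cohom_morphism C D T' U \<rho> \<and> (\<forall>n. \<forall>M\<in>Obj C. \<rho> n M \<cdot>\<^bsub>D\<^esub> \<nu> n M = \<mu> n M) \<and>
          (\<forall>\<rho>'. cohom_morphism C D T' U \<rho>' \<and>
             (\<forall>n. \<forall>M\<in>Obj C. \<rho>' n M \<cdot>\<^bsub>D\<^esub> \<nu> n M = \<mu> n M) \<longrightarrow>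
             (\<forall>n. \<forall>M\<in>Obj C. \<rho>' n M = \<rho> n M))"
    if U: "cohomological_functor C D U \<and> vanishes_on_projectives C D U \<and> cohom_morphism C D T U \<mu>" for U \<mu>
  proof -
    obtain \<rho> where \<rho>: "cohom_morphism C D T' U \<rho>"
      "\<And>k M. M \<in> Obj C \<Longrightarrow> \<rho> k M \<cdot>\<^bsub>D\<^esub> (l 0 k M \<cdot>\<^bsub>D\<^esub> \<Phi> 0 k M) = \<mu> k M"
      and uniq: "\<And>\<rho>' k M. cohom_morphism C D T' U \<rho>' \<Longrightarrow>
        (\<And>m k M. k \<ge> int m \<Longrightarrow> M \<in> Obj C \<Longrightarrow> \<rho>' k M \<cdot>\<^bsub>D\<^esub> l m k M = \<mu> k M) \<Longrightarrow> M \<in> Obj C \<Longrightarrow> \<rho>' k M = \<rho> k M"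
      using ex_factor[of U \<mu>] U by blast
    have l\<mu>: "\<rho>' k M \<cdot>\<^bsub>D\<^esub> l m k M = \<mu> k M"
      if "cohom_morphism C D T' U \<rho>'" "\<forall>n. \<forall>M\<in>Obj C. \<rho>' n M \<cdot>\<^bsub>D\<^esub> \<nu> n M = \<mu> n M"
        and k: "k \<ge> int m" and M: "M \<in> Obj C" for \<rho>' m k M
    proof -
      have "\<nu> k M = l m k M"
        using \<nu>[OF M, of k m] \<Phi>_ident[OF k M] M lim_simps(2,3)[OF M, of m k] trunc_high(1)[OF k] by simp
      then show ?thesis
        using that(2)[rule_format, OF M, of k] by simp
    qed
    show ?thesis
    proof (intro exI[of _ \<rho>] conjI allI ballI impI; (elim conjE)?)
      fix n M
      assume M: "M \<in> Obj C"
      show "\<rho> n M \<cdot>\<^bsub>D\<^esub> \<nu> n M = \<mu> n M"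
        using \<rho>(2)[OF M, of n] \<nu>[OF M, of n 0] by simp
      fix \<rho>'
      assume "cohom_morphism C D T' U \<rho>'" "\<forall>n. \<forall>M\<in>Obj C. \<rho>' n M \<cdot>\<^bsub>D\<^esub> \<nu> n M = \<mu> n M"
      then show "\<rho>' n M = \<rho> n M"
        using uniq[of \<rho>' M n] l\<mu> M by blast
    qed (rule \<rho>(1))
  qed
  ultimately show ?thesis
    unfolding mislin_completion_def using lim_cohomological lim_vanishes by blast
qed

end

section \<open>The satellite construction: completeness and existence\<close>

context satellite_limits
begin

lemma satellite_construction_mislin:
  assumes "satellite_construction C D i p \<kappa> T T' \<nu>"
  shows "mislin_completion C D T T' \<nu>"
proof -
  obtain \<Phi> \<Psi> l where
    1: "\<forall>m. cohom_morphism C D T (Tr m) (\<Phi> m) \<and>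
           (\<forall>k\<ge>int m. \<forall>M\<in>Obj C. \<Phi> m k M = Ident D (fobj (Deg T k) M))"
    and 2: "\<forall>m n. m \<le> n \<longrightarrow> cohom_morphism C D (Tr m) (Tr n) (\<Psi> m n) \<and>
           (\<forall>k\<ge>int n. \<forall>M\<in>Obj C. \<Psi> m n k M = Ident D (fobj (Deg T k) M))"
    and 3: "\<forall>k. \<forall>M\<in>Obj C. is_direct_limit D UNIV nat_le
           (\<lambda>m. fobj (Deg (Tr m) k) M) (\<lambda>m n. \<Psi> m n k M) (fobj (Deg T' k) M) (\<lambda>m. l m k M)"
    and 4: "\<forall>k A B. \<forall>f\<in>Hom C A B. fmap (Deg T' k) f \<in> Hom D (fobj (Deg T' k) A) (fobj (Deg T' k) B) \<and>
           (\<forall>m. fmap (Deg T' k) f \<cdot>\<^bsub>D\<^esub> l m k A = l m k B \<cdot>\<^bsub>D\<^esub> fmap (Deg (Tr m) k) f)"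
    and 5: "\<forall>k \<iota> \<pi>. short_exact C \<iota> \<pi> \<longrightarrow>
           Conn T' k \<iota> \<pi> \<in> Hom D (fobj (Deg T' k) (Tgt C \<pi>)) (fobj (Deg T' (k + 1)) (Src C \<iota>)) \<and>
           (\<forall>m. Conn T' k \<iota> \<pi> \<cdot>\<^bsub>D\<^esub> l m k (Tgt C \<pi>)
              = l m (k + 1) (Src C \<iota>) \<cdot>\<^bsub>D\<^esub> Conn (Tr m) k \<iota> \<pi>)"
    and 6: "\<forall>m k. \<forall>M\<in>Obj C. \<nu> k M = l m k M \<cdot>\<^bsub>D\<^esub> \<Phi> m k M"
    using assms unfolding satellite_construction_def Let_def by (elim exE conjE) (rule that)
  interpret satellite_limit C D i p \<kappa> T T' \<Phi> \<Psi> l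
  proof unfold_locales
    fix f k m
    assume "f \<in> Arr C"
    then have "f \<in> Hom C (Src C f) (Tgt C f)"
      by simp
    then show "fmap (Deg T' k) f \<in> Hom D (fobj (Deg T' k) (Src C f)) (fobj (Deg T' k) (Tgt C f))"
      "fmap (Deg T' k) f \<cdot>\<^bsub>D\<^esub> l m k (Src C f) = l m k (Tgt C f) \<cdot>\<^bsub>D\<^esub> fmap (Deg (Tr m) k) f"
      using 4 by blast+
  qed (use 1 2 3 5 in blast)+
  show ?thesis
    using lim_mislin_completion 6 by blast
qed

text \<open>Limits are picked separately for each degree and object, and the induced maps for each
  morphism and short exact sequence. The relation records only their equations with
  \<open>l\<close>; that \<open>T'\<close> is a cohomological functor is left to the lemmas on an
  arbitrary limit.\<close>

lemma ex_satellite_construction: "\<exists>T' \<nu>. satellite_construction C D i p \<kappa> T T' \<nu>"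
proof -
  have "\<exists>\<nu>. cohom_morphism C D T (Tr m) \<nu> \<and> (\<forall>k\<ge>int m. \<forall>M\<in>Obj C. \<nu> k M = Ident D (fobj (Deg T k) M))" for m
    by (rule ex_to_trunc[OF cohom_ftor_axioms]) simp_all
  then obtain \<Phi> where \<Phi>: "\<And>m. cohom_morphism C D T (Tr m) (\<Phi> m)"
    and \<Phi>_ident: "\<And>m k M. k \<ge> int m \<Longrightarrow> M \<in> Obj C \<Longrightarrow> \<Phi> m k M = Ident D (fobj (Deg T k) M)"
    by metis
  have "\<exists>\<nu>. cohom_morphism C D (Tr m) (Tr n) \<nu> \<and> (\<forall>k\<ge>int n. \<forall>M\<in>Obj C. \<nu> k M = Ident D (fobj (Deg T k) M))"
    if "m \<le> n" for m n
    by (rule ex_to_trunc[OF trunc_ftor]) (use that in simp_all)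
  then obtain \<Psi> where \<Psi>: "\<And>m n. m \<le> n \<Longrightarrow> cohom_morphism C D (Tr m) (Tr n) (\<Psi> m n)"
    and \<Psi>_ident: "\<And>m n k M. m \<le> n \<Longrightarrow> k \<ge> int n \<Longrightarrow> M \<in> Obj C \<Longrightarrow> \<Psi> m n k M = Ident D (fobj (Deg T k) M)"
    by metis
  note \<Phi>S [simp] = cohom_morphismD(1-3)[OF \<Phi>] and \<Psi>S [simp] = cohom_morphismD(1-3)[OF \<Psi>]
  \<comment> \<open>All identities among transition maps follow from one fact: two morphisms into
    \<open>T\<langle>n\<rangle>\<close> that agree from degree \<open>n\<close> on are
    equal.\<close>
  note unique = cohom_extension.cohom_morphism_unique[OF extension_trunc]
  have \<Psi>_refl: "\<Psi> m m k M = Ident D (fobj (Deg (Tr m) k) M)" if "M \<in> Obj C" for m k M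
    by (rule unique[OF trunc_ftor \<Psi> trunc.cohom_morphism_ident]) (use that \<Psi>_ident in simp_all)
  have \<Psi>_comp: "\<Psi> n q k M \<cdot>\<^bsub>D\<^esub> \<Psi> m n k M = \<Psi> m q k M" if mn: "m \<le> n" and nq: "n \<le> q" and M: "M \<in> Obj C" for m n q k M
  proof (rule unique[OF trunc_ftor cohom_morphism_comp[OF trunc_ftor trunc_ftor trunc_ftor \<Psi> \<Psi>] \<Psi>])
    show "\<Psi> n q k M \<cdot>\<^bsub>D\<^esub> \<Psi> m n k M = \<Psi> m q k M" if "int q \<le> k" "M \<in> Obj C" for k M
      using that mn nq \<Psi>_ident[of m n k M] \<Psi>_ident[of n q k M] \<Psi>_ident[of m q k M] by simp
  qed (use mn nq M in simp_all)
  have \<Psi>\<Phi>: "\<Psi> 0 m k M \<cdot>\<^bsub>D\<^esub> \<Phi> 0 k M = \<Phi> m k M" if M: "M \<in> Obj C" for m k M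
  proof (rule unique[OF cohom_ftor_axioms cohom_morphism_comp[OF cohom_ftor_axioms trunc_ftor trunc_ftor \<Phi> \<Psi>] \<Phi>])
    show "\<Psi> 0 m k M \<cdot>\<^bsub>D\<^esub> \<Phi> 0 k M = \<Phi> m k M" if "int m \<le> k" "M \<in> Obj C" for k M
      using that \<Psi>_ident[of 0 m k M] \<Phi>_ident[of 0 k M] \<Phi>_ident[of m k M] by simp
  qed (use M in simp_all)
  have "direct_system D UNIV nat_le (\<lambda>m. fobj (Deg (Tr m) k) M) (\<lambda>m n. \<Psi> m n k M)" if "M \<in> Obj C" for k M
    by (rule D.sequence_systemI) (use that \<Psi>_refl \<Psi>_comp in simp_all)
  then have ex_lim: "\<exists>L l. is_direct_limit D UNIV nat_le (\<lambda>m. fobj (Deg (Tr m) k) M) (\<lambda>m n. \<Psi> m n k M) L l"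
    if "M \<in> Obj C" for k M
    using D.ex_sequence_limit that by blast
  \<comment> \<open>The object of a limit and its maps have to be chosen together, hence a choice of
    pairs.\<close>
  have "\<exists>Ll. \<forall>k M. M \<in> Obj C \<longrightarrow>
    is_direct_limit D UNIV nat_le (\<lambda>m. fobj (Deg (Tr m) k) M) (\<lambda>m n. \<Psi> m n k M) (fst (Ll k M)) (snd (Ll k M))"
    by (intro Hilbert_Choice.choice allI) (use ex_lim in simp)
  then obtain Ll where "\<forall>k M. M \<in> Obj C \<longrightarrow>
    is_direct_limit D UNIV nat_le (\<lambda>m. fobj (Deg (Tr m) k) M) (\<lambda>m n. \<Psi> m n k M) (fst (Ll k M)) (snd (Ll k M))"
    by blast
  then obtain L l where lim: "\<And>k M. M \<in> Obj C \<Longrightarrow>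
    is_direct_limit D UNIV nat_le (\<lambda>m. fobj (Deg (Tr m) k) M) (\<lambda>m n. \<Psi> m n k M) (L k M) (l k M)"
    using that[of "\<lambda>k M. fst (Ll k M)" "\<lambda>k M. snd (Ll k M)"] by blast
  note limS [simp] = D.sequence_limitD(1-4)[OF lim]
  have ex_FM: "\<exists>u. u \<in> Hom D (L k (Src C f)) (L k (Tgt C f)) \<and>
    (\<forall>m. u \<cdot>\<^bsub>D\<^esub> l k (Src C f) m = l k (Tgt C f) m \<cdot>\<^bsub>D\<^esub> fmap (Deg (Tr m) k) f)"
    if f [simp]: "f \<in> Arr C" for k f
  proof -
    have "direct_system_morphism D UNIV nat_le (\<lambda>m. fobj (Deg (Tr m) k) (Src C f)) (\<lambda>m n. \<Psi> m n k (Src C f))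
      (\<lambda>m. fobj (Deg (Tr m) k) (Tgt C f)) (\<lambda>m n. \<Psi> m n k (Tgt C f)) (\<lambda>m. fmap (Deg (Tr m) k) f)"
      by (rule D.sequence_morphismI) (use cohom_morphismD(4)[OF \<Psi> f] in simp_all)
    from D.sequence_limit_map[OF this lim lim] show ?thesis
      by auto
  qed
  have "\<exists>FM. \<forall>k f. f \<in> Arr C \<longrightarrow> FM k f \<in> Hom D (L k (Src C f)) (L k (Tgt C f)) \<and>
    (\<forall>m. FM k f \<cdot>\<^bsub>D\<^esub> l k (Src C f) m = l k (Tgt C f) m \<cdot>\<^bsub>D\<^esub> fmap (Deg (Tr m) k) f)"
    by (intro Hilbert_Choice.choice allI) (use ex_FM in blast)
  then obtain FM where FM: "\<And>k f. f \<in> Arr C \<Longrightarrow> FM k f \<in> Hom D (L k (Src C f)) (L k (Tgt C f)) \<and>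
    (\<forall>m. FM k f \<cdot>\<^bsub>D\<^esub> l k (Src C f) m = l k (Tgt C f) m \<cdot>\<^bsub>D\<^esub> fmap (Deg (Tr m) k) f)"
    by blast
  have ex_CN: "\<exists>u. u \<in> Hom D (L k (Tgt C \<pi>)) (L (k + 1) (Src C \<iota>)) \<and>
    (\<forall>m. u \<cdot>\<^bsub>D\<^esub> l k (Tgt C \<pi>) m = l (k + 1) (Src C \<iota>) m \<cdot>\<^bsub>D\<^esub> Conn (Tr m) k \<iota> \<pi>)"
    if se: "short_exact C \<iota> \<pi>" for k \<iota> \<pi>
  proof -
    note [simp] = C.short_exact_simps(1-3)[OF se] trunc.Conn_arr[OF se]
    have "direct_system_morphism D UNIV nat_le (\<lambda>m. fobj (Deg (Tr m) k) (Tgt C \<pi>)) (\<lambda>m n. \<Psi> m n k (Tgt C \<pi>))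
      (\<lambda>m. fobj (Deg (Tr m) (k + 1)) (Src C \<iota>)) (\<lambda>m n. \<Psi> m n (k + 1) (Src C \<iota>)) (\<lambda>m. Conn (Tr m) k \<iota> \<pi>)"
      by (rule D.sequence_morphismI) (use cohom_morphismD(5)[OF \<Psi> se] in simp_all)
    from D.sequence_limit_map[OF this lim lim] show ?thesis
      by auto
  qed
  have "\<exists>CN. \<forall>k \<iota> \<pi>. short_exact C \<iota> \<pi> \<longrightarrow> CN k \<iota> \<pi> \<in> Hom D (L k (Tgt C \<pi>)) (L (k + 1) (Src C \<iota>)) \<and>
    (\<forall>m. CN k \<iota> \<pi> \<cdot>\<^bsub>D\<^esub> l k (Tgt C \<pi>) m = l (k + 1) (Src C \<iota>) m \<cdot>\<^bsub>D\<^esub> Conn (Tr m) k \<iota> \<pi>)"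
    by (intro Hilbert_Choice.choice allI) (use ex_CN in blast)
  then obtain CN where CN: "\<And>k \<iota> \<pi>. short_exact C \<iota> \<pi> \<Longrightarrow> CN k \<iota> \<pi> \<in> Hom D (L k (Tgt C \<pi>)) (L (k + 1) (Src C \<iota>)) \<and>
    (\<forall>m. CN k \<iota> \<pi> \<cdot>\<^bsub>D\<^esub> l k (Tgt C \<pi>) m = l (k + 1) (Src C \<iota>) m \<cdot>\<^bsub>D\<^esub> Conn (Tr m) k \<iota> \<pi>)"
    by blast
  define T' where "T' = \<lparr>Deg = (\<lambda>k. \<lparr>fobj = L k, fmap = FM k\<rparr>), Conn = CN\<rparr>"
  have T'S: "fobj (Deg T' k) = L k" "fmap (Deg T' k) = FM k" "Conn T' = CN" for k
    by (simp_all add: T'_def)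
  \<comment> \<open>Defined through index 0, the canonical morphism is the same through every index,
    since \<open>\<Phi> m\<close> is \<open>\<Psi> 0 m\<close> after
    \<open>\<Phi> 0\<close>.\<close>
  have \<nu>: "l k M 0 \<cdot>\<^bsub>D\<^esub> \<Phi> 0 k M = l k M m \<cdot>\<^bsub>D\<^esub> \<Phi> m k M" if M [simp]: "M \<in> Obj C" for m k M
    using D.reassoc[OF D.sequence_limitD(5)[OF lim[OF M, of k], of 0 m], of "\<Phi> 0 k M"] \<Psi>\<Phi>[OF M, of m k] by simp
  have "satellite_construction C D i p \<kappa> T T' (\<lambda>k M. l k M 0 \<cdot>\<^bsub>D\<^esub> \<Phi> 0 k M)"
    unfolding satellite_construction_def Let_def T'S
  proof (rule exI[of _ \<Phi>], rule exI[of _ \<Psi>], rule exI[of _ "\<lambda>m k M. l k M m"], intro conjI allI impI ballI)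
    fix k A B f m
    assume "f \<in> Hom C A B"
    then have "f \<in> Arr C" and [simp]: "Src C f = A" "Tgt C f = B"
      by simp_all
    then show "FM k f \<in> Hom D (L k A) (L k B)"
      "FM k f \<cdot>\<^bsub>D\<^esub> l k A m = l k B m \<cdot>\<^bsub>D\<^esub> fmap (Deg (Tr m) k) f"
      using FM[of f k] by simp_all
  next
    fix k \<iota> \<pi> m
    assume "short_exact C \<iota> \<pi>"
    then show "CN k \<iota> \<pi> \<in> Hom D (L k (Tgt C \<pi>)) (L (k + 1) (Src C \<iota>))"
      "CN k \<iota> \<pi> \<cdot>\<^bsub>D\<^esub> l k (Tgt C \<pi>) m = l (k + 1) (Src C \<iota>) m \<cdot>\<^bsub>D\<^esub> Conn (Tr m) k \<iota> \<pi>"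
      using CN by blast+
  qed (fact \<Phi> | (rule \<Phi>_ident \<Psi> \<Psi>_ident lim \<nu>; assumption))+
  then show ?thesis
    by blast
qed

end

lemma (in two_abelian) ex_satellite_choice:
  assumes "enough_projectives C"
  shows "\<exists>i p \<kappa>. satellite_choice C D i p \<kappa>"
proof -
  have "\<exists>i p. short_exact C i p \<and> Tgt C p = M \<and> projective C (Src C p)" if M: "M \<in> Obj C" for M
  proof -
    obtain e where e: "epi_mor C e" "Tgt C e = M" "projective C (Src C e)"
      using assms M unfolding enough_projectives_def by blast
    then show ?thesis
      using C.ex_kernel C.short_exact_kernelI C.epi_mor_arr by metis
  qed
  then obtain i p where "\<And>M. M \<in> Obj C \<Longrightarrow> short_exact C (i M) (p M) \<and> Tgt C (p M) = M \<and> projective C (Src C (p M))"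
    by metis
  moreover obtain \<kappa> where "\<And>f. f \<in> Arr D \<Longrightarrow> is_kernel D f (\<kappa> f)"
    using D.ex_kernel by metis
  ultimately have "satellite_choice C D i p \<kappa>"
    unfolding satellite_choice_def by blast
  then show ?thesis
    by blast
qed

theorem theorem3p2:
  fixes C :: "('o, 'm) ab_cat" and D :: "('p, 'q) ab_cat"
    and T :: "('o, 'm, 'p, 'q) cohom"
  assumes "abelian_category C" and "enough_projectives C"
    and "abelian_category D"
    and "has_direct_limits TYPE('i::infinite) D" and "exact_direct_limits TYPE('i) D"
    and "cohomological_functor C D T"
  shows "(\<exists>T' \<nu>. mislin_completion C D T T' \<nu>) \<and>
    (\<exists>i p \<kappa>. satellite_choice C D i p \<kappa>) \<and>
    (\<forall>i p \<kappa>. satellite_choice C D i p \<kappa> \<longrightarrow>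
       (\<exists>T' \<nu>. satellite_construction C D i p \<kappa> T T' \<nu>) \<and>
       (\<forall>T' \<nu>. satellite_construction C D i p \<kappa> T T' \<nu> \<longrightarrow> mislin_completion C D T T' \<nu>))"
proof -
  \<comment> \<open>The construction takes limits of sequences; an infinite index type contains a
    copy of nat, so both assumptions on limits transfer to sequences.\<close>
  obtain f :: "nat \<Rightarrow> 'i" where f: "inj f"
    using infinite_countable_subset[OF infinite_UNIV] by blast
  interpret two_abelian C D
    using assms unfolding two_abelian_def by blast
  have lims: "satellite_limits C D i p \<kappa> T" if "satellite_choice C D i p \<kappa>" for i p \<kappa>
  proof (unfold_locales)
    show "has_direct_limits TYPE(nat) D" "exact_direct_limits TYPE(nat) D"
      using has_direct_limits_inj[OF f] exact_direct_limits_inj[OF f] assms by blast+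
  qed (use that assms in simp_all)
  \<comment> \<open>The plain existence of a completion is the construction carried out for one such
    choice.\<close>
  have choice: "\<exists>i p \<kappa>. satellite_choice C D i p \<kappa>"
    using ex_satellite_choice assms(2) .
  show ?thesis
    using choice lims satellite_limits.ex_satellite_construction satellite_limits.satellite_construction_mislin
    by metis
qed

end
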